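(* Let $0<p\le\infty$, $r,s\in\mathbb{N}$, $0<\alpha<r$, $\alpha\le s$, $p_1=\min(p,1)$, and let $f\in H_p^{r,\alpha}$. There exists a constant $L>0$ such that for any $n\in\mathbb{N}$ $$\theta_{s,\alpha}\left(f,\tfrac1n\right)_p\le L\,E_n(f)_{H_p^{r,\alpha}}$$ if and only if for some $k\in\mathbb{N}$ with $k>s+\frac1{p_1}-1$ there exists a constant $M>0$ such that for any $h\in(0,1]$ $$\theta_{s,\alpha}(f,h)_p\le M\,\theta_{k,\alpha}(f,h)_p .$$ (The constants $L$ and $M$ may depend on $f$.)
   Context: $\mathbb{T}\cong[0,2\pi)$ is the torus; functions are complex-valued and $2\pi$-periodic. For $0<p<\infty$, $L_p=L_p(\mathbb{T})$ is the space of measurable functions with $\|f\|_p=\left(\frac1{2\pi}\int_{\mathbb{T}}|f(x)|^p\,dx\right)^{1/p}<\infty$; $L_\infty$ denotes the space of $2\pi$-periodic continuous functions with $\|f\|_\infty=\max|f|$. For $k\in\mathbb{N}=\{1,2,\dots\}$: $\Delta_\delta^k f(x)=\sum_{\nu=0}^k(-1)^\nu\binom k\nu f(x+\nu\delta)$ and $\omega_k(f,t)_p=\sup_{0<\delta<t}\|\Delta_\delta^kf\|_p$. For $0<p\le\infty$, $r\in\mathbb{N}$, $0<\alpha\le r$: $f\in H_p^{r,\alpha}$ if $f\in L_p$ and $\|f\|_{H_p^{r,\alpha}}=\|f\|_p+|f|_{H_p^{r,\alpha}}<\infty$, where $|f|_{H_p^{r,\alpha}}=\sup_{h>0}h^{-\alpha}\|\Delta_h^rf\|_p$.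 $\mathcal{T}_n$ is the set of trigonometric polynomials $\sum_{\nu=-n}^nc_\nu e^{i\nu x}$, $c_\nu\in\mathbb{C}$, and $E_n(f)_{H_p^{r,\alpha}}=\inf_{T\in\mathcal{T}_n}\|f-T\|_{H_p^{r,\alpha}}$. Further, $\theta_{k,\alpha}(f,\delta)_p=\sup_{0<h\le\delta}h^{-\alpha}\omega_k(f,h)_p$. *)

theory Defs
  imports "HOL-Analysis.Analysis"
begin

text \<open>
  Functions on the torus are represented by \<open>2\<pi>\<close>-periodic functions on the real line.
  All (quasi-)norms, moduli and suprema take values in \<^typ>\<open>ennreal\<close>: a supremum such as
  the one defining \<open>\<theta>\<close> can genuinely be infinite, and a real-valued \<open>Sup\<close> would be
  meaningless there.
\<close>

definition periodic_2pi :: "(real \<Rightarrow> complex) \<Rightarrow> bool" where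
  "periodic_2pi f \<longleftrightarrow> (\<forall>x. f (x + 2 * pi) = f x)"

text \<open>
  The real function \<open>powr\<close> is applied to the \<open>p\<close>-th power mean only when the latter is finite.
  For \<open>p = \<infinity>\<close> the norm is the supremum of \<open>\<bar>f\<bar>\<close>, attained for continuous periodic \<open>f\<close>.
\<close>

definition Lp_norm :: "ennreal \<Rightarrow> (real \<Rightarrow> complex) \<Rightarrow> ennreal" where
  "Lp_norm p f =
     (if p = \<infinity> then (SUP x. ennreal (norm (f x)))
      else (let I = (\<integral>\<^sup>+x\<in>{0..<2 * pi}. ennreal (norm (f x) powr enn2real p) \<partial>lebesgue)
                      / ennreal (2 * pi)
            in if I = \<infinity> then \<infinity> else ennreal (enn2real I powr (1 / enn2real p))))"

definition Lp :: "ennreal \<Rightarrow> (real \<Rightarrow> complex) set" where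
  "Lp p = {f. periodic_2pi f \<and>
              (if p = \<infinity> then continuous_on UNIV f
               else f \<in> borel_measurable lebesgue \<and> Lp_norm p f < \<infinity>)}"

definition fdiff :: "nat \<Rightarrow> real \<Rightarrow> (real \<Rightarrow> complex) \<Rightarrow> real \<Rightarrow> complex" where
  "fdiff k \<delta> f x = (\<Sum>\<nu>\<le>k. (-1) ^ \<nu> * of_nat (k choose \<nu>) * f (x + real \<nu> * \<delta>))"

definition modulus :: "nat \<Rightarrow> ennreal \<Rightarrow> (real \<Rightarrow> complex) \<Rightarrow> real \<Rightarrow> ennreal" where
  "modulus k p f t = (SUP \<delta>\<in>{0<..<t}. Lp_norm p (fdiff k \<delta> f))"

definition theta_mod ::
    "nat \<Rightarrow> real \<Rightarrow> ennreal \<Rightarrow> (real \<Rightarrow> complex) \<Rightarrow> real \<Rightarrow> ennreal" where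
  "theta_mod k \<alpha> p f \<delta> = (SUP h\<in>{0<..\<delta>}. ennreal (h powr (- \<alpha>)) * modulus k p f h)"

definition H_seminorm :: "ennreal \<Rightarrow> nat \<Rightarrow> real \<Rightarrow> (real \<Rightarrow> complex) \<Rightarrow> ennreal" where
  "H_seminorm p r \<alpha> f = (SUP h\<in>{0<..}. ennreal (h powr (- \<alpha>)) * Lp_norm p (fdiff r h f))"

definition H_norm :: "ennreal \<Rightarrow> nat \<Rightarrow> real \<Rightarrow> (real \<Rightarrow> complex) \<Rightarrow> ennreal" where
  "H_norm p r \<alpha> f = Lp_norm p f + H_seminorm p r \<alpha> f"

definition H_space :: "ennreal \<Rightarrow> nat \<Rightarrow> real \<Rightarrow> (real \<Rightarrow> complex) set" where
  "H_space p r \<alpha> = {f \<in> Lp p. H_norm p r \<alpha> f < \<infinity>}"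

definition trig_poly :: "nat \<Rightarrow> (real \<Rightarrow> complex) set" where
  "trig_poly n =
     {T. \<exists>c :: int \<Rightarrow> complex.
           T = (\<lambda>x. \<Sum>\<nu>\<in>{- int n..int n}. c \<nu> * exp (\<i> * of_int \<nu> * of_real x))}"

definition best_approx ::
    "nat \<Rightarrow> ennreal \<Rightarrow> nat \<Rightarrow> real \<Rightarrow> (real \<Rightarrow> complex) \<Rightarrow> ennreal" where
  "best_approx n p r \<alpha> f = (INF T\<in>trig_poly n. H_norm p r \<alpha> (\<lambda>x. f x - T x))"

end

theory Submission
  imports Defs "HOL-Probability.Probability_Measure"
begin

text \<open>
  With \<open>q = min p 1\<close>, the \<open>q\<close>-th power of the \<open>L_p\<close> quasi-norm is subadditive; it is called \<open>nq\<close>, and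
  \<open>\<beta> = \<alpha> q\<close> is the smoothness exponent on its scale. A bound \<open>\<theta>\<^sub>k(f, \<delta>) \<le> A\<close> means
  \<open>\<parallel>\<Delta>\<^sub>t\<^sup>k f\<parallel> \<le> A t\<^sup>\<alpha>\<close> for all \<open>0 < t < \<delta>\<close>, and under such a bound \<open>f\<close> lies within
  \<open>C A 2 ^ (-j \<alpha>)\<close> of the trigonometric polynomials of degree \<open>O(2 ^ j)\<close> as soon as \<open>2 ^ (-j) \<le> \<delta>\<close>. For \<open>p < 1\<close>
  there are no integral means, so the approximants are built from the values of \<open>f\<close> on the grid
  \<open>l + (2 \<pi> / N) \<int>\<close> with \<open>N\<close> comparable to \<open>2 ^ j\<close>, and all norms are averaged over the offset \<open>l\<close>.
  If \<open>K\<close> is the discrete convolution with a localized kernel of mean one, \<open>f - (I - K)\<^sup>k f\<close> agrees on the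
  grid with a polynomial, and \<open>(I - K)\<^sup>k f\<close> is controlled by the \<open>k\<close>-th difference of \<open>f\<close> with the grid step.
  Consecutive approximants therefore differ little on the coarser grid, hence everywhere, and
  telescoping down to \<open>f\<close> itself gives the estimate. Bernstein's inequality follows from the same
  sampling formula.

  Telescoping dyadic approximants with Bernstein's inequality turns the estimate into
  \<open>E\<^sub>n(f) \<le> C \<theta>\<^sub>k(f, 1/n)\<close> in the Hoelder norm, which gives one implication. For the other one,
  \<open>\<theta>\<^sub>s \<le> M \<theta>\<^sub>k\<close> forces \<open>\<theta>\<^sub>k(f, m h) \<le> C m ^ (\<gamma> - \<alpha>) \<theta>\<^sub>k(f, h)\<close> with \<open>\<gamma> = s + 1 / q - 1 < k\<close>, whereas
  \<open>\<theta>\<^sub>k(f, 1 / (m n)) \<le> C (E\<^sub>n(f) + m ^ (\<alpha> - k) \<theta>\<^sub>k(f, 1 / n))\<close>; for large \<open>m\<close> the last term is absorbed.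
\<close>

section \<open>Trigonometric polynomials and localized kernels\<close>

text \<open>The threshold for \<open>k\<close> comes from two competing exponents on the scale of
  \<open>nq\<close>. Passing from the step \<open>t\<close> to \<open>m * t\<close> costs an s-th
  difference up to \<open>m powr (q * (s - 1) + 1)\<close>, the q-th power of m^(s + 1/q - 1), while
  Bernstein's inequality gives a k-th difference of a polynomial the exponent \<open>q * k\<close>.
  The second must win strictly, so that a sum over scales is dominated by its last term and
  something is left to absorb with.

  For p < 1 the values on one fixed grid do not control the quasi-norm. Averaging over the offset
  turns a sum of samples into an integral, by rotation invariance. A concrete offset is selected
  only at the end of the telescoping, since different scales may favour different offsets.

  Telescoping also needs that the approximants converge to f at all. No rate is required there, so a
  Marchaud type inequality first turns smallness of k-th differences into smallness of first ones.
  The argument runs in an abstract quasi-norm with an abstract averaged bound; L_p for finite p and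
  the uniform norm are its two instances.\<close>

definition grid :: "nat \<Rightarrow> nat \<Rightarrow> real" where
  "grid N i = 2 * pi * real i / real N"

section \<open>Orthogonality of exponentials on a grid\<close>

lemma cis_eq_1_imp:
  assumes "cis x = 1" shows "\<exists>k::int. x = 2 * pi * of_int k"
proof -
  have "cos x = 1" using assms by (simp add: complex_eq_iff)
  then show ?thesis by (auto simp: cos_one_2pi_int)
qed

lemma cis_int_mult_add_2pi: "cis (of_int k * (x + 2 * pi)) = cis (of_int k * x)"
proof -
  have "cis (of_int k * (x + 2 * pi)) = cis (of_int k * x) * cis (2 * pi * of_int k)"
    by (simp add: cis_mult algebra_simps)
  also have "cis (2 * pi * of_int k) = 1" by (simp add: cis.code complex_eq_iff)
  finally show ?thesis by simp
qed

text \<open>The summands are the powers of an N-th root of unity, which differs from 1 because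
  \<open>t\<close> is not a multiple of \<open>N\<close>. Every exact quadrature below rests on this
  cancellation.\<close>

lemma sum_cis_grid:
  assumes "t \<noteq> 0" "\<bar>t\<bar> < int N"
  shows "(\<Sum>i<N. cis (of_int t * grid N i)) = 0"
proof -
  define w where "w = cis (2 * pi * of_int t / real N)"
  have N: "N > 0" using assms by auto
  have pw: "cis (of_int t * grid N i) = w ^ i" for i
    by (simp add: w_def grid_def Complex.DeMoivre mult_ac)
  have "w \<noteq> 1"
  proof
    assume "w = 1"
    then obtain k :: int where k: "2 * pi * of_int t / real N = 2 * pi * of_int k"
      using cis_eq_1_imp unfolding w_def by blast
    then have "real_of_int t = of_int (k * int N)" using N by (simp add: field_simps)
    then have "t = k * int N" by linarith
    with assms show False
      by (metis abs_mult abs_of_nat dvd_triv_right zdvd_not_zless abs_eq_0 abs_ge_zero dvd_abs_iff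
          less_le mult_eq_0_iff)
  qed
  moreover have "w ^ N = 1"
  proof -
    have "w ^ N = cis (2 * pi * of_int t)" using N by (simp add: w_def Complex.DeMoivre)
    then show ?thesis by (simp add: cis.code complex_eq_iff)
  qed
  ultimately show ?thesis unfolding pw by (simp add: geometric_sum)
qed

lemma sum_cis_grid':
  assumes "\<bar>t\<bar> < int N"
  shows "(\<Sum>i<N. cis (of_int t * grid N i)) = (if t = 0 then of_nat N else 0)"
  using sum_cis_grid[OF _ assms] by auto

section \<open>The algebra of trigonometric polynomials\<close>

lemma trig_poly_cis:
  "trig_poly n = {T. \<exists>c. T = (\<lambda>x. \<Sum>\<nu>\<in>{- int n..int n}. c \<nu> * cis (of_int \<nu> * x))}"
  unfolding trig_poly_def by (simp add: cis_conv_exp mult.assoc of_real_mult)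

lemma trig_poly_add:
  assumes "S \<in> trig_poly n" "T \<in> trig_poly n" shows "(\<lambda>x. S x + T x) \<in> trig_poly n"
proof -
  obtain c d where "S = (\<lambda>x. \<Sum>\<nu>\<in>{- int n..int n}. c \<nu> * cis (of_int \<nu> * x))"
     "T = (\<lambda>x. \<Sum>\<nu>\<in>{- int n..int n}. d \<nu> * cis (of_int \<nu> * x))"
    using assms unfolding trig_poly_cis by auto
  then show ?thesis unfolding trig_poly_cis
    by (auto intro!: exI[of _ "\<lambda>\<nu>. c \<nu> + d \<nu>"] simp: sum.distrib algebra_simps)
qed

lemma trig_poly_scale:
  assumes "T \<in> trig_poly n" shows "(\<lambda>x. a * T x) \<in> trig_poly n"
proof -
  obtain d where "T = (\<lambda>x. \<Sum>\<nu>\<in>{- int n..int n}. d \<nu> * cis (of_int \<nu> * x))"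
    using assms unfolding trig_poly_cis by auto
  then show ?thesis unfolding trig_poly_cis
    by (auto intro!: exI[of _ "\<lambda>\<nu>. a * d \<nu>"] simp: sum_distrib_left algebra_simps)
qed

lemma trig_poly_zero: "(\<lambda>x. 0) \<in> trig_poly n"
  unfolding trig_poly_cis by (auto intro!: exI[of _ "\<lambda>\<nu>. 0"])

lemma trig_poly_sum:
  assumes "\<And>i. i \<in> I \<Longrightarrow> S i \<in> trig_poly n"
  shows "(\<lambda>x. \<Sum>i\<in>I. S i x) \<in> trig_poly n"
  using assms by (induction I rule: infinite_finite_induct) (auto intro: trig_poly_zero trig_poly_add)

lemma trig_poly_single:
  assumes "\<bar>t\<bar> \<le> int n" shows "(\<lambda>x. cis (of_int t * x)) \<in> trig_poly n"
  unfolding trig_poly_cis using assms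
  by (auto intro!: exI[of _ "\<lambda>\<nu>. if \<nu> = t then 1 else 0"] ext simp: if_distrib[where f="\<lambda>a. a * _"] sum.delta cong: if_cong)

text \<open>Linear statements about polynomials reduce to single exponentials, so coefficients
  seldom have to be handled.\<close>

lemma trig_poly_induct [consumes 1, case_names zero add scale single]:
  assumes "T \<in> trig_poly n"
    and "P (\<lambda>x. 0)" "\<And>S T. P S \<Longrightarrow> P T \<Longrightarrow> P (\<lambda>x. S x + T x)"
    and "\<And>a T. P T \<Longrightarrow> P (\<lambda>x. a * T x)"
    and single: "\<And>t::int. \<bar>t\<bar> \<le> int n \<Longrightarrow> P (\<lambda>x. cis (of_int t * x))"
  shows "P T"
proof -
  obtain c where T: "T = (\<lambda>x. \<Sum>\<nu>\<in>{- int n..int n}. c \<nu> * cis (of_int \<nu> * x))"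
    using assms(1) unfolding trig_poly_cis by auto
  have "P (\<lambda>x. \<Sum>\<nu>\<in>I. c \<nu> * cis (of_int \<nu> * x))" if "finite I" "I \<subseteq> {- int n..int n}" for I
    using that
  proof (induction I rule: finite_induct)
    case (insert a I)
    have "P (\<lambda>x. c a * cis (of_int a * x))"
      using insert.prems by (intro assms(4) single) auto
    then show ?case using insert assms(3) by simp
  qed (simp add: assms(2))
  then show ?thesis unfolding T by simp
qed

lemma trig_poly_mono:
  assumes "T \<in> trig_poly n" "n \<le> m" shows "T \<in> trig_poly m"
  using assms by (induction rule: trig_poly_induct)
    (auto intro: trig_poly_zero trig_poly_add trig_poly_scale trig_poly_single)

lemma trig_poly_shift:
  assumes "T \<in> trig_poly n" shows "(\<lambda>x. T (x + h)) \<in> trig_poly n"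
  using assms
proof (induction rule: trig_poly_induct)
  case (single t)
  have "(\<lambda>x. cis (of_int t * h) * cis (of_int t * x)) \<in> trig_poly n"
    using single by (intro trig_poly_scale trig_poly_single)
  then show ?case by (simp add: cis_mult algebra_simps)
qed (auto intro: trig_poly_zero trig_poly_add trig_poly_scale)

lemma trig_poly_uminus_arg:
  assumes "T \<in> trig_poly n" shows "(\<lambda>x. T (- x)) \<in> trig_poly n"
  using assms
proof (induction rule: trig_poly_induct)
  case (single t)
  have "(\<lambda>x. cis (of_int (-t) * x)) \<in> trig_poly n"
    using single by (intro trig_poly_single) auto
  then show ?case by simp
qed (auto intro: trig_poly_zero trig_poly_add trig_poly_scale)

lemma trig_poly_mult:
  assumes "S \<in> trig_poly n" "T \<in> trig_poly m" shows "(\<lambda>x. S x * T x) \<in> trig_poly (n + m)"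
  using assms(1)
proof (induction rule: trig_poly_induct)
  case zero then show ?case by (simp add: trig_poly_zero)
next
  case (add S1 S2)
  then show ?case using trig_poly_add by (simp add: distrib_right)
next
  case (scale a S)
  then show ?case using trig_poly_scale by (simp add: mult.assoc)
next
  case (single s)
  from assms(2) show ?case
  proof (induction rule: trig_poly_induct)
    case zero then show ?case by (simp add: trig_poly_zero)
  next
    case (add S1 S2)
    then show ?case using trig_poly_add by (simp add: distrib_left)
  next
    case (scale a S)
    then show ?case using trig_poly_scale[OF scale, of a] by (simp add: algebra_simps)
  next
    case (single t)
    have "(\<lambda>x. cis (of_int (s+t) * x)) \<in> trig_poly (n+m)"
      using single \<open>\<bar>s\<bar> \<le> int n\<close> by (intro trig_poly_single) auto
    then show ?case by (simp add: cis_mult algebra_simps)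
  qed
qed

lemma trig_poly_const: "(\<lambda>x. c) \<in> trig_poly n"
  using trig_poly_scale[OF trig_poly_single[of 0 n], of c] by simp

lemma trig_poly_power:
  assumes "T \<in> trig_poly n" shows "(\<lambda>x. T x ^ k) \<in> trig_poly (k * n)"
proof (induction k)
  case 0 show ?case using trig_poly_const[of 1] by simp
next
  case (Suc k) show ?case using trig_poly_mult[OF assms Suc] by simp
qed

lemma trig_poly_periodic:
  assumes "T \<in> trig_poly n" shows "periodic_2pi T"
  using assms by (induction rule: trig_poly_induct)
    (auto simp: periodic_2pi_def cis_int_mult_add_2pi)

lemma trig_poly_continuous:
  assumes "T \<in> trig_poly n" shows "continuous_on A T"
  using assms by (induction rule: trig_poly_induct) (auto intro!: continuous_intros)

section \<open>Exact interpolation and localization\<close>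

definition dirichlet :: "nat \<Rightarrow> real \<Rightarrow> complex" where
  "dirichlet L x = (\<Sum>s\<in>{- int L..int L}. cis (of_int s * x))"

lemma dirichlet_trig_poly: "dirichlet L \<in> trig_poly L"
  unfolding dirichlet_def[abs_def] by (intro trig_poly_sum trig_poly_single) auto

lemma norm_dirichlet_le: "norm (dirichlet L x) \<le> 2 * real L + 1"
proof -
  have "norm (dirichlet L x) \<le> (\<Sum>s\<in>{- int L..int L}. norm (cis (of_int s * x)))"
    unfolding dirichlet_def by (rule norm_sum)
  also have "\<dots> = 2 * real L + 1" by simp
  finally show ?thesis .
qed

lemma norm_cis_diff_le: "norm (cis a - cis b) \<le> \<bar>a - b\<bar>"
proof -
  have "norm (cis a - cis b) = norm (cis b * (cis (a - b) - 1))"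
    by (simp add: algebra_simps cis_mult)
  also have "\<dots> = norm (cis (a - b) - 1)" by (simp add: norm_mult)
  also have "\<dots> = 2 * \<bar>sin ((a-b)/2)\<bar>"
    using dist_exp_i_1[of "a-b"] by (simp add: cis_conv_exp)
  also have "\<dots> \<le> 2 * \<bar>(a-b)/2\<bar>" by (intro mult_left_mono abs_sin_x_le_abs_x) auto
  finally show ?thesis by simp
qed

lemma dirichlet_diff_le: "norm (dirichlet L (x + h) - dirichlet L x) \<le> (2 * real L + 1) * (real L * \<bar>h\<bar>)"
proof -
  have "norm (dirichlet L (x+h) - dirichlet L x)
      \<le> (\<Sum>s\<in>{- int L..int L}. norm (cis (of_int s * (x+h)) - cis (of_int s * x)))"
    unfolding dirichlet_def sum_subtractf[symmetric] by (rule norm_sum)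
  also have "\<dots> \<le> (\<Sum>s\<in>{- int L..int L}. real L * \<bar>h\<bar>)"
  proof (rule sum_mono)
    fix s assume s: "s \<in> {- int L..int L}"
    have "norm (cis (of_int s * (x+h)) - cis (of_int s * x)) \<le> \<bar>of_int s * (x+h) - of_int s * x\<bar>"
      by (rule norm_cis_diff_le)
    also have "\<dots> = \<bar>of_int s\<bar> * \<bar>h\<bar>" by (simp add: algebra_simps abs_mult)
    also have "\<dots> \<le> real L * \<bar>h\<bar>" using s by (intro mult_right_mono) auto
    finally show "norm (cis (of_int s * (x+h)) - cis (of_int s * x)) \<le> real L * \<bar>h\<bar>" .
  qed
  also have "\<dots> = (2 * real L + 1) * (real L * \<bar>h\<bar>)" by simp
  finally show ?thesis .
qed

text \<open>The products of exponentials have frequencies \<open>t - s\<close> of modulus at most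
  \<open>2 * L < N\<close>, so no aliasing occurs and only \<open>s = t\<close> survives the grid
  sum. The offset \<open>l\<close> enters as a phase that is trivial for
  \<open>s = t\<close>.\<close>

lemma dirichlet_interpolation:
  assumes "T \<in> trig_poly L" "2 * L + 1 \<le> N"
  shows "(\<Sum>i<N. T (l + grid N i) * dirichlet L (x - l - grid N i)) = of_nat N * T x"
  using assms(1)
proof (induction rule: trig_poly_induct)
  case zero then show ?case by simp
next
  case (add S T)
  then show ?case by (simp add: distrib_left distrib_right sum.distrib)
next
  case (scale a T)
  then show ?case by (simp add: mult.assoc sum_distrib_left[symmetric])
next
  case (single t)
  have e: "cis (of_int t * (l + y)) * cis (of_int s * (x - l - y))
     = cis (of_int s * x + of_int (t - s) * l) * cis (of_int (t - s) * y)" for s and y :: real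
    by (simp add: cis_mult algebra_simps)
  have "(\<Sum>i<N. cis (of_int t * (l + grid N i)) * dirichlet L (x - l - grid N i))
     = (\<Sum>i<N. \<Sum>s\<in>{- int L..int L}. cis (of_int s * x + of_int (t - s) * l) * cis (of_int (t - s) * grid N i))"
    unfolding dirichlet_def sum_distrib_left e by simp
  also have "\<dots> = (\<Sum>s\<in>{- int L..int L}. cis (of_int s * x + of_int (t - s) * l) * (\<Sum>i<N. cis (of_int (t - s) * grid N i)))"
    by (subst sum.swap) (simp add: sum_distrib_left)
  also have "\<dots> = (\<Sum>s\<in>{- int L..int L}. if s = t then of_nat N * cis (of_int t * x) else 0)"
  proof (rule sum.cong)
    fix s assume "s \<in> {- int L..int L}"
    then have "\<bar>t - s\<bar> < int N" using single assms(2) by auto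
    then show "cis (of_int s * x + of_int (t - s) * l) * (\<Sum>i<N. cis (of_int (t - s) * grid N i))
      = (if s = t then of_nat N * cis (of_int t * x) else 0)"
      by (subst sum_cis_grid') auto
  qed simp
  also have "\<dots> = of_nat N * cis (of_int t * x)" using single by (auto simp: sum.delta abs_le_iff)
  finally show ?case .
qed

text \<open>A one-sided Dirichlet kernel normalized to 1 at 0. Its squared modulus is the Fejer
  kernel divided by \<open>m\<close>, which is what gets summed and integrated later.\<close>

definition avg_exp :: "nat \<Rightarrow> real \<Rightarrow> complex" where
  "avg_exp m x = (\<Sum>l<m. cis (real l * x)) / of_nat m"

lemma avg_exp_trig_poly: "avg_exp m \<in> trig_poly (m - 1)"
proof -
  have "(\<lambda>x. (1 / of_nat m) * (\<Sum>l<m. cis (of_int (int l) * x))) \<in> trig_poly (m - 1)"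
    by (intro trig_poly_scale trig_poly_sum trig_poly_single) auto
  then show ?thesis by (simp add: avg_exp_def[abs_def])
qed

lemma norm_avg_exp_le_1: "norm (avg_exp m x) \<le> 1"
proof -
  have "norm (\<Sum>l<m. cis (real l * x)) \<le> (\<Sum>l<m. norm (cis (real l * x)))" by (rule norm_sum)
  also have "\<dots> = real m" by simp
  finally show ?thesis by (cases "m = 0") (auto simp: avg_exp_def norm_divide divide_simps)
qed

lemma avg_exp_0: "m \<ge> 1 \<Longrightarrow> avg_exp m 0 = 1"
  by (simp add: avg_exp_def)

lemma avg_exp_diff_le: "norm (avg_exp m (x + h) - avg_exp m x) \<le> real m * \<bar>h\<bar>"
proof (cases "m = 0")
  case False
  have "norm ((\<Sum>l<m. cis (real l * (x + h))) - (\<Sum>l<m. cis (real l * x)))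
     \<le> (\<Sum>l<m. norm (cis (real l * (x + h)) - cis (real l * x)))"
    unfolding sum_subtractf[symmetric] by (rule norm_sum)
  also have "\<dots> \<le> (\<Sum>l<m. real m * \<bar>h\<bar>)"
  proof (rule sum_mono)
    fix l assume l: "l \<in> {..<m}"
    have "norm (cis (real l * (x+h)) - cis (real l * x)) \<le> \<bar>real l * (x+h) - real l * x\<bar>"
      by (rule norm_cis_diff_le)
    also have "\<dots> = real l * \<bar>h\<bar>" by (simp add: algebra_simps abs_mult)
    also have "\<dots> \<le> real m * \<bar>h\<bar>" using l by (intro mult_right_mono) auto
    finally show "norm (cis (real l * (x+h)) - cis (real l * x)) \<le> real m * \<bar>h\<bar>" .
  qed
  finally show ?thesis using False
    by (simp add: avg_exp_def norm_divide diff_divide_distrib[symmetric] divide_simps mult_ac)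
qed (simp add: avg_exp_def)

lemma norm_one_minus_cis: "norm (1 - cis u) = 2 * \<bar>sin (u / 2)\<bar>"
  using dist_exp_i_1[of u] by (simp add: cis_conv_exp norm_minus_commute)

text \<open>A weak form of Jordan's inequality, with 1/3 in place of 2/pi. Up to
  \<open>pi / 3\<close> the derivative \<open>cos y - 1 / 3\<close> is nonnegative; beyond it
  monotonicity keeps the sine above 2/3, which \<open>x / 3\<close> does not exceed.\<close>

lemma sin_ge_third:
  assumes "0 \<le> x" "x \<le> pi / 2" shows "x / 3 \<le> sin (x::real)"
proof (cases "x \<le> pi / 3")
  case True
  have "sin 0 - 0 / 3 \<le> sin x - x / 3"
  proof (rule DERIV_nonneg_imp_nondecreasing[OF assms(1)])
    fix y assume y: "0 \<le> y" "y \<le> x"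
    have "cos (pi/3) \<le> cos y" using y True pi_gt_zero by (intro cos_monotone_0_pi_le) auto
    then have "0 \<le> cos y - 1 / 3" by (simp add: cos_60)
    moreover have "((\<lambda>x. sin x - x / 3) has_real_derivative cos y - 1 / 3) (at y)"
      by (auto intro!: derivative_eq_intros)
    ultimately show "\<exists>z. ((\<lambda>x. sin x - x / 3) has_real_derivative z) (at y) \<and> 0 \<le> z" by blast
  qed
  then show ?thesis by simp
next
  case False
  have "sin (pi/3) \<le> sin x" using False assms by (intro sin_monotone_2pi_le) auto
  moreover have "4/3 \<le> sqrt 3" by (rule real_le_rsqrt) (simp add: power2_eq_square)
  ultimately have "2/3 \<le> sin x" by (simp add: sin_60)
  moreover have "x / 3 \<le> 2/3" using assms pi_less_4 by simp
  ultimately show ?thesis by linarith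
qed

lemma norm_one_minus_cis_ge:
  assumes "\<bar>u\<bar> \<le> pi" shows "\<bar>u\<bar> / 3 \<le> norm (1 - cis u)"
proof -
  have "\<bar>u\<bar>/2/3 \<le> sin (\<bar>u\<bar>/2)" using assms by (intro sin_ge_third) auto
  also have "sin (\<bar>u\<bar>/2) \<le> \<bar>sin (u/2)\<bar>"
    by (cases "u \<ge> 0") auto
  finally show ?thesis unfolding norm_one_minus_cis by simp
qed

lemma norm_avg_exp_mult_le: "norm (avg_exp m u) * norm (1 - cis u) \<le> 2 / real m"
proof (cases "m = 0")
  case False
  have "(\<Sum>l<m. cis (real l * u)) = (\<Sum>l<m. cis u ^ l)" by (simp add: Complex.DeMoivre)
  then have "avg_exp m u * (1 - cis u) = (1 - cis u ^ m) / of_nat m"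
    unfolding avg_exp_def using one_diff_power_eq[of "cis u" m] by (simp add: mult.commute)
  then have "norm (avg_exp m u) * norm (1 - cis u) = norm (1 - cis u ^ m) / real m"
    by (metis norm_divide norm_mult norm_of_nat)
  also have "norm (1 - cis u ^ m) \<le> norm (1::complex) + norm (cis u ^ m)" by (rule norm_triangle_ineq4)
  then have "norm (1 - cis u ^ m) / real m \<le> 2 / real m" by (intro divide_right_mono) (auto simp: norm_power)
  finally show ?thesis .
qed (simp add: avg_exp_def)

lemma norm_avg_exp_decay:
  assumes "\<bar>u\<bar> \<le> pi" shows "norm (avg_exp m u) * \<bar>u\<bar> \<le> 6 / real m"
proof -
  have "norm (avg_exp m u) * (\<bar>u\<bar>/3) \<le> norm (avg_exp m u) * norm (1 - cis u)"
    using norm_one_minus_cis_ge[OF assms] by (intro mult_left_mono) auto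
  also have "\<dots> \<le> 2 / real m" by (rule norm_avg_exp_mult_le)
  finally show ?thesis by simp
qed

text \<open>A discrete Parseval identity: the frequencies \<open>a - b\<close> of the expanded
  square are smaller than \<open>N\<close> in modulus, so only the diagonal contributes. The value
  is the same for every shift \<open>z\<close>, hence for every offset of the grid.\<close>

lemma sum_norm_avg_exp_sq:
  assumes "m \<ge> 1" "m \<le> N"
  shows "(\<Sum>i<N. (norm (avg_exp m (z - grid N i)))\<^sup>2) = real N / real m"
proof -
  have e: "complex_of_real ((norm (avg_exp m u))\<^sup>2)
      = (\<Sum>a<m. \<Sum>b<m. cis (of_int (int a - int b) * u)) / (of_nat m)\<^sup>2" for u
    unfolding complex_norm_square avg_exp_def
    by (simp add: power2_eq_square sum_product cis_cnj cis_mult algebra_simps)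
  have s: "cis (of_int t * (z - y)) = cis (of_int t * z) * cis (of_int (-t) * y)" for t and y :: real
    by (simp add: cis_mult algebra_simps)
  have "complex_of_real (\<Sum>i<N. (norm (avg_exp m (z - grid N i)))\<^sup>2)
     = (\<Sum>i<N. \<Sum>a<m. \<Sum>b<m. cis (of_int (int a - int b) * (z - grid N i))) / (of_nat m)\<^sup>2"
    unfolding of_real_sum e sum_divide_distrib ..
  also have "(\<Sum>i<N. \<Sum>a<m. \<Sum>b<m. cis (of_int (int a - int b) * (z - grid N i)))
     = (\<Sum>a<m. \<Sum>b<m. cis (of_int (int a - int b) * z) * (\<Sum>i<N. cis (of_int (-(int a - int b)) * grid N i)))"
    unfolding s sum_distrib_left
    by (subst sum.swap) (intro sum.cong refl sum.swap)
  also have "\<dots> = (\<Sum>a<m. \<Sum>b<m. if b = a then of_nat N else 0)"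
  proof (intro sum.cong refl)
    fix a b assume "a \<in> {..<m}" "b \<in> {..<m}"
    then have "\<bar>-(int a - int b)\<bar> < int N" using assms by auto
    then show "cis (of_int (int a - int b) * z) * (\<Sum>i<N. cis (of_int (-(int a - int b)) * grid N i))
       = (if b = a then of_nat N else 0)" by (subst sum_cis_grid') auto
  qed
  also have "\<dots> = of_nat m * of_nat N" by (simp add: sum.delta)
  also have "\<dots> / (of_nat m)\<^sup>2 = complex_of_real (real N / real m)" using assms by (simp add: power2_eq_square)
  finally show ?thesis using of_real_eq_iff by blast
qed

text \<open>The kernel with exponent \<open>Q\<close> decays like \<open>\<bar>m u\<bar> ^ (-Q)\<close> and still reproduces trigonometric
  polynomials: multiplying a polynomial by \<open>avg_exp m (x - \<cdot>) ^ Q\<close> does not change its value at \<open>x\<close>.\<close>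

definition kern :: "nat \<Rightarrow> nat \<Rightarrow> nat \<Rightarrow> real \<Rightarrow> complex" where
  "kern L m Q u = dirichlet L u * avg_exp m u ^ Q"

lemma kern_trig_poly: "kern L m Q \<in> trig_poly (L + Q * (m - 1))"
  unfolding kern_def[abs_def]
  by (intro trig_poly_mult dirichlet_trig_poly trig_poly_power avg_exp_trig_poly)

lemma norm_kern_le: "norm (kern L m Q u) \<le> (2 * real L + 1) * norm (avg_exp m u) ^ Q"
  unfolding kern_def norm_mult norm_power by (intro mult_right_mono norm_dirichlet_le) auto

text \<open>For fixed \<open>x\<close> the localizing factor is moved from the kernel to the
  polynomial: \<open>P\<close> has degree at most \<open>L\<close>, Dirichlet interpolation is exact
  for it, and \<open>P x = T x\<close> because \<open>avg_exp m 0 = 1\<close>.\<close>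

lemma kern_reproduces:
  assumes "T \<in> trig_poly n" "n + Q * (m - 1) \<le> L" "2 * L + 1 \<le> N" "m \<ge> 1"
  shows "(\<Sum>i<N. T (l + grid N i) * kern L m Q (x - l - grid N i)) = of_nat N * T x"
proof -
  define P where "P y = T y * avg_exp m (x - y) ^ Q" for y
  have "(\<lambda>y. (\<lambda>u. avg_exp m (u + x) ^ Q) (- y)) \<in> trig_poly (Q * (m - 1))"
    by (intro trig_poly_uminus_arg trig_poly_power trig_poly_shift avg_exp_trig_poly)
  then have "P \<in> trig_poly (n + Q * (m - 1))"
    unfolding P_def[abs_def] by (intro trig_poly_mult assms(1)) (simp add: add.commute)
  then have "P \<in> trig_poly L" using assms(2) trig_poly_mono by blast
  from dirichlet_interpolation[OF this assms(3), of l x] show ?thesis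
    using assms(4) by (simp add: P_def kern_def avg_exp_0 algebra_simps)
qed

text \<open>One of the \<open>Suc Q\<close> factors is spent on the Lipschitz estimate, which leaves
  the Q-th powers expected by \<open>bnd2_sample\<close>. Both \<open>u\<close> and
  \<open>u + h\<close> occur on the right because \<open>h\<close> may be large.\<close>

lemma kern_diff_le:
  assumes "m \<ge> 1"
  shows "norm (kern L m (Suc Q) (u + h) - kern L m (Suc Q) u)
     \<le> (2 * real L + 1) * (real L + real (Suc Q) * real m) * \<bar>h\<bar> * (norm (avg_exp m u) ^ Q + norm (avg_exp m (u + h)) ^ Q)"
proof -
  let ?G = "avg_exp m u" and ?H = "avg_exp m (u + h)"
  let ?M = "norm ?G ^ Q + norm ?H ^ Q"
  \<comment> \<open>A mixed product of total degree \<open>Q\<close> is at most the Q-th power of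
    the larger of the two moduli.\<close>
  have mixed: "norm ?H ^ i * norm ?G ^ (Q - i) \<le> ?M" if "i \<le> Q" for i
  proof (cases "norm ?H \<le> norm ?G")
    case True
    then have "norm ?H ^ i * norm ?G ^ (Q - i) \<le> norm ?G ^ i * norm ?G ^ (Q - i)"
      by (intro mult_right_mono power_mono) auto
    also have "\<dots> = norm ?G ^ Q" using that by (simp flip: power_add)
    finally show ?thesis by (meson add_increasing2 norm_ge_zero zero_le_power)
  next
    case False
    then have "norm ?H ^ i * norm ?G ^ (Q - i) \<le> norm ?H ^ i * norm ?H ^ (Q - i)"
      by (intro mult_left_mono power_mono) auto
    also have "\<dots> = norm ?H ^ Q" using that by (simp flip: power_add)
    finally show ?thesis by (meson add_increasing norm_ge_zero zero_le_power)
  qed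
  have pd: "norm (?H ^ Suc Q - ?G ^ Suc Q) \<le> real (Suc Q) * (real m * \<bar>h\<bar>) * ?M"
  proof -
    have "?H ^ Suc Q - ?G ^ Suc Q = (?H - ?G) * (\<Sum>i<Suc Q. ?H ^ i * ?G ^ (Q - i))"
      using power_diff_sumr2[of ?H "Suc Q" ?G] by (simp add: mult.commute)
    then have "norm (?H ^ Suc Q - ?G ^ Suc Q) = norm (?H - ?G) * norm (\<Sum>i<Suc Q. ?H ^ i * ?G ^ (Q - i))"
      by (simp add: norm_mult)
    also have "\<dots> \<le> (real m * \<bar>h\<bar>) * (\<Sum>i<Suc Q. ?M)"
    proof (intro mult_mono)
      show "norm (\<Sum>i<Suc Q. ?H ^ i * ?G ^ (Q - i)) \<le> (\<Sum>i<Suc Q. ?M)"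
        by (rule order.trans[OF norm_sum]) (intro sum_mono, auto simp: norm_mult norm_power intro!: mixed)
    qed (auto simp: avg_exp_diff_le)
    finally show ?thesis by (simp add: algebra_simps)
  qed
  have "kern L m (Suc Q) (u + h) - kern L m (Suc Q) u
     = (dirichlet L (u + h) - dirichlet L u) * ?H ^ Suc Q + dirichlet L u * (?H ^ Suc Q - ?G ^ Suc Q)"
    by (simp add: kern_def algebra_simps)
  also have "norm \<dots> \<le> norm (dirichlet L (u + h) - dirichlet L u) * norm ?H ^ Suc Q
      + norm (dirichlet L u) * norm (?H ^ Suc Q - ?G ^ Suc Q)"
    by (rule order.trans[OF norm_triangle_ineq]) (simp add: norm_mult norm_power)
  also have "\<dots> \<le> ((2 * real L + 1) * (real L * \<bar>h\<bar>)) * ?M + (2 * real L + 1) * (real (Suc Q) * (real m * \<bar>h\<bar>) * ?M)"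
  proof (intro add_mono mult_mono dirichlet_diff_le norm_dirichlet_le pd)
    have "norm ?H ^ Suc Q \<le> norm ?H ^ Q" by (intro power_decreasing norm_avg_exp_le_1) auto
    then show "norm ?H ^ Suc Q \<le> ?M" by (simp add: add_increasing)
  qed auto
  finally show ?thesis by (simp add: algebra_simps)
qed

section \<open>Iterated differences in shift-invariant quasi-normed spaces\<close>

lemma fdiff_0 [simp]: "fdiff 0 \<delta> f = f"
  by (simp add: fdiff_def fun_eq_iff)

text \<open>Pascal's rule for the binomial coefficients. Most later arguments use this recursion and
  not the explicit sum.\<close>

lemma fdiff_Suc: "fdiff (Suc k) \<delta> f x = fdiff k \<delta> f x - fdiff k \<delta> f (x + \<delta>)"
proof -
  let ?h = "\<lambda>\<nu>. f (x + real \<nu> * \<delta>)"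
  have "fdiff (Suc k) \<delta> f x = ?h 0 + (\<Sum>\<nu>\<le>k. (-1) ^ Suc \<nu> * of_nat (Suc k choose Suc \<nu>) * ?h (Suc \<nu>))"
    unfolding fdiff_def by (subst sum.atMost_Suc_shift) simp
  also have "\<dots> = ?h 0 + (\<Sum>\<nu>\<le>k. (-1) ^ Suc \<nu> * of_nat (k choose Suc \<nu>) * ?h (Suc \<nu>))
      - (\<Sum>\<nu>\<le>k. (-1) ^ \<nu> * of_nat (k choose \<nu>) * ?h (Suc \<nu>))"
    by (simp add: sum_subtractf sum.distrib sum_negf algebra_simps)
  also have "?h 0 + (\<Sum>\<nu>\<le>k. (-1) ^ Suc \<nu> * of_nat (k choose Suc \<nu>) * ?h (Suc \<nu>))
      = (\<Sum>\<nu>\<le>Suc k. (-1) ^ \<nu> * of_nat (k choose \<nu>) * ?h \<nu>)"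
    by (subst sum.atMost_Suc_shift) simp
  also have "\<dots> = fdiff k \<delta> f x" by (simp add: fdiff_def)
  also have "(\<Sum>\<nu>\<le>k. (-1) ^ \<nu> * of_nat (k choose \<nu>) * ?h (Suc \<nu>)) = fdiff k \<delta> f (x + \<delta>)"
    unfolding fdiff_def by (simp add: algebra_simps)
  finally show ?thesis .
qed

lemma fdiff_add: "fdiff k \<delta> (\<lambda>x. f x + g x) = (\<lambda>x. fdiff k \<delta> f x + fdiff k \<delta> g x)"
  by (rule ext) (simp add: fdiff_def sum.distrib algebra_simps)

lemma fdiff_diff: "fdiff k \<delta> (\<lambda>x. f x - g x) = (\<lambda>x. fdiff k \<delta> f x - fdiff k \<delta> g x)"
  by (rule ext) (simp add: fdiff_def sum_subtractf algebra_simps)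

lemma fdiff_sum: "fdiff k \<delta> (\<lambda>x. \<Sum>i\<in>I. f i x) = (\<lambda>x. \<Sum>i\<in>I. fdiff k \<delta> (f i) x)"
  by (rule ext) (simp add: fdiff_def sum_distrib_left fun_eq_iff sum.swap[of _ I])

lemma fdiff_shift: "fdiff k \<delta> (\<lambda>x. f (x + h)) = (\<lambda>x. fdiff k \<delta> f (x + h))"
  by (rule ext) (simp add: fdiff_def algebra_simps)

lemma fdiff_1: "fdiff 1 \<delta> f = (\<lambda>x. f x - f (x + \<delta>))"
  using fdiff_Suc[of 0] by (simp add: fun_eq_iff)

lemma fdiff_compose: "fdiff j \<delta> (fdiff k \<delta> f) = fdiff (j + k) \<delta> f"
  by (induction j) (simp_all add: fdiff_Suc fun_eq_iff)

lemma fdiff_Suc': "fdiff (Suc k) \<delta> f = fdiff k \<delta> (\<lambda>x. f x - f (x + \<delta>))"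
  using fdiff_compose[of k \<delta> 1 f] by (simp add: fdiff_1[simplified])

lemma fdiff_const: "k \<ge> 1 \<Longrightarrow> fdiff k \<delta> (\<lambda>x. c) = (\<lambda>x. 0)"
  by (induction k rule: dec_induct) (auto simp: fdiff_Suc fun_eq_iff)

section \<open>Differences with a multiple of the step\<close>

lemma diff_shift_mult:
  fixes f :: "real \<Rightarrow> complex"
  shows "f x - f (x + real n * t) = (\<Sum>j<n. f (x + real j * t) - f (x + real j * t + t))"
  by (induction n) (auto simp: algebra_simps)

text \<open>Multiplication of a polynomial in the shift by 1 + z + ... + z^(n-1), with the terms
  collected by the exponent \<open>l = i + j\<close>.\<close>

lemma sum_sum_add_shift:
  fixes h :: "nat \<Rightarrow> complex"
  shows "(\<Sum>i<a. \<Sum>j<n. c i * h (i + j)) = (\<Sum>l<a + n. (\<Sum>i\<in>{i. i < a \<and> i \<le> l \<and> l < i + n}. c i) * h l)"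
proof -
  have "(\<Sum>j<n. c i * h (i + j)) = (\<Sum>l<a + n. if i \<le> l \<and> l < i + n then c i * h l else 0)" if "i < a" for i
  proof -
    have "(\<Sum>j<n. c i * h (i + j)) = (\<Sum>l\<in>{i..<i+n}. c i * h l)"
      by (rule sum.reindex_bij_witness[of _ "\<lambda>l. l - i" "\<lambda>j. i + j"]) auto
    also have "\<dots> = (\<Sum>l<a + n. if i \<le> l \<and> l < i + n then c i * h l else 0)"
      by (rule sum.mono_neutral_cong_left) (use that in auto)
    finally show ?thesis .
  qed
  then have "(\<Sum>i<a. \<Sum>j<n. c i * h (i + j)) = (\<Sum>l<a + n. \<Sum>i<a. if i \<le> l \<and> l < i + n then c i * h l else 0)"
    by (subst sum.swap) simp
  also have "\<dots> = (\<Sum>l<a + n. (\<Sum>i\<in>{i. i < a \<and> i \<le> l \<and> l < i + n}. c i) * h l)"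
  proof (rule sum.cong)
    fix l
    show "(\<Sum>i<a. if i \<le> l \<and> l < i + n then c i * h l else 0) = (\<Sum>i\<in>{i. i < a \<and> i \<le> l \<and> l < i + n}. c i) * h l"
      unfolding sum_distrib_right by (rule sum.mono_neutral_cong_right) auto
  qed simp
  finally show ?thesis .
qed

text \<open>The coefficients are those of \<open>(1 + z + \<dots> + z ^ (n - 1)) ^ s\<close>. Bounding each of them by
  \<open>n ^ (s - 1)\<close> yields the growth exponent \<open>s + 1 / p - 1\<close> for \<open>p < 1\<close>.\<close>

lemma fdiff_mult_step:
  assumes "s \<ge> 1"
  shows "\<exists>c. (\<forall>i. 0 \<le> c i \<and> c i \<le> real n ^ (s - 1)) \<and>
    (\<forall>x. fdiff s (real n * t) f x = (\<Sum>i<s * n. complex_of_real (c i) * fdiff s t f (x + real i * t)))"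
  using assms
proof (induction s arbitrary: f rule: dec_induct)
  case base
  show ?case
    by (rule exI[of _ "\<lambda>i. 1"]) (use diff_shift_mult[of f _ n t] in \<open>auto simp: fdiff_1[simplified]\<close>)
next
  case (step s)
  define g where "g = (\<lambda>x. f x - f (x + real n * t))"
  obtain c where c: "\<And>i. 0 \<le> c i \<and> c i \<le> real n ^ (s - 1)"
    and eq: "\<And>x. fdiff s (real n * t) g x = (\<Sum>i<s * n. complex_of_real (c i) * fdiff s t g (x + real i * t))"
    using step.IH by blast
  have g: "g = (\<lambda>x. \<Sum>j<n. (\<lambda>x. f x - f (x + t)) (x + real j * t))"
    unfolding g_def using diff_shift_mult[of f _ n t] by (simp add: fun_eq_iff)
  have "fdiff s t g = (\<lambda>x. \<Sum>j<n. fdiff s t (\<lambda>x. f x - f (x + t)) (x + real j * t))"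
    unfolding g fdiff_sum
    using fun_cong[OF fdiff_shift[of s t "\<lambda>x. f x - f (x + t)"]] by simp
  then have sg: "fdiff s t g x = (\<Sum>j<n. fdiff (Suc s) t f (x + real j * t))" for x
    by (simp add: fdiff_Suc')
  define d where "d l = (\<Sum>i\<in>{i. i < s * n \<and> i \<le> l \<and> l < i + n}. c i)" for l
  have d0: "0 \<le> d l" for l unfolding d_def using c by (intro sum_nonneg) auto
  have d1: "d l \<le> real n ^ (Suc s - 1)" for l
  proof -
    \<comment> \<open>Only indices in a window of length \<open>n\<close> contribute to
      \<open>d l\<close>, so the bound on the coefficients grows by a factor \<open>n\<close> and
      not by the number of coefficients.\<close>
    have sub: "{i. i < s * n \<and> i \<le> l \<and> l < i + n} \<subseteq> {Suc l - n..l}" by auto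
    then have "card {i. i < s * n \<and> i \<le> l \<and> l < i + n} \<le> card {Suc l - n..l}" by (intro card_mono) auto
    also have "\<dots> \<le> n" by auto
    finally have card: "card {i. i < s * n \<and> i \<le> l \<and> l < i + n} \<le> n" .
    have "d l \<le> (\<Sum>i\<in>{i. i < s * n \<and> i \<le> l \<and> l < i + n}. real n ^ (s - 1))"
      unfolding d_def using c by (intro sum_mono) auto
    also have "\<dots> \<le> real n * real n ^ (s - 1)" using card by (simp add: mult_right_mono)
    also have "\<dots> = real n ^ (Suc s - 1)" using step.hyps by (cases s) auto
    finally show ?thesis .
  qed
  have "fdiff (Suc s) (real n * t) f x = (\<Sum>i<Suc s * n. complex_of_real (d i) * fdiff (Suc s) t f (x + real i * t))" for x
  proof -
    have "fdiff (Suc s) (real n * t) f x = fdiff s (real n * t) g x" by (simp add: fdiff_Suc' g_def)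
    also have "\<dots> = (\<Sum>i<s * n. \<Sum>j<n. complex_of_real (c i) * fdiff (Suc s) t f (x + real (i + j) * t))"
      unfolding eq sg by (simp add: sum_distrib_left algebra_simps)
    also have "\<dots> = (\<Sum>l<s * n + n. complex_of_real (d l) * fdiff (Suc s) t f (x + real l * t))"
      by (subst sum_sum_add_shift) (simp add: d_def)
    finally show ?thesis by (simp add: add.commute)
  qed
  then show ?case using d0 d1 by (intro exI[of _ d]) auto
qed

text \<open>With \<open>z\<close> the shift by \<open>t\<close>, this is (1 - z^2)^n = (1 + z)^n (1
  - z)^n.\<close>

lemma fdiff_double_step:
  "fdiff n (2 * t) f = ((\<lambda>g x. g x + g (x + t)) ^^ n) (fdiff n t f)"
proof (induction n)
  case (Suc n)
  let ?A = "\<lambda>g x. g x + g (x + t) :: complex"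
  have comm: "(?A ^^ n) (\<lambda>x. g x - g (x + t)) = (\<lambda>x. (?A ^^ n) g x - (?A ^^ n) g (x + t))" for g
    by (induction n) (simp_all add: fun_eq_iff)
  have "fdiff (Suc n) t f = (\<lambda>x. fdiff n t f x - fdiff n t f (x + t))" by (simp add: fdiff_Suc fun_eq_iff)
  then have "(?A ^^ Suc n) (fdiff (Suc n) t f) = ?A (\<lambda>x. fdiff n (2*t) f x - fdiff n (2*t) f (x + t))"
    by (simp add: comm Suc)
  also have "\<dots> = fdiff (Suc n) (2 * t) f"
    by (simp add: fdiff_Suc fun_eq_iff algebra_simps)
  finally show ?case ..
qed simp

text \<open>The common properties of the L_p quasi-norms and the uniform norm. \<open>X\<close>
  consists of functions of finite norm, so \<open>nq\<close> can be real-valued; it is homogeneous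
  of degree \<open>q\<close> because it is a q-th power.\<close>

locale shift_quasinorm =
  fixes X :: "(real \<Rightarrow> complex) set" and nq :: "(real \<Rightarrow> complex) \<Rightarrow> real" and q :: real
  assumes q_pos: "0 < q" and q_le_1: "q \<le> 1"
    and nq_nonneg [simp]: "0 \<le> nq f"
    and X_zero [simp]: "(\<lambda>x. 0) \<in> X"
    and X_add [intro]: "f \<in> X \<Longrightarrow> g \<in> X \<Longrightarrow> (\<lambda>x. f x + g x) \<in> X"
    and X_scale [intro]: "f \<in> X \<Longrightarrow> (\<lambda>x. c * f x) \<in> X"
    and X_shift [intro]: "f \<in> X \<Longrightarrow> (\<lambda>x. f (x + h)) \<in> X"
    and X_periodic: "f \<in> X \<Longrightarrow> periodic_2pi f"
    and X_trig_poly: "f \<in> trig_poly n \<Longrightarrow> f \<in> X"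
    and nq_add: "f \<in> X \<Longrightarrow> g \<in> X \<Longrightarrow> nq (\<lambda>x. f x + g x) \<le> nq f + nq g"
    and nq_scale: "f \<in> X \<Longrightarrow> nq (\<lambda>x. c * f x) = norm c powr q * nq f"
    and nq_shift: "f \<in> X \<Longrightarrow> nq (\<lambda>x. f (x + h)) = nq f"
begin

section \<open>Estimates for differences in the abstract space\<close>

lemma X_diff [intro]: "f \<in> X \<Longrightarrow> g \<in> X \<Longrightarrow> (\<lambda>x. f x - g x) \<in> X"
  using X_add[of f "\<lambda>x. (-1) * g x"] X_scale[of g "-1"] by simp

lemma X_sum [intro]: "(\<And>i. i \<in> I \<Longrightarrow> f i \<in> X) \<Longrightarrow> (\<lambda>x. \<Sum>i\<in>I. f i x) \<in> X"
  by (induction I rule: infinite_finite_induct) auto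

lemma X_fdiff [intro]: "f \<in> X \<Longrightarrow> fdiff k \<delta> f \<in> X"
proof (induction k)
  case (Suc k)
  then have "(\<lambda>x. fdiff k \<delta> f x - fdiff k \<delta> f (x + \<delta>)) \<in> X" by auto
  then show ?case by (simp add: fdiff_Suc[abs_def])
qed simp

lemma nq_zero [simp]: "nq (\<lambda>x. 0) = 0"
  using nq_scale[OF X_zero, of 0] by simp

lemma nq_uminus: "f \<in> X \<Longrightarrow> nq (\<lambda>x. - f x) = nq f"
  using nq_scale[of f "-1"] by simp

lemma nq_diff: "f \<in> X \<Longrightarrow> g \<in> X \<Longrightarrow> nq (\<lambda>x. f x - g x) \<le> nq f + nq g"
  using nq_add[of f "\<lambda>x. (-1) * g x"] X_scale[of g "-1"] nq_uminus[of g] by simp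

lemma nq_diff_commute: "f \<in> X \<Longrightarrow> g \<in> X \<Longrightarrow> nq (\<lambda>x. f x - g x) = nq (\<lambda>x. g x - f x)"
  using nq_uminus[of "\<lambda>x. f x - g x"] by (simp add: X_diff)

lemma nq_sum: "(\<And>i. i \<in> I \<Longrightarrow> f i \<in> X) \<Longrightarrow> nq (\<lambda>x. \<Sum>i\<in>I. f i x) \<le> (\<Sum>i\<in>I. nq (f i))"
proof (induction I rule: infinite_finite_induct)
  case (insert i I)
  then have "nq (\<lambda>x. f i x + (\<Sum>i\<in>I. f i x)) \<le> nq (f i) + nq (\<lambda>x. \<Sum>i\<in>I. f i x)"
    by (intro nq_add) auto
  with insert show ?case by simp
qed auto

lemma nq_fdiff_le: "f \<in> X \<Longrightarrow> nq (fdiff k \<delta> f) \<le> 2 ^ k * nq f"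
proof (induction k)
  case (Suc k)
  have "nq (fdiff (Suc k) \<delta> f) = nq (\<lambda>x. fdiff k \<delta> f x - fdiff k \<delta> f (x + \<delta>))"
    by (simp add: fdiff_Suc[abs_def])
  also have "\<dots> \<le> nq (fdiff k \<delta> f) + nq (\<lambda>x. fdiff k \<delta> f (x + \<delta>))"
    using Suc.prems by (intro nq_diff) auto
  also have "\<dots> = 2 * nq (fdiff k \<delta> f)" using Suc.prems by (simp add: nq_shift X_fdiff)
  finally show ?case using Suc by simp
qed simp

lemma nq_fdiff_mono: "f \<in> X \<Longrightarrow> j \<le> k \<Longrightarrow> nq (fdiff k \<delta> f) \<le> 2 ^ (k - j) * nq (fdiff j \<delta> f)"
  using nq_fdiff_le[of "fdiff j \<delta> f" "k - j" \<delta>] by (simp add: fdiff_compose X_fdiff)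

text \<open>\<open>fdiff_mult_step\<close> yields \<open>s * n\<close> translates with coefficients
  at most \<open>n ^ (s - 1)\<close>, hence the exponent. Divided by \<open>q\<close> it is s + 1/q
  - 1, the number with which \<open>k\<close> is compared in the theorem.\<close>

lemma nq_fdiff_growth:
  assumes "f \<in> X" "s \<ge> 1" "n \<ge> 1"
  shows "nq (fdiff s (real n * t) f) \<le> real s * real n powr (q * (real s - 1) + 1) * nq (fdiff s t f)"
proof -
  obtain c where c: "\<And>i. 0 \<le> c i \<and> c i \<le> real n ^ (s - 1)"
    and eq: "\<And>x. fdiff s (real n * t) f x = (\<Sum>i<s * n. complex_of_real (c i) * fdiff s t f (x + real i * t))"
    using fdiff_mult_step[OF assms(2), of n t f] by blast
  have "nq (fdiff s (real n * t) f) = nq (\<lambda>x. \<Sum>i<s * n. complex_of_real (c i) * fdiff s t f (x + real i * t))"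
    by (simp add: eq[abs_def])
  also have "\<dots> \<le> (\<Sum>i<s * n. nq (\<lambda>x. complex_of_real (c i) * fdiff s t f (x + real i * t)))"
    using assms by (intro nq_sum X_scale X_shift[of "fdiff s t f"] X_fdiff)
  also have "\<dots> = (\<Sum>i<s * n. c i powr q * nq (fdiff s t f))"
    using assms c by (intro sum.cong refl) (auto simp: nq_scale nq_shift X_fdiff X_shift)
  also have "\<dots> \<le> (\<Sum>i<s * n. (real n powr (real s - 1)) powr q * nq (fdiff s t f))"
  proof (intro sum_mono mult_right_mono powr_mono2)
    fix i
    have "c i \<le> real n ^ (s - 1)" using c by blast
    also have "\<dots> = real n powr (real s - 1)" using assms by (simp flip: powr_realpow add: of_nat_diff)
    finally show "c i \<le> real n powr (real s - 1)" .
  qed (use c q_pos in auto)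
  also have "\<dots> = real s * (real n powr 1 * real n powr (q * (real s - 1))) * nq (fdiff s t f)"
    using assms by (simp add: powr_powr mult.commute)
  also have "real n powr 1 * real n powr (q * (real s - 1)) = real n powr (q * (real s - 1) + 1)"
    by (simp add: powr_add mult.commute)
  finally show ?thesis .
qed

lemma nq_fdiff_minus: "f \<in> X \<Longrightarrow> nq (\<lambda>x. f x - f (x - h)) = nq (\<lambda>x. f x - f (x + h))"
proof -
  assume f: "f \<in> X"
  have "nq (\<lambda>x. f x - f (x + h)) = nq (\<lambda>x. f (x - h) - f x)"
    using nq_shift[of "\<lambda>x. f x - f (x + h)" "-h"] f by (simp add: X_diff X_shift)
  also have "\<dots> = nq (\<lambda>x. f x - f (x - h))"
    using nq_diff_commute[of "\<lambda>x. f (x + (-h))" f] f X_shift[OF f, of "-h"] by simp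
  finally show ?thesis ..
qed

text \<open>A Marchaud type inequality for one doubling of the step. With \<open>z\<close> the shift
  by \<open>t\<close>, the polynomial 2^n - (1 + z)^n is divisible by 1 - z, so replacing (1 + z)^n
  by 2^n in \<open>fdiff_double_step\<close> costs only a difference of the next order.\<close>

lemma nq_marchaud:
  assumes "f \<in> X"
  shows "2 powr (real n * q) * nq (fdiff n t f) \<le> nq (fdiff n (2 * t) f) + 4 ^ n * nq (fdiff (Suc n) t f)"
proof -
  let ?A = "\<lambda>g x. g x + g (x + t) :: complex"
  let ?D = "\<lambda>g x. g x - g (x + t) :: complex"
  have XA: "(?A ^^ n) g \<in> X" if "g \<in> X" for g n using that by (induction n) auto
  have A_le: "nq ((?A ^^ n) g) \<le> 2 ^ n * nq g" if "g \<in> X" for g n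
  proof (induction n)
    case (Suc n)
    have "nq ((?A ^^ Suc n) g) \<le> nq ((?A ^^ n) g) + nq (\<lambda>x. (?A ^^ n) g (x + t))"
      using XA[OF that] by (auto intro!: nq_add)
    with Suc XA[OF that] show ?case by (simp add: nq_shift)
  qed simp
  have main: "nq (\<lambda>x. 2 ^ n * g x - (?A ^^ n) g x) \<le> 4 ^ n * nq (?D g)" if g: "g \<in> X" for g n
  proof (induction n)
    case (Suc n)
    have comm: "(?A ^^ n) (?D g) = ?D ((?A ^^ n) g)"
      by (induction n) (simp_all add: fun_eq_iff)
    \<comment> \<open>2^(n+1) - (1 + z)^(n+1) = 2 (2^n - (1 + z)^n) + (1 + z)^n (1 - z). The
      constants follow from 2 * 4^n + 2^n \<le> 4^(n+1).\<close>
    have eq: "(\<lambda>x. 2 ^ Suc n * g x - (?A ^^ Suc n) g x)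
        = (\<lambda>x. 2 * (2 ^ n * g x - (?A ^^ n) g x) + (?A ^^ n) (?D g) x)"
      unfolding comm by (simp add: fun_eq_iff algebra_simps)
    have DX: "?D g \<in> X" using g by auto
    have "nq (\<lambda>x. 2 ^ Suc n * g x - (?A ^^ Suc n) g x)
        \<le> nq (\<lambda>x. 2 * (2 ^ n * g x - (?A ^^ n) g x)) + nq ((?A ^^ n) (?D g))"
      unfolding eq using g XA[OF g] XA[OF DX] by (intro nq_add X_scale X_diff)
    also have "nq (\<lambda>x. 2 * (2 ^ n * g x - (?A ^^ n) g x)) = 2 powr q * nq (\<lambda>x. 2 ^ n * g x - (?A ^^ n) g x)"
      using g XA[OF g] by (subst nq_scale) auto
    also have "\<dots> \<le> 2 * (4 ^ n * nq (?D g))"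
      using powr_mono[of q 1 "2::real"] q_le_1 by (intro mult_mono Suc) auto
    also have "nq ((?A ^^ n) (?D g)) \<le> 2 ^ n * nq (?D g)" using A_le[OF DX] .
    also have "(2::real) ^ n * nq (?D g) \<le> 4 ^ n * nq (?D g)" by (intro mult_right_mono power_mono) auto
    finally have *: "nq (\<lambda>x. 2 ^ Suc n * g x - (?A ^^ Suc n) g x) \<le> 3 * (4 ^ n * nq (?D g))" by simp
    have "0 \<le> 4 ^ n * nq (?D g)" by simp
    then have "3 * (4 ^ n * nq (?D g)) \<le> 4 ^ Suc n * nq (?D g)" by simp
    with * show ?case by (rule order.trans)
  qed simp
  have FX: "fdiff n t f \<in> X" using assms by auto
  have "2 powr (real n * q) * nq (fdiff n t f) = nq (\<lambda>x. 2 ^ n * fdiff n t f x)"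
    using FX by (subst nq_scale) (auto simp: norm_power powr_powr simp flip: powr_realpow)
  also have "\<dots> = nq (\<lambda>x. (2 ^ n * fdiff n t f x - (?A ^^ n) (fdiff n t f) x) + (?A ^^ n) (fdiff n t f) x)" by simp
  also have "\<dots> \<le> nq (\<lambda>x. 2 ^ n * fdiff n t f x - (?A ^^ n) (fdiff n t f) x) + nq ((?A ^^ n) (fdiff n t f))"
    using FX XA[OF FX] by (intro nq_add) auto
  also have "nq (\<lambda>x. 2 ^ n * fdiff n t f x - (?A ^^ n) (fdiff n t f) x) \<le> 4 ^ n * nq (?D (fdiff n t f))"
    by (rule main[OF FX])
  also have "?D (fdiff n t f) = fdiff (Suc n) t f" by (simp add: fdiff_Suc fun_eq_iff)
  finally show ?thesis by (simp add: fdiff_double_step)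
qed

text \<open>Vanishing of the k-th modulus of smoothness at 0, without a rate: it only serves to show
  that the approximants converge.\<close>

definition null_mod :: "nat \<Rightarrow> (real \<Rightarrow> complex) \<Rightarrow> bool" where
  "null_mod k f \<longleftrightarrow> (\<forall>\<epsilon>>0. \<exists>\<delta>>0. \<forall>t. 0 < t \<and> t < \<delta> \<longrightarrow> nq (fdiff k t f) \<le> \<epsilon>)"

text \<open>By \<open>nq_marchaud\<close> each halving of the step contracts the n-th difference by
  \<open>c < 1\<close>, up to an error controlled by the difference of order
  \<open>n + 1\<close>.\<close>

lemma null_mod_pred:
  assumes f: "f \<in> X" and n: "n \<ge> 1" and null: "null_mod (Suc n) f"
  shows "null_mod n f"
  unfolding null_mod_def
proof (intro allI impI)
  fix \<epsilon> :: real assume \<epsilon>: "\<epsilon> > 0"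
  define c where "c = 1 / 2 powr (real n * q)"
  have c: "0 < c" "c < 1" using n q_pos powr_less_mono[of 0 "real n * q" "2::real"] by (auto simp: c_def)
  define B where "B = 2 ^ n * nq f"
  \<comment> \<open>The bound is chosen so that the recursion becomes y -> c y + (1 - c) \<epsilon>
    / 2, whose fixed point is \<open>\<epsilon> / 2\<close>.\<close>
  obtain \<delta>0 where \<delta>0: "\<delta>0 > 0" and e: "\<And>t. 0 < t \<Longrightarrow> t < \<delta>0 \<Longrightarrow> nq (fdiff (Suc n) t f) \<le> \<epsilon> / 2 * (1 - c) / (c * 4 ^ n)"
    using null[unfolded null_mod_def, rule_format, of "\<epsilon> / 2 * (1 - c) / (c * 4 ^ n)"] c \<epsilon> by auto
  have step: "nq (fdiff n t f) \<le> c * nq (fdiff n (2 * t) f) + \<epsilon> / 2 * (1 - c)" if "0 < t" "t < \<delta>0" for t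
  proof -
    have "nq (fdiff n t f) = c * (2 powr (real n * q) * nq (fdiff n t f))" by (simp add: c_def)
    also have "\<dots> \<le> c * (nq (fdiff n (2 * t) f) + 4 ^ n * nq (fdiff (Suc n) t f))"
      using c nq_marchaud[OF f, of n t] by (intro mult_left_mono) auto
    also have "\<dots> \<le> c * (nq (fdiff n (2 * t) f) + 4 ^ n * (\<epsilon> / 2 * (1 - c) / (c * 4 ^ n)))"
      using c e[OF that] by (intro mult_left_mono add_mono) auto
    also have "\<dots> = c * nq (fdiff n (2 * t) f) + \<epsilon> / 2 * (1 - c)"
      using c by (simp add: distrib_left)
    finally show ?thesis .
  qed
  have iter: "nq (fdiff n t f) \<le> c ^ i * B + \<epsilon> / 2" if "0 < t" "t < \<delta>0 / 2 ^ i" for t i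
    using that
  proof (induction i arbitrary: t)
    case 0
    then show ?case using nq_fdiff_le[OF f, of n t] \<epsilon> by (simp add: B_def)
  next
    case (Suc i)
    have "\<delta>0 / 2 ^ Suc i \<le> \<delta>0" using \<delta>0 two_realpow_ge_one[of "Suc i"] by (simp add: divide_le_eq mult_le_cancel_left1)
    then have "nq (fdiff n t f) \<le> c * nq (fdiff n (2 * t) f) + \<epsilon> / 2 * (1 - c)" using Suc.prems by (intro step) auto
    also have "\<dots> \<le> c * (c ^ i * B + \<epsilon> / 2) + \<epsilon> / 2 * (1 - c)"
      using c Suc.prems \<epsilon> by (intro add_mono mult_left_mono Suc.IH) (auto simp: field_simps)
    finally show ?case by (simp add: field_simps)
  qed
  have "(\<lambda>i. c ^ i * B) \<longlonglongrightarrow> 0 * B" using c by (intro tendsto_mult LIMSEQ_power_zero tendsto_const) auto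
  then have "(\<lambda>i. c ^ i * B) \<longlonglongrightarrow> 0" by simp
  then have "eventually (\<lambda>i. c ^ i * B < \<epsilon> / 2) sequentially" by (rule order_tendstoD(2)) (use \<epsilon> in simp)
  then obtain i where "c ^ i * B < \<epsilon> / 2" by (auto simp: eventually_sequentially)
  with iter[of _ i] \<delta>0 show "\<exists>\<delta>>0. \<forall>t. 0 < t \<and> t < \<delta> \<longrightarrow> nq (fdiff n t f) \<le> \<epsilon>"
    by (intro exI[of _ "\<delta>0 / 2 ^ i"]) force
qed

lemma null_mod_1:
  assumes "f \<in> X" "k \<ge> 1" "null_mod k f" shows "null_mod 1 f"
  using assms(2,3) by (induction k rule: dec_induct) (auto dest: null_mod_pred[OF assms(1), rotated])

end

section \<open>Sampling operators and a Jackson estimate\<close>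

lemma grid_add: "grid N (i + j) = grid N i + grid N j"
  by (simp add: grid_def add_divide_distrib distrib_left)

lemma grid_double: "grid (2 * N) (2 * i) = grid N i"
  by (simp add: grid_def)

lemma grid_mult: "grid N i = real i * grid N 1"
  by (simp add: grid_def)

lemma grid_self: "N \<ge> 1 \<Longrightarrow> grid N N = 2 * pi"
  by (simp add: grid_def)

lemma grid_0 [simp]: "grid N 0 = 0"
  by (simp add: grid_def)

lemma sum_grid_shift:
  fixes \<phi> :: "real \<Rightarrow> 'a::ab_group_add"
  assumes per: "\<And>u. \<phi> (u + 2 * pi) = \<phi> u" and "N \<ge> 1"
  shows "(\<Sum>i<N. \<phi> (grid N i - grid N j)) = (\<Sum>i<N. \<phi> (grid N i))"
proof -
  \<comment> \<open>Rotating by one node trades the value at \<open>a\<close> for the value at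
    \<open>a + 2 * pi\<close>; they agree by periodicity.\<close>
  have one: "(\<Sum>i<N. \<phi> (a + grid N (Suc i))) = (\<Sum>i<N. \<phi> (a + grid N i))" for a
  proof -
    have "(\<Sum>i<N. \<phi> (a + grid N (Suc i)) - \<phi> (a + grid N i)) = \<phi> (a + grid N N) - \<phi> (a + grid N 0)"
      by (rule sum_lessThan_telescope)
    also have "\<dots> = 0" using per[of a] assms(2) by (simp add: grid_self)
    finally show ?thesis by (simp add: sum_subtractf)
  qed
  have "(\<Sum>i<N. \<phi> (grid N i - grid N j)) = (\<Sum>i<N. \<phi> (grid N i - grid N j + grid N j))"
  proof -
    have "(\<Sum>i<N. \<phi> (grid N i - grid N j)) = (\<Sum>i<N. \<phi> (grid N i - grid N j + grid N j'))" for j'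
    proof (induction j')
      case (Suc j')
      have "(\<Sum>i<N. \<phi> (grid N i - grid N j + grid N (Suc j'))) = (\<Sum>i<N. \<phi> ((grid N j' - grid N j) + grid N (Suc i)))"
        by (intro sum.cong refl arg_cong[of _ _ \<phi>])
          (simp add: grid_def add_divide_distrib distrib_left)
      also have "\<dots> = (\<Sum>i<N. \<phi> ((grid N j' - grid N j) + grid N i))" by (rule one)
      finally show ?case using Suc by (simp add: algebra_simps)
    qed simp
    then show ?thesis .
  qed
  then show ?thesis by simp
qed

lemma trig_poly_fdiff: "T \<in> trig_poly n \<Longrightarrow> fdiff k h T \<in> trig_poly n"
  unfolding fdiff_def[abs_def]
  by (intro trig_poly_sum trig_poly_scale trig_poly_shift)

lemma trig_poly_diff: "S \<in> trig_poly n \<Longrightarrow> T \<in> trig_poly n \<Longrightarrow> (\<lambda>x. S x - T x) \<in> trig_poly n"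
  using trig_poly_add[of S n "\<lambda>x. (-1) * T x"] trig_poly_scale[of T n "-1"] by simp

text \<open>Joint measurability is what exchanging the two integrations requires; periodicity
  concerns \<open>x\<close> alone, so that slices with a fixed offset can lie in
  \<open>X\<close>.\<close>

definition meas2 :: "(real \<Rightarrow> real \<Rightarrow> complex) \<Rightarrow> bool" where
  "meas2 F \<longleftrightarrow> (\<lambda>(x, l). F x l) \<in> borel_measurable (borel \<Otimes>\<^sub>M borel) \<and> (\<forall>l. periodic_2pi (\<lambda>x. F x l))"

text \<open>\<open>bnd2 F c\<close> says that the quasi-norm of \<open>F x l\<close>, taken over both variables, is at most \<open>c\<close>
  (on the scale of \<open>nq\<close>, the \<open>q\<close>-th power of the quasi-norm). The second variable is the
  offset of the sampling grid; averaging over it replaces the integral means that are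
  unavailable for \<open>p < 1\<close>.\<close>

locale sampling_quasinorm = shift_quasinorm +
  fixes bnd2 :: "(real \<Rightarrow> real \<Rightarrow> complex) \<Rightarrow> real \<Rightarrow> bool" and Q :: nat
  assumes Q_q: "3 \<le> real Q * q"
    and X_meas: "f \<in> X \<Longrightarrow> f \<in> borel_measurable borel"
    and bnd2_add: "bnd2 F a \<Longrightarrow> bnd2 G b \<Longrightarrow> bnd2 (\<lambda>x l. F x l + G x l) (a + b)"
    and bnd2_mono: "bnd2 F a \<Longrightarrow> a \<le> b \<Longrightarrow> bnd2 F b"
    and bnd2_const: "f \<in> X \<Longrightarrow> bnd2 (\<lambda>x l. f x) c \<Longrightarrow> nq f \<le> c"
    and bnd2_slice: "bnd2 F c \<Longrightarrow> 0 < c \<Longrightarrow> \<exists>l. (\<lambda>x. F x l) \<in> X \<and> nq (\<lambda>x. F x l) \<le> 2 * c"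
    and bnd2_sample: "\<And>M. M \<ge> 1 \<Longrightarrow> \<exists>C\<ge>0. \<forall>m\<ge>1. \<forall>b\<in>X. \<forall>c F. meas2 F \<longrightarrow>
        (\<forall>x l. norm (F x l) \<le> (\<Sum>i<M * m. norm (b (l + grid (M * m) i)) *
            (norm (avg_exp m (x - l - grid (M * m) i)) ^ Q
              + norm (avg_exp m (x - l - grid (M * m) i + c)) ^ Q))) \<longrightarrow>
        bnd2 F (C * nq b)"
    and bnd2_null: "\<And>M f \<epsilon>. M \<ge> 1 \<Longrightarrow> f \<in> X \<Longrightarrow> null_mod 1 f \<Longrightarrow> 0 < \<epsilon> \<Longrightarrow> \<exists>m0. \<forall>m\<ge>m0. \<forall>F. meas2 F \<longrightarrow>
        (\<forall>x l. norm (F x l) \<le> (\<Sum>i<M * m. norm (f x - f (l + grid (M * m) i)) *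
            norm (avg_exp m (x - l - grid (M * m) i)) ^ Q)) \<longrightarrow>
        bnd2 F \<epsilon>"
begin

text \<open>Names the constant of \<open>bnd2_sample\<close>: for a node density \<open>M\<close>,
  one \<open>C\<close> serves all \<open>m\<close>, \<open>b\<close>, \<open>c\<close> and
  \<open>F\<close>.\<close>

definition sample_const :: "nat \<Rightarrow> real \<Rightarrow> bool" where
  "sample_const M C \<longleftrightarrow> C \<ge> 0 \<and> (\<forall>m\<ge>1. \<forall>b\<in>X. \<forall>c F. meas2 F \<longrightarrow>
        (\<forall>x l. norm (F x l) \<le> (\<Sum>i<M * m. norm (b (l + grid (M * m) i)) *
            (norm (avg_exp m (x - l - grid (M * m) i)) ^ Q
              + norm (avg_exp m (x - l - grid (M * m) i + c)) ^ Q))) \<longrightarrow>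
        bnd2 F (C * nq b))"

lemma ex_sample_const: "M \<ge> 1 \<Longrightarrow> \<exists>C. sample_const M C"
  using bnd2_sample[of M] by (simp add: sample_const_def)

lemma sample_constD:
  assumes "sample_const M C" "m \<ge> 1" "b \<in> X" "meas2 F"
    and "\<And>x l. norm (F x l) \<le> (\<Sum>i<M * m. norm (b (l + grid (M * m) i)) *
            (norm (avg_exp m (x - l - grid (M * m) i)) ^ Q
              + norm (avg_exp m (x - l - grid (M * m) i + c)) ^ Q))"
  shows "bnd2 F (C * nq b)"
  using assms(1)[unfolded sample_const_def, THEN conjunct2, rule_format, OF assms(2-5)] .

section \<open>Bernstein's inequality\<close>

lemma Q_ge_1: "Q \<ge> 1"
  using Q_q by (cases "Q = 0") auto

text \<open>The reproducing formula is written at \<open>x\<close> and at \<open>x + h\<close>; the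
  difference of the kernels gains the factor \<open>n * \<bar>h\<bar>\<close>. The function so
  represented does not involve the offset, so the averaged bound is a bound on its
  quasi-norm.\<close>

lemma bernstein_1:
  "\<exists>C\<ge>0. \<forall>n\<ge>1. \<forall>T\<in>trig_poly n. \<forall>h. nq (fdiff 1 h T) \<le> C * (real n * \<bar>h\<bar>) powr q * nq T"
proof -
  \<comment> \<open>The kernel of exponent \<open>Suc Q\<close> needs
    \<open>L = (Q + 2) * n\<close>, and \<open>2 * L + 1\<close> is at most
    \<open>2 * (Q + 3) * n\<close>.\<close>
  define M where "M = 2 * (Q + 3)"
  have "M \<ge> 1" by (simp add: M_def)
  then obtain C where sample: "sample_const M C" using ex_sample_const by blast
  then have C: "C \<ge> 0" by (simp add: sample_const_def)
  show ?thesis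
  proof (intro exI[of _ "C * (2 * real Q + 3) powr q"] conjI allI impI ballI)
    show "0 \<le> C * (2 * real Q + 3) powr q" using C by simp
    fix n :: nat and T and h :: real assume n: "n \<ge> 1" and T: "T \<in> trig_poly n"
    define L where "L = n + Suc Q * n"
    define N where "N = M * n"
    have N: "2 * L + 1 \<le> N" "N \<ge> 1" using n by (simp_all add: L_def N_def M_def algebra_simps)
    have Lr: "2 * real L + 1 \<le> real N" using N by linarith
    \<comment> \<open>\<open>2 * Q + 3\<close> is \<open>L + (Q + 1) * n\<close> in units of
      \<open>n\<close>. The factor is put into the sampled function, so that homogeneity of
      \<open>nq\<close> raises it to the power \<open>q\<close>.\<close>
    define c where "c = complex_of_real ((2 * real Q + 3) * (real n * \<bar>h\<bar>))"
    have norm_c: "norm c = (2 * real Q + 3) * (real n * \<bar>h\<bar>)" unfolding c_def by (subst norm_of_real) simp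
    have TX: "T \<in> X" "(\<lambda>x. T (x + h)) \<in> X" "fdiff 1 h T \<in> X" using X_trig_poly[OF T] by auto
    have "bnd2 (\<lambda>x l. fdiff 1 h T x) (C * nq (\<lambda>x. c * T x))"
    proof (rule sample_constD[where c = h, OF sample n X_scale[OF TX(1)]])
      show "meas2 (\<lambda>x l. fdiff 1 h T x)"
        using X_meas[OF TX(3)] X_periodic[OF TX(3)] by (auto simp: meas2_def)
      fix x l
      let ?u = "\<lambda>i. x - l - grid N i"
      have rep: "of_nat N * T y = (\<Sum>i<N. T (l + grid N i) * kern L n (Suc Q) (y - l - grid N i))" for y
        by (rule kern_reproduces[OF T _ N(1) n, symmetric])
            (simp add: L_def add_mono mult_le_mono)
      have "of_nat N * fdiff 1 h T x = of_nat N * T x - of_nat N * T (x + h)"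
        by (simp add: fdiff_1[simplified] algebra_simps)
      also have "\<dots> = (\<Sum>i<N. T (l + grid N i) * (kern L n (Suc Q) (?u i) - kern L n (Suc Q) (?u i + h)))"
        unfolding rep sum_subtractf[symmetric] by (intro sum.cong) (auto simp: algebra_simps)
      finally have "real N * norm (fdiff 1 h T x)
          = norm (\<Sum>i<N. T (l + grid N i) * (kern L n (Suc Q) (?u i) - kern L n (Suc Q) (?u i + h)))"
        by (metis norm_mult norm_of_nat)
      also have "\<dots> \<le> (\<Sum>i<N. norm (T (l + grid N i)) * (real N * ((2 * real Q + 3) * real n) * \<bar>h\<bar> *
            (norm (avg_exp n (?u i)) ^ Q + norm (avg_exp n (?u i + h)) ^ Q)))"
      proof (rule sum_norm_le)
        fix i assume "i \<in> {..<N}"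
        have "norm (kern L n (Suc Q) (?u i) - kern L n (Suc Q) (?u i + h))
          \<le> (2 * real L + 1) * (real L + real (Suc Q) * real n) * \<bar>h\<bar> *
              (norm (avg_exp n (?u i)) ^ Q + norm (avg_exp n (?u i + h)) ^ Q)"
          using kern_diff_le[OF n, of L Q "?u i" h] by (simp add: norm_minus_commute)
        also have "\<dots> \<le> real N * ((2 * real Q + 3) * real n) * \<bar>h\<bar> *
            (norm (avg_exp n (?u i)) ^ Q + norm (avg_exp n (?u i + h)) ^ Q)"
          using Lr by (intro mult_right_mono mult_mono) (auto simp: L_def algebra_simps)
        finally show "norm (T (l + grid N i) * (kern L n (Suc Q) (?u i) - kern L n (Suc Q) (?u i + h)))
          \<le> norm (T (l + grid N i)) * (real N * ((2 * real Q + 3) * real n) * \<bar>h\<bar> *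
            (norm (avg_exp n (?u i)) ^ Q + norm (avg_exp n (?u i + h)) ^ Q))"
          by (simp add: norm_mult mult_left_mono)
      qed
      also have "\<dots> = real N * (\<Sum>i<N. norm (c * T (l + grid N i)) *
            (norm (avg_exp n (?u i)) ^ Q + norm (avg_exp n (?u i + h)) ^ Q))"
        unfolding sum_distrib_left by (intro sum.cong refl) (simp add: norm_mult norm_c)
      finally show "norm (fdiff 1 h T x) \<le> (\<Sum>i<M * n. norm (c * T (l + grid (M * n) i)) *
            (norm (avg_exp n (x - l - grid (M * n) i)) ^ Q + norm (avg_exp n (x - l - grid (M * n) i + h)) ^ Q))"
        using N(2) by (simp add: N_def)
    qed
    then have "nq (fdiff 1 h T) \<le> C * nq (\<lambda>x. c * T x)" by (rule bnd2_const[OF TX(3)])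
    also have "nq (\<lambda>x. c * T x) = ((2 * real Q + 3) * (real n * \<bar>h\<bar>)) powr q * nq T"
      using nq_scale[OF TX(1), of c] by (simp add: norm_c)
    also have "\<dots> = (2 * real Q + 3) powr q * (real n * \<bar>h\<bar>) powr q * nq T" by (simp add: powr_mult)
    finally show "nq (fdiff 1 h T) \<le> C * (2 * real Q + 3) powr q * (real n * \<bar>h\<bar>) powr q * nq T" by simp
  qed
qed

lemma bernstein:
  "\<exists>C\<ge>0. \<forall>n\<ge>1. \<forall>T\<in>trig_poly n. \<forall>h. h \<noteq> 0 \<longrightarrow>
    nq (fdiff k h T) \<le> C * (real n * \<bar>h\<bar>) powr (q * real k) * nq T"
proof -
  obtain C where C: "C \<ge> 0" and b: "\<And>n T h. n \<ge> 1 \<Longrightarrow> T \<in> trig_poly n \<Longrightarrow> nq (fdiff 1 h T) \<le> C * (real n * \<bar>h\<bar>) powr q * nq T"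
    using bernstein_1 by blast
  show ?thesis
  proof (intro exI[of _ "C ^ k"] conjI allI impI ballI)
    show "0 \<le> C ^ k" using C by simp
    fix n :: nat and T and h :: real assume n: "n \<ge> 1" and T: "T \<in> trig_poly n" and h: "h \<noteq> 0"
    show "nq (fdiff k h T) \<le> C ^ k * (real n * \<bar>h\<bar>) powr (q * real k) * nq T"
    proof (induction k)
      \<comment> \<open>Since \<open>0 powr 0 = 0\<close>, the empty iteration is where
        \<open>h \<noteq> 0\<close> enters.\<close>
      case 0 then show ?case using h n by simp
    next
      case (Suc k)
      have "nq (fdiff (Suc k) h T) = nq (fdiff 1 h (fdiff k h T))" using fdiff_compose[of 1 h k T] by simp
      also have "\<dots> \<le> C * (real n * \<bar>h\<bar>) powr q * nq (fdiff k h T)"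
        by (intro b n trig_poly_fdiff T)
      also have "\<dots> \<le> C * (real n * \<bar>h\<bar>) powr q * (C ^ k * (real n * \<bar>h\<bar>) powr (q * real k) * nq T)"
        using C by (intro mult_left_mono Suc) auto
      also have "\<dots> = C ^ Suc k * ((real n * \<bar>h\<bar>) powr q * (real n * \<bar>h\<bar>) powr (q * real k)) * nq T"
        by simp
      also have "(real n * \<bar>h\<bar>) powr q * (real n * \<bar>h\<bar>) powr (q * real k) = (real n * \<bar>h\<bar>) powr (q * real (Suc k))"
        by (simp add: powr_add[symmetric] algebra_simps)
      finally show ?case .
    qed
  qed
qed

section \<open>Discrete convolution with a localized kernel\<close>

definition nodes :: "nat \<Rightarrow> nat" where "nodes m = 12 * Q * m"

text \<open>The smallest \<open>L\<close> for which \<open>kern_reproduces\<close> still covers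
  constants; the grid mean of this kernel is therefore one.\<close>

definition sker :: "nat \<Rightarrow> real \<Rightarrow> complex" where "sker m = kern (Q * (m - 1)) m Q"

definition smooth :: "nat \<Rightarrow> (real \<Rightarrow> complex) \<Rightarrow> real \<Rightarrow> complex" where
  "smooth m b x = (\<Sum>i<nodes m. sker m (- grid (nodes m) i) * b (x + grid (nodes m) i)) / of_nat (nodes m)"

definition resid :: "nat \<Rightarrow> (real \<Rightarrow> complex) \<Rightarrow> real \<Rightarrow> complex" where
  "resid m b x = b x - smooth m b x"

text \<open>A partial Neumann series: with K for \<open>smooth m\<close> and R = I - K for
  \<open>resid m\<close>, one has K (I + R + ... + R^(k-1)) = I - R^k.\<close>

definition presum :: "nat \<Rightarrow> nat \<Rightarrow> (real \<Rightarrow> complex) \<Rightarrow> real \<Rightarrow> complex" where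
  "presum k m f x = (\<Sum>t<k. (resid m ^^ t) f x)"

text \<open>The same convolution, with \<open>presum\<close> read off only at the nodes
  \<open>l + grid (nodes m) i\<close>: as a function of \<open>x\<close> it is a polynomial, and at
  the nodes it agrees with \<open>smooth m (presum k m f)\<close>.\<close>

definition sampled :: "nat \<Rightarrow> nat \<Rightarrow> (real \<Rightarrow> complex) \<Rightarrow> real \<Rightarrow> real \<Rightarrow> complex" where
  "sampled k m f x l = (\<Sum>i<nodes m. sker m (x - l - grid (nodes m) i) * presum k m f (l + grid (nodes m) i)) / of_nat (nodes m)"

text \<open>The factor 12 in \<open>nodes\<close> covers the degree \<open>5 * Q * m\<close>, which
  occurs when the approximants for \<open>m\<close> and \<open>2 * m\<close> are compared. It also
  exceeds \<open>2 * pi\<close>, so the grid step is below \<open>1 / m\<close>.\<close>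

lemma nodes_ge: "m \<ge> 1 \<Longrightarrow> 2 * (Q * (m - 1)) + 1 \<le> nodes m" "m \<ge> 1 \<Longrightarrow> nodes m \<ge> 1" "m \<le> nodes m"
    "m \<ge> 1 \<Longrightarrow> 2 * (5 * Q * m) + 1 \<le> nodes m"
proof -
  show "nodes m \<ge> 1" if "m \<ge> 1" using that Q_ge_1 by (simp add: nodes_def)
  have "1 \<le> Q * m" if "m \<ge> 1" using that Q_ge_1 by simp
  then show "2 * (5 * Q * m) + 1 \<le> nodes m" if "m \<ge> 1" using that by (simp add: nodes_def)
  have "m \<le> Q * m" using Q_ge_1 by simp
  then show "m \<le> nodes m" by (simp add: nodes_def)
  have "Q * (m - 1) \<le> Q * m" by simp
  with \<open>m \<ge> 1 \<Longrightarrow> 1 \<le> Q * m\<close> show "2 * (Q * (m - 1)) + 1 \<le> nodes m" if "m \<ge> 1"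
    using that unfolding nodes_def by linarith
qed

lemma sker_sum: "m \<ge> 1 \<Longrightarrow> (\<Sum>i<nodes m. sker m (x - grid (nodes m) i)) = of_nat (nodes m)"
  unfolding sker_def
  using kern_reproduces[OF trig_poly_const[of 1 0], where Q = Q and m = m and L = "Q * (m - 1)" and N = "nodes m" and l = 0 and x = x]
    nodes_ge(1)[of m] by simp

lemma norm_sker_le: "m \<ge> 1 \<Longrightarrow> norm (sker m u) / real (nodes m) \<le> norm (avg_exp m u) ^ Q"
proof -
  assume m: "m \<ge> 1"
  have "norm (sker m u) \<le> (2 * real (Q * (m - 1)) + 1) * norm (avg_exp m u) ^ Q"
    unfolding sker_def by (rule norm_kern_le)
  also have "\<dots> \<le> real (nodes m) * norm (avg_exp m u) ^ Q"
  proof (rule mult_right_mono)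
    show "2 * real (Q * (m - 1)) + 1 \<le> real (nodes m)" using nodes_ge(1)[OF m] by linarith
  qed simp
  finally show ?thesis using nodes_ge(2)[OF m] by (simp add: divide_le_eq mult.commute)
qed

lemma avg_exp_2pi: "avg_exp m (u + 2 * pi) = avg_exp m u"
  using trig_poly_periodic[OF avg_exp_trig_poly] by (simp add: periodic_2pi_def)

lemma X_smooth [intro]: "b \<in> X \<Longrightarrow> smooth m b \<in> X"
proof -
  assume b: "b \<in> X"
  have "(\<lambda>x. (1 / of_nat (nodes m)) * (\<Sum>i<nodes m. sker m (- grid (nodes m) i) * b (x + grid (nodes m) i))) \<in> X"
    using b by (intro X_scale X_sum X_shift)
  then show ?thesis by (simp add: smooth_def[abs_def])
qed

lemma X_resid [intro]: "b \<in> X \<Longrightarrow> resid m b \<in> X"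
  unfolding resid_def[abs_def] by auto

lemma X_resid_pow [intro]: "b \<in> X \<Longrightarrow> (resid m ^^ t) b \<in> X"
  by (induction t) auto

lemma X_presum [intro]: "b \<in> X \<Longrightarrow> presum k m b \<in> X"
  unfolding presum_def[abs_def] by auto

lemma smooth_sum: "smooth m (\<lambda>x. \<Sum>t\<in>I. b t x) = (\<lambda>x. \<Sum>t\<in>I. smooth m (b t) x)"
  by (rule ext) (simp add: smooth_def sum_distrib_left sum_divide_distrib sum.swap[of _ I])

lemma smooth_presum: "smooth m (presum k m f) x = f x - (resid m ^^ k) f x"
proof -
  have "smooth m (presum k m f) x = (\<Sum>t<k. (resid m ^^ t) f x - (resid m ^^ Suc t) f x)"
    unfolding presum_def[abs_def] smooth_sum by (simp add: resid_def)
  also have "\<dots> = (resid m ^^ 0) f x - (resid m ^^ k) f x"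
    by (induction k) simp_all
  finally show ?thesis by simp
qed

text \<open>Because the weights have sum one, the residual is a weighted sum of differences of
  \<open>b\<close>.\<close>

lemma resid_eq:
  "m \<ge> 1 \<Longrightarrow> resid m b x = (\<Sum>i<nodes m. (sker m (- grid (nodes m) i) / of_nat (nodes m)) * (b x - b (x + grid (nodes m) i)))"
  using sker_sum[of m 0] nodes_ge(2)[of m]
  by (simp add: resid_def smooth_def right_diff_distrib sum_subtractf sum_distrib_right[symmetric]
      sum_divide_distrib[symmetric])

lemma nq_diff_shift_le:
  assumes "b \<in> X" shows "nq (\<lambda>x. b x - b (x + real i * t)) \<le> real i * nq (\<lambda>x. b x - b (x + t))"
proof -
  have s: "(\<lambda>x. b (x + real j * t) - b (x + real j * t + t)) \<in> X" for j
    using X_shift[OF X_diff[OF assms X_shift[OF assms, of t]], of "real j * t"] .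
  have "nq (\<lambda>x. b x - b (x + real i * t)) \<le> (\<Sum>j<i. nq (\<lambda>x. b (x + real j * t) - b (x + real j * t + t)))"
    unfolding diff_shift_mult by (intro nq_sum s)
  also have "\<dots> = (\<Sum>j<i. nq (\<lambda>x. b x - b (x + t)))"
    using nq_shift[OF X_diff[OF assms X_shift[OF assms, of t]]] by simp
  finally show ?thesis by simp
qed

text \<open>A node can be reached from 0 in either direction around the circle; the shorter way
  takes \<open>min i (N - i)\<close> steps.\<close>

lemma nq_diff_grid_le:
  assumes b: "b \<in> X" and i: "i < N"
  shows "nq (\<lambda>x. b x - b (x + grid N i)) \<le> real (min i (N - i)) * nq (\<lambda>x. b x - b (x + grid N 1))"
proof -
  have 1: "nq (\<lambda>x. b x - b (x + grid N i)) \<le> real i * nq (\<lambda>x. b x - b (x + grid N 1))"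
    using nq_diff_shift_le[OF b, of i "grid N 1"] by (simp add: grid_mult[of N i])
  have per: "b (x + 2 * pi) = b x" for x using X_periodic[OF b] by (simp add: periodic_2pi_def)
  have "b (x + grid N i) = b (x - grid N (N - i))" for x
  proof -
    have "grid N i = 2 * pi - grid N (N - i)"
      using i grid_add[of N i "N - i"] grid_self[of N] by simp
    then have "x + grid N i = x - grid N (N - i) + 2 * pi" by simp
    then show ?thesis by (simp only: per)
  qed
  then have "nq (\<lambda>x. b x - b (x + grid N i)) = nq (\<lambda>x. b x - b (x + grid N (N - i)))"
    using nq_fdiff_minus[OF b] by simp
  also have "\<dots> \<le> real (N - i) * nq (\<lambda>x. b x - b (x + grid N 1))"
    using nq_diff_shift_le[OF b, of "N - i" "grid N 1"] by (simp add: grid_mult[of N "N - i"])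
  finally show ?thesis using 1 by (simp add: min_def)
qed

lemma avg_exp_grid_decay:
  assumes i: "i < N" and m: "m \<ge> 1"
  shows "norm (avg_exp m (- grid N i)) * real (min i (N - i)) \<le> real N / real m"
proof -
  \<comment> \<open>The signed distance \<open>y\<close> covers both halves of the circle at once;
    the constant 6 of \<open>norm_avg_exp_decay\<close> is cancelled by
    \<open>2 * pi > 6\<close>.\<close>
  have *: "norm (avg_exp m (2 * pi * y / real N)) * \<bar>y\<bar> \<le> real N / real m" if "\<bar>y\<bar> \<le> real N / 2" for y
  proof -
    have "\<bar>2 * pi * y / real N\<bar> \<le> pi" using that i by (simp add: abs_mult field_simps)
    from norm_avg_exp_decay[OF this, of m]
    have "norm (avg_exp m (2 * pi * y / real N)) * (2 * pi * \<bar>y\<bar>) \<le> 6 / real m * real N"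
      using i by (simp add: abs_mult field_simps)
    have "6 * (norm (avg_exp m (2 * pi * y / real N)) * \<bar>y\<bar>)
        = norm (avg_exp m (2 * pi * y / real N)) * (2 * 3 * \<bar>y\<bar>)" by simp
    also have "\<dots> \<le> norm (avg_exp m (2 * pi * y / real N)) * (2 * pi * \<bar>y\<bar>)"
      using pi_gt3 by (intro mult_left_mono mult_right_mono) auto
    also have "\<dots> \<le> 6 / real m * real N" by fact
    also have "\<dots> = 6 * (real N / real m)" by simp
    finally have "6 * (norm (avg_exp m (2 * pi * y / real N)) * \<bar>y\<bar>) \<le> 6 * (real N / real m)" .
    then show ?thesis by linarith
  qed
  show ?thesis
  proof (cases "2 * i \<le> N")
    case True
    then have "norm (avg_exp m (- grid N i)) * real i \<le> real N / real m"
      using *[of "- real i"] by (simp add: grid_def)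
    then show ?thesis using True by (simp add: min_def)
  next
    case False
    have "avg_exp m (- grid N i) = avg_exp m (grid N (N - i))"
      using avg_exp_2pi[of m "- grid N i"] i grid_add[of N i "N - i"] grid_self[of N] by simp
    then have "norm (avg_exp m (- grid N i)) * real (N - i) \<le> real N / real m"
      using *[of "real (N - i)"] False i by (simp add: grid_def)
    moreover have "min i (N - i) = N - i" using False by simp
    ultimately show ?thesis by simp
  qed
qed

text \<open>The condition \<open>Q_q\<close> provides three powers of \<open>avg_exp\<close>: one
  compensates the distance \<open>min i (N - i)\<close>, the other two are summed by the discrete
  Parseval identity. Each of the two uses contributes a factor
  \<open>N / m = 12 * Q\<close>.\<close>

lemma nq_resid_le:
  assumes b: "b \<in> X" and m: "m \<ge> 1"
  shows "nq (resid m b) \<le> (12 * real Q)\<^sup>2 * nq (\<lambda>x. b x - b (x + grid (nodes m) 1))"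
proof -
  define N where "N = nodes m"
  define D where "D = nq (\<lambda>x. b x - b (x + grid N 1))"
  have N: "N \<ge> 1" "m \<le> N" using nodes_ge m by (auto simp: N_def)
  have Nm: "real N / real m = 12 * real Q" using m by (simp add: N_def nodes_def)
  let ?G = "\<lambda>i. norm (avg_exp m (- grid N i))"
  have summand: "nq (\<lambda>x. (sker m (- grid N i) / of_nat N) * (b x - b (x + grid N i))) \<le> (?G i)\<^sup>2 * (12 * real Q * D)"
    if i: "i < N" for i
  proof -
    have w: "norm (sker m (- grid N i) / of_nat N) powr q \<le> ?G i ^ 3"
    proof -
      have "norm (sker m (- grid N i) / of_nat N) powr q \<le> (?G i ^ Q) powr q"
        using norm_sker_le[OF m, of "- grid N i"] q_pos by (intro powr_mono2) (auto simp: N_def norm_divide)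
      also have "\<dots> \<le> ?G i ^ 3"
      proof (cases "?G i = 0")
        case True
        then have "(?G i ^ Q) powr q = 0" using Q_ge_1 by simp
        then show ?thesis by simp
      next
        case False
        then have pos: "?G i > 0" by simp
        have "(?G i ^ Q) powr q = ?G i powr (real Q * q)" using pos by (simp add: powr_powr flip: powr_realpow)
        also have "\<dots> \<le> ?G i powr 3" using pos Q_q norm_avg_exp_le_1 by (intro powr_mono') auto
        finally show ?thesis using pos by simp
      qed
      finally show ?thesis .
    qed
    have "nq (\<lambda>x. (sker m (- grid N i) / of_nat N) * (b x - b (x + grid N i)))
       = norm (sker m (- grid N i) / of_nat N) powr q * nq (\<lambda>x. b x - b (x + grid N i))"
      using b by (intro nq_scale) auto
    also have "\<dots> \<le> ?G i ^ 3 * (real (min i (N - i)) * D)"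
      unfolding D_def using w by (intro mult_mono nq_diff_grid_le b i) auto
    also have "\<dots> = (?G i)\<^sup>2 * (?G i * real (min i (N - i))) * D" by (simp add: power2_eq_square power3_eq_cube)
    also have "\<dots> \<le> (?G i)\<^sup>2 * (real N / real m) * D"
      unfolding D_def by (intro mult_right_mono mult_left_mono avg_exp_grid_decay i m) auto
    finally show ?thesis unfolding Nm by (simp add: mult.assoc)
  qed
  have "nq (resid m b) = nq (\<lambda>x. \<Sum>i<N. (sker m (- grid N i) / of_nat N) * (b x - b (x + grid N i)))"
    unfolding N_def resid_eq[OF m, abs_def] ..
  also have "\<dots> \<le> (\<Sum>i<N. nq (\<lambda>x. (sker m (- grid N i) / of_nat N) * (b x - b (x + grid N i))))"
    using b by (intro nq_sum X_scale X_diff X_shift)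
  also have "\<dots> \<le> (\<Sum>i<N. (?G i)\<^sup>2 * (12 * real Q * D))" using summand by (intro sum_mono) auto
  also have "\<dots> = (\<Sum>i<N. (?G i)\<^sup>2) * (12 * real Q * D)" by (rule sum_distrib_right[symmetric])
  also have "(\<Sum>i<N. (?G i)\<^sup>2) = real N / real m" using sum_norm_avg_exp_sq[OF m N(2), of 0] by simp
  finally show ?thesis unfolding Nm by (simp add: D_def N_def power2_eq_square mult_ac)
qed

lemma resid_diff_shift: "resid m (\<lambda>x. b x - b (x + h)) = (\<lambda>x. resid m b x - resid m b (x + h))"
  by (rule ext) (simp add: resid_def smooth_def right_diff_distrib sum_subtractf diff_divide_distrib add_ac)

text \<open>\<open>resid m\<close> commutes with differences, so each of the \<open>k\<close>
  applications yields one further difference with the grid step.\<close>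

lemma nq_resid_pow_le:
  assumes "b \<in> X" "m \<ge> 1"
  shows "nq ((resid m ^^ k) b) \<le> ((12 * real Q)\<^sup>2) ^ k * nq (fdiff k (grid (nodes m) 1) b)"
  using assms(1)
proof (induction k arbitrary: b)
  case (Suc k)
  let ?h = "grid (nodes m) 1"
  have comm: "(resid m ^^ k) (\<lambda>x. b x - b (x + ?h)) = (\<lambda>x. (resid m ^^ k) b x - (resid m ^^ k) b (x + ?h))"
    by (induction k) (simp_all add: resid_diff_shift)
  have "nq ((resid m ^^ Suc k) b) \<le> (12 * real Q)\<^sup>2 * nq ((resid m ^^ k) (\<lambda>x. b x - b (x + ?h)))"
    unfolding comm using nq_resid_le[OF X_resid_pow[OF Suc.prems] assms(2)] by simp
  also have "\<dots> \<le> (12 * real Q)\<^sup>2 * (((12 * real Q)\<^sup>2) ^ k * nq (fdiff k ?h (\<lambda>x. b x - b (x + ?h))))"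
    using Suc.prems by (intro mult_left_mono Suc.IH) auto
  finally show ?case by (simp add: fdiff_Suc')
qed simp

section \<open>Sampled approximants and their refinement\<close>

lemma sampled_trig_poly: "(\<lambda>x. sampled k m f x l) \<in> trig_poly (2 * Q * (m - 1))"
proof -
  have "(\<lambda>x. (1 / of_nat (nodes m)) * (\<Sum>i<nodes m. presum k m f (l + grid (nodes m) i) * sker m (x + (- l - grid (nodes m) i)))) \<in> trig_poly (Q * (m - 1) + Q * (m - 1))"
    unfolding sker_def
    by (intro trig_poly_scale trig_poly_sum trig_poly_shift[OF kern_trig_poly])
  moreover have "Q * (m - 1) + Q * (m - 1) = 2 * Q * (m - 1)" by simp
  moreover have "(1 / of_nat (nodes m)) * (\<Sum>i<nodes m. presum k m f (l + grid (nodes m) i) * sker m (x + (- l - grid (nodes m) i))) = sampled k m f x l" for x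
    by (simp add: sampled_def mult.commute algebra_simps)
  ultimately show ?thesis by (simp only:)
qed

lemma sampled_grid:
  assumes f: "f \<in> X" and m: "m \<ge> 1"
  shows "sampled k m f (l + grid (nodes m) j) l = f (l + grid (nodes m) j) - (resid m ^^ k) f (l + grid (nodes m) j)"
proof -
  define N where "N = nodes m"
  define \<phi> where "\<phi> u = sker m (- u) * presum k m f (l + grid N j + u)" for u
  have N: "N \<ge> 1" using nodes_ge m by (simp add: N_def)
  have "periodic_2pi (\<lambda>x. sker m (- x))"
    unfolding sker_def by (rule trig_poly_periodic[OF trig_poly_uminus_arg[OF kern_trig_poly]])
  moreover have "periodic_2pi (presum k m f)" using f by (intro X_periodic) auto
  ultimately have per: "\<phi> (u + 2 * pi) = \<phi> u" for u
    unfolding \<phi>_def periodic_2pi_def by (simp add: add.assoc[symmetric])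
  \<comment> \<open>At a node the sampled sum differs from the sum in \<open>smooth\<close> only by
    a rotation of the grid.\<close>
  have "sampled k m f (l + grid N j) l = (\<Sum>i<N. \<phi> (grid N i - grid N j)) / of_nat N"
    by (simp add: sampled_def \<phi>_def N_def algebra_simps)
  also have "\<dots> = (\<Sum>i<N. \<phi> (grid N i)) / of_nat N" using sum_grid_shift[of \<phi>, OF per N] by simp
  also have "\<dots> = smooth m (presum k m f) (l + grid N j)" by (simp add: smooth_def \<phi>_def N_def)
  finally show ?thesis by (simp add: smooth_presum N_def)
qed

lemma meas2_sampled: "f \<in> X \<Longrightarrow> meas2 (sampled k m f)"
proof -
  assume f: "f \<in> X"
  have [measurable]: "presum k m f \<in> borel_measurable borel" using f by (intro X_meas) auto
  have [measurable]: "sker m \<in> borel_measurable borel"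
    unfolding sker_def by (intro borel_measurable_continuous_onI trig_poly_continuous[OF kern_trig_poly])
  have "(\<lambda>(x, l). sampled k m f x l) \<in> borel_measurable (borel \<Otimes>\<^sub>M borel)"
    unfolding sampled_def by measurable
  then show ?thesis using trig_poly_periodic[OF sampled_trig_poly] by (simp add: meas2_def)
qed

lemma meas2_diff: "meas2 F \<Longrightarrow> meas2 G \<Longrightarrow> meas2 (\<lambda>x l. F x l - G x l)"
  unfolding meas2_def periodic_2pi_def by (auto simp: case_prod_beta)

text \<open>The coarse grid is contained in the fine one, so at its nodes both approximants are
  \<open>f\<close> minus a residual. Their difference is a polynomial of degree at most
  \<open>4 * Q * m\<close> and is recovered everywhere from these node values by
  \<open>kern_reproduces\<close>.\<close>

lemma sampled_refine:
  "\<exists>C\<ge>0. \<forall>m\<ge>1. \<forall>f\<in>X. bnd2 (\<lambda>x l. sampled k (2 * m) f x l - sampled k m f x l)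
      (C * (nq (fdiff k (grid (nodes m) 1) f) + nq (fdiff k (grid (nodes (2 * m)) 1) f)))"
proof -
  have "12 * Q \<ge> 1" using Q_ge_1 by simp
  then obtain C where sample: "sample_const (12 * Q) C" using ex_sample_const by blast
  then have C: "C \<ge> 0" by (simp add: sample_const_def)
  define K where "K = ((12 * real Q)\<^sup>2) ^ k"
  have K: "K \<ge> 0" by (simp add: K_def)
  show ?thesis
  proof (intro exI[of _ "C * K"] conjI allI impI ballI)
    show "0 \<le> C * K" using C K by simp
    fix m :: nat and f assume m: "m \<ge> 1" and f: "f \<in> X"
    define N where "N = nodes m"
    have m2: "2 * m \<ge> 1" using m by simp
    have N2: "nodes (2 * m) = 2 * N" by (simp add: nodes_def N_def)
    define b where "b x = (resid m ^^ k) f x - (resid (2 * m) ^^ k) f x" for x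
    have bX: "b \<in> X" unfolding b_def[abs_def] using f by auto
    let ?P = "\<lambda>x l. sampled k (2 * m) f x l - sampled k m f x l"
    have "bnd2 ?P (C * nq b)"
    proof (rule sample_constD[where c = 0, OF sample m bX])
      show "meas2 ?P" using f by (intro meas2_diff meas2_sampled)
      fix x l
      have P: "(\<lambda>x. ?P x l) \<in> trig_poly (4 * Q * m)"
      proof (rule trig_poly_diff)
        show "(\<lambda>x. sampled k (2 * m) f x l) \<in> trig_poly (4 * Q * m)"
          by (rule trig_poly_mono[OF sampled_trig_poly]) simp
        have "2 * Q * (m - 1) \<le> 4 * Q * m" by (rule mult_le_mono) auto
        then show "(\<lambda>x. sampled k m f x l) \<in> trig_poly (4 * Q * m)"
          by (rule trig_poly_mono[OF sampled_trig_poly])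
      qed
      have Pb: "?P (l + grid N i) l = b (l + grid N i)" for i
        using sampled_grid[OF f m2, of k l "2 * i"] sampled_grid[OF f m, of k l i]
        unfolding N2 grid_double b_def N_def[symmetric] by simp
      have rep: "of_nat N * ?P x l = (\<Sum>i<N. b (l + grid N i) * kern (5 * Q * m) m Q (x - l - grid N i))"
        unfolding Pb[symmetric]
      proof (rule kern_reproduces[OF P, symmetric])
        have "Q * (m - 1) \<le> Q * m" by simp
        then show "4 * Q * m + Q * (m - 1) \<le> 5 * Q * m" by simp
        show "2 * (5 * Q * m) + 1 \<le> N" unfolding N_def by (rule nodes_ge(4)[OF m])
      qed (rule m)
      have "real N * norm (?P x l) = norm (\<Sum>i<N. b (l + grid N i) * kern (5 * Q * m) m Q (x - l - grid N i))"
        unfolding rep[symmetric] by (simp add: norm_mult)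
      also have "\<dots> \<le> (\<Sum>i<N. norm (b (l + grid N i)) * (real N * norm (avg_exp m (x - l - grid N i)) ^ Q))"
      proof (rule sum_norm_le)
        fix i
        have "norm (kern (5 * Q * m) m Q (x - l - grid N i)) \<le> (2 * real (5 * Q * m) + 1) * norm (avg_exp m (x - l - grid N i)) ^ Q"
          by (rule norm_kern_le)
        also have "\<dots> \<le> real N * norm (avg_exp m (x - l - grid N i)) ^ Q"
          using nodes_ge(4)[OF m] by (intro mult_right_mono) (simp_all add: N_def del: of_nat_mult flip: of_nat_le_iff)
        finally show "norm (b (l + grid N i) * kern (5 * Q * m) m Q (x - l - grid N i))
            \<le> norm (b (l + grid N i)) * (real N * norm (avg_exp m (x - l - grid N i)) ^ Q)"
          by (simp add: norm_mult mult_left_mono)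
      qed
      also have "\<dots> = real N * (\<Sum>i<N. norm (b (l + grid N i)) * norm (avg_exp m (x - l - grid N i)) ^ Q)"
        unfolding sum_distrib_left by (intro sum.cong) auto
      finally have "norm (?P x l) \<le> (\<Sum>i<N. norm (b (l + grid N i)) * norm (avg_exp m (x - l - grid N i)) ^ Q)"
        using nodes_ge(2)[OF m] by (simp add: N_def)
      also have "\<dots> \<le> (\<Sum>i<N. norm (b (l + grid N i)) * (norm (avg_exp m (x - l - grid N i)) ^ Q + norm (avg_exp m (x - l - grid N i + 0)) ^ Q))"
        by (intro sum_mono mult_left_mono) auto
      finally show "norm (?P x l) \<le> (\<Sum>i<12 * Q * m. norm (b (l + grid (12 * Q * m) i)) *
            (norm (avg_exp m (x - l - grid (12 * Q * m) i)) ^ Q + norm (avg_exp m (x - l - grid (12 * Q * m) i + 0)) ^ Q))"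
        unfolding N_def nodes_def .
    qed
    moreover have "C * nq b \<le> C * K * (nq (fdiff k (grid (nodes m) 1) f) + nq (fdiff k (grid (nodes (2 * m)) 1) f))"
    proof -
      have "nq b \<le> nq ((resid m ^^ k) f) + nq ((resid (2 * m) ^^ k) f)"
        unfolding b_def[abs_def] using f by (intro nq_diff) auto
      also have "\<dots> \<le> K * nq (fdiff k (grid (nodes m) 1) f) + K * nq (fdiff k (grid (nodes (2 * m)) 1) f)"
        unfolding K_def by (intro add_mono nq_resid_pow_le f m m2)
      finally have "nq b \<le> K * (nq (fdiff k (grid (nodes m) 1) f) + nq (fdiff k (grid (nodes (2 * m)) 1) f))"
        by (simp add: algebra_simps)
      then show ?thesis using C by (simp add: mult.assoc mult_left_mono)
    qed
    ultimately show "bnd2 ?P (C * K * (nq (fdiff k (grid (nodes m) 1) f) + nq (fdiff k (grid (nodes (2 * m)) 1) f)))"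
      by (rule bnd2_mono)
  qed
qed

text \<open>The error splits into \<open>F1\<close>, a weighted sum of the differences
  \<open>f x - f (l + grid N i)\<close>, and \<open>F2\<close>, the sampled
  \<open>b = f - presum k m f\<close>. The first is small by \<open>bnd2_null\<close>; in the
  second, \<open>b\<close> consists of residuals of positive order, which are controlled by
  differences of positive order.\<close>

lemma sampled_tendsto:
  assumes f: "f \<in> X" and k: "k \<ge> 1" and null: "null_mod k f" and \<epsilon>: "\<epsilon> > 0"
  shows "\<exists>m0. \<forall>m\<ge>m0. bnd2 (\<lambda>x l. f x - sampled k m f x l) \<epsilon>"
proof -
  have Q12: "12 * Q \<ge> 1" using Q_ge_1 by simp
  then obtain C where sample: "sample_const (12 * Q) C" using ex_sample_const by blast
  then have C: "C \<ge> 0" by (simp add: sample_const_def)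
  have null1: "null_mod 1 f" by (rule null_mod_1[OF f k null])
  obtain m1 where m1: "\<forall>m\<ge>m1. \<forall>F. meas2 F \<longrightarrow>
        (\<forall>x l. norm (F x l) \<le> (\<Sum>i<nodes m. norm (f x - f (l + grid (nodes m) i)) *
            norm (avg_exp m (x - l - grid (nodes m) i)) ^ Q)) \<longrightarrow> bnd2 F (\<epsilon> / 2)"
    using bnd2_null[OF Q12 f null1, of "\<epsilon> / 2"] \<epsilon> unfolding nodes_def by auto
  define B where "B = (\<Sum>t\<in>{1..<k}. ((12 * real Q)\<^sup>2) ^ t * 2 ^ (t - 1))"
  have B: "B \<ge> 0" unfolding B_def by (intro sum_nonneg) auto
  \<comment> \<open>The summand 1 keeps the denominator positive when
    \<open>C * B = 0\<close>.\<close>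
  define \<epsilon>1 where "\<epsilon>1 = \<epsilon> / (2 * (C * B + 1))"
  have \<epsilon>1: "\<epsilon>1 > 0" "C * B * \<epsilon>1 \<le> \<epsilon> / 2"
    using \<epsilon> B C by (auto simp: \<epsilon>1_def divide_simps add_nonneg_pos)
  obtain \<delta> where \<delta>: "\<delta> > 0" and d: "\<And>t. 0 < t \<Longrightarrow> t < \<delta> \<Longrightarrow> nq (fdiff 1 t f) \<le> \<epsilon>1"
    using null1 \<epsilon>1 unfolding null_mod_def by blast
  obtain m2 :: nat where m2: "1 / \<delta> < real m2" using reals_Archimedean2 by blast
  show ?thesis
  proof (intro exI[of _ "max 1 (max m1 m2)"] allI impI)
    fix m assume "max 1 (max m1 m2) \<le> m"
    then have m: "m \<ge> 1" "m \<ge> m1" "m \<ge> m2" by auto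
    define N where "N = nodes m"
    have N: "N \<ge> 1" "real N = 12 * real Q * real m" using nodes_ge m by (auto simp: N_def nodes_def)
    have h: "0 < grid N 1" "grid N 1 < \<delta>"
    proof -
      show "0 < grid N 1" using N by (simp add: grid_def)
      have "1 < \<delta> * real m2" using m2 \<delta> by (simp add: field_simps)
      also have "\<dots> \<le> \<delta> * real m" using m \<delta> by simp
      finally have m\<delta>: "1 < \<delta> * real m" .
      have "2 * pi < 12 * 1" using pi_less_4 by simp
      also have "\<dots> < 12 * (\<delta> * real m)" using m\<delta> by simp
      also have "\<dots> \<le> 12 * (\<delta> * real m) * real Q"
      proof -
        have "12 * (\<delta> * real m) * 1 \<le> 12 * (\<delta> * real m) * real Q"
          using Q_ge_1 m\<delta> by (intro mult_left_mono) auto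
        then show ?thesis by simp
      qed
      finally show "grid N 1 < \<delta>" unfolding grid_def using N by (simp add: divide_less_eq algebra_simps)
    qed
    define b where "b x = f x - presum k m f x" for x
    have bX: "b \<in> X" unfolding b_def[abs_def] using f by auto
    have nqb: "nq b \<le> B * \<epsilon>1"
    proof -
      have "presum k m f x = f x + (\<Sum>t\<in>{1..<k}. (resid m ^^ t) f x)" for x
        using k sum.atLeast_Suc_lessThan[of 0 k "\<lambda>t. (resid m ^^ t) f x"]
        by (simp add: presum_def lessThan_atLeast0)
      then have "b = (\<lambda>x. - (\<Sum>t\<in>{1..<k}. (resid m ^^ t) f x))" by (simp add: b_def fun_eq_iff)
      then have "nq b = nq (\<lambda>x. \<Sum>t\<in>{1..<k}. (resid m ^^ t) f x)"
        using nq_uminus[OF X_sum[of "{1..<k}" "\<lambda>t. (resid m ^^ t) f"]] f by auto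
      also have "\<dots> \<le> (\<Sum>t\<in>{1..<k}. nq ((resid m ^^ t) f))" using f by (intro nq_sum) auto
      also have "\<dots> \<le> (\<Sum>t\<in>{1..<k}. ((12 * real Q)\<^sup>2) ^ t * 2 ^ (t - 1) * \<epsilon>1)"
      proof (rule sum_mono)
        fix t assume t: "t \<in> {1..<k}"
        have "nq ((resid m ^^ t) f) \<le> ((12 * real Q)\<^sup>2) ^ t * nq (fdiff t (grid N 1) f)"
          unfolding N_def by (rule nq_resid_pow_le[OF f m(1)])
        also have "nq (fdiff t (grid N 1) f) \<le> 2 ^ (t - 1) * nq (fdiff 1 (grid N 1) f)"
          using t by (intro nq_fdiff_mono f) auto
        also have "nq (fdiff 1 (grid N 1) f) \<le> \<epsilon>1" by (rule d[OF h])
        finally show "nq ((resid m ^^ t) f) \<le> ((12 * real Q)\<^sup>2) ^ t * 2 ^ (t - 1) * \<epsilon>1"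
          by (simp add: mult_left_mono mult.assoc)
      qed
      also have "\<dots> = B * \<epsilon>1" by (simp add: B_def sum_distrib_right)
      finally show ?thesis .
    qed
    have presum_meas [measurable]: "presum k m f \<in> borel_measurable borel" "b \<in> borel_measurable borel" "f \<in> borel_measurable borel"
      using f bX by (auto intro: X_meas)
    have sker_meas [measurable]: "sker m \<in> borel_measurable borel"
      unfolding sker_def by (intro borel_measurable_continuous_onI trig_poly_continuous[OF kern_trig_poly])
    have sker_per: "sker m (u + 2 * pi) = sker m u" for u
      using trig_poly_periodic[OF kern_trig_poly] by (simp add: sker_def periodic_2pi_def)
    have f_per: "f (u + 2 * pi) = f u" for u using X_periodic[OF f] by (simp add: periodic_2pi_def)
    define F1 where "F1 x l = (\<Sum>i<N. sker m (x - l - grid N i) / of_nat N * (f x - f (l + grid N i)))" for x l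
    define F2 where "F2 x l = (\<Sum>i<N. sker m (x - l - grid N i) / of_nat N * b (l + grid N i))" for x l
    have meas: "meas2 F1" "meas2 F2"
    proof -
      have "(\<lambda>(x, l). F1 x l) \<in> borel_measurable (borel \<Otimes>\<^sub>M borel)" unfolding F1_def by measurable
      moreover have "(\<lambda>(x, l). F2 x l) \<in> borel_measurable (borel \<Otimes>\<^sub>M borel)" unfolding F2_def by measurable
      moreover have "x + 2 * pi - l - u = (x - l - u) + 2 * pi" for x l u :: real by simp
      ultimately show "meas2 F1" "meas2 F2"
        by (simp_all only: meas2_def periodic_2pi_def F1_def F2_def sker_per f_per simp_thms)
    qed
    have w: "norm (sker m u / of_nat N) \<le> norm (avg_exp m u) ^ Q" for u
      using norm_sker_le[OF m(1), of u] by (simp add: N_def norm_divide)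
    have "bnd2 F1 (\<epsilon> / 2)"
    proof (rule m1[rule_format, OF m(2) meas(1)])
      fix x l
      show "norm (F1 x l) \<le> (\<Sum>i<nodes m. norm (f x - f (l + grid (nodes m) i)) *
            norm (avg_exp m (x - l - grid (nodes m) i)) ^ Q)"
        unfolding F1_def N_def[symmetric]
      proof (rule sum_norm_le)
        fix i
        show "norm (sker m (x - l - grid N i) / of_nat N * (f x - f (l + grid N i)))
          \<le> norm (f x - f (l + grid N i)) * norm (avg_exp m (x - l - grid N i)) ^ Q"
          unfolding norm_mult[of _ "f x - _"] using mult_right_mono[OF w norm_ge_zero] by (simp add: mult.commute)
      qed
    qed
    moreover have "bnd2 F2 (C * nq b)"
    proof (rule sample_constD[OF sample m(1) bX meas(2), where c = 0])
      fix x l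
      have "norm (F2 x l) \<le> (\<Sum>i<N. norm (b (l + grid N i)) *
            (norm (avg_exp m (x - l - grid N i)) ^ Q + norm (avg_exp m (x - l - grid N i + 0)) ^ Q))"
        unfolding F2_def
      proof (rule sum_norm_le)
        fix i
        have "norm (sker m (x - l - grid N i) / of_nat N * b (l + grid N i))
          \<le> norm (b (l + grid N i)) * norm (avg_exp m (x - l - grid N i)) ^ Q"
          unfolding norm_mult[of _ "b _"] using w by (simp add: mult.commute mult_left_mono)
        also have "\<dots> \<le> norm (b (l + grid N i)) *
            (norm (avg_exp m (x - l - grid N i)) ^ Q + norm (avg_exp m (x - l - grid N i + 0)) ^ Q)"
          by (intro mult_left_mono) auto
        finally show "norm (sker m (x - l - grid N i) / of_nat N * b (l + grid N i)) \<le> \<dots>" .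
      qed
      then show "norm (F2 x l) \<le> (\<Sum>i<12 * Q * m. norm (b (l + grid (12 * Q * m) i)) *
            (norm (avg_exp m (x - l - grid (12 * Q * m) i)) ^ Q + norm (avg_exp m (x - l - grid (12 * Q * m) i + 0)) ^ Q))"
        unfolding N_def nodes_def .
    qed
    moreover have "C * nq b \<le> \<epsilon> / 2"
      using mult_left_mono[OF nqb C] \<epsilon>1(2) by (simp add: mult.assoc)
    ultimately have "bnd2 (\<lambda>x l. F1 x l + F2 x l) (\<epsilon> / 2 + \<epsilon> / 2)"
      using bnd2_mono bnd2_add by blast
    moreover have "F1 x l + F2 x l = f x - sampled k m f x l" for x l
    proof -
      have "(\<Sum>i<N. sker m (x - l - grid N i) / of_nat N * f x) = f x"
        using sker_sum[OF m(1), of "x - l"] N(1)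
        by (simp add: N_def sum_distrib_right[symmetric] sum_divide_distrib[symmetric])
      then show ?thesis
        unfolding F1_def F2_def sampled_def b_def N_def[symmetric]
        by (simp add: right_diff_distrib sum_subtractf sum_divide_distrib)
    qed
    ultimately show "bnd2 (\<lambda>x l. f x - sampled k m f x l) \<epsilon>" by simp
  qed
qed

text \<open>The telescoping starts at a level so fine that the error is below the target and
  descends to level \<open>j\<close>; the descents cost the terms of a geometric series with ratio
  \<open>c\<close>. The degree is 0 for \<open>j = 0\<close>, so the coarsest approximant is a
  constant.\<close>

lemma weak_jackson:
  assumes k: "k \<ge> 1" and \<beta>: "\<beta> > 0"
  shows "\<exists>C>0. \<forall>j A. \<forall>f\<in>X. 0 < A \<longrightarrow>
    (\<forall>t. 0 < t \<and> t < 1 / 2 ^ j \<longrightarrow> nq (fdiff k t f) \<le> A * t powr \<beta>) \<longrightarrow>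
    (\<exists>T\<in>trig_poly (2 * Q * (2 ^ j - 1)). nq (\<lambda>x. f x - T x) \<le> C * A * (1 / 2 ^ j) powr \<beta>)"
proof -
  obtain C where C: "C \<ge> 0" and refine: "\<And>m f. m \<ge> 1 \<Longrightarrow> f \<in> X \<Longrightarrow>
      bnd2 (\<lambda>x l. sampled k (2 * m) f x l - sampled k m f x l)
      (C * (nq (fdiff k (grid (nodes m) 1) f) + nq (fdiff k (grid (nodes (2 * m)) 1) f)))"
    using sampled_refine[of k] by blast
  define c where "c = (1 / 2) powr \<beta>"
  have c: "0 < c" "c < 1" using \<beta> powr_less_mono2[of \<beta> "1/2" 1] by (auto simp: c_def)
  have cj: "(1 / 2 ^ j) powr \<beta> = c ^ j" for j :: nat
  proof -
    have "(1 / 2 ^ j) powr \<beta> = ((1 / 2) powr real j) powr \<beta>"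
      by (simp add: powr_realpow power_one_over)
    also have "\<dots> = c powr real j" by (simp add: c_def powr_powr mult.commute)
    finally show ?thesis using c by (simp add: powr_realpow)
  qed
  \<comment> \<open>The outer 2 is the price for selecting an offset; inside, 1 is the starting
    error and the rest sums the refinements.\<close>
  define C' where "C' = 2 * (1 + 2 * C / (1 - c))"
  have C': "C' > 0" using C c by (simp add: C'_def add_pos_nonneg)
  show ?thesis
  proof (intro exI[of _ C'] conjI allI ballI impI)
    show "0 < C'" by (rule C')
    fix j A f assume f: "f \<in> X" and A: "0 < A"
      and hol: "\<forall>t. 0 < t \<and> t < 1 / 2 ^ j \<longrightarrow> nq (fdiff k t f) \<le> A * t powr \<beta>"
    have small: "nq (fdiff k (grid (nodes (2 ^ i)) 1) f) \<le> A * c ^ i" if "i \<ge> j" for i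
    proof -
      have "2 * pi < 12 * 1" using pi_less_4 by simp
      also have "\<dots> \<le> 12 * real Q" using Q_ge_1 by simp
      finally have g: "0 < grid (nodes (2 ^ i)) 1" "grid (nodes (2 ^ i)) 1 < 1 / 2 ^ i"
        using Q_ge_1 by (auto simp: grid_def nodes_def field_simps)
      have "1 / 2 ^ i \<le> 1 / (2 ^ j :: real)" using that by (intro divide_left_mono power_increasing) auto
      with g(2) have "grid (nodes (2 ^ i)) 1 < 1 / 2 ^ j" by linarith
      then have "nq (fdiff k (grid (nodes (2 ^ i)) 1) f) \<le> A * (grid (nodes (2 ^ i)) 1) powr \<beta>"
        using hol g(1) by blast
      also have "\<dots> \<le> A * (1 / 2 ^ i) powr \<beta>" using A g \<beta> by (intro mult_left_mono powr_mono2) auto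
      finally show ?thesis by (simp add: cj)
    qed
    have null: "null_mod k f"
      unfolding null_mod_def
    proof (intro allI impI)
      fix \<epsilon> :: real assume \<epsilon>: "\<epsilon> > 0"
      define \<delta> where "\<delta> = min (1 / 2 ^ j) ((\<epsilon> / A) powr (1 / \<beta>))"
      show "\<exists>\<delta>>0. \<forall>t. 0 < t \<and> t < \<delta> \<longrightarrow> nq (fdiff k t f) \<le> \<epsilon>"
      proof (intro exI[of _ \<delta>] conjI allI impI)
        show "\<delta> > 0" using \<epsilon> A by (simp add: \<delta>_def)
        fix t assume t: "0 < t \<and> t < \<delta>"
        then have "nq (fdiff k t f) \<le> A * t powr \<beta>" using hol by (simp add: \<delta>_def)
        also have "\<dots> \<le> A * ((\<epsilon> / A) powr (1 / \<beta>)) powr \<beta>"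
          using t A \<beta> by (intro mult_left_mono powr_mono2) (auto simp: \<delta>_def)
        also have "\<dots> = \<epsilon>" using A \<epsilon> \<beta> by (simp add: powr_powr)
        finally show "nq (fdiff k t f) \<le> \<epsilon>" .
      qed
    qed
    \<comment> \<open>The starting error has the size of the final bound; how fine the starting
      level must be does not enter the constant.\<close>
    define \<epsilon> where "\<epsilon> = A * c ^ j"
    have \<epsilon>: "\<epsilon> > 0" using A c by (simp add: \<epsilon>_def)
    obtain m0 where m0: "\<And>m. m \<ge> m0 \<Longrightarrow> bnd2 (\<lambda>x l. f x - sampled k m f x l) \<epsilon>"
      using sampled_tendsto[OF f k null \<epsilon>] by blast
    let ?S = "\<lambda>i. sampled k (2 ^ i) f"
    have start: "bnd2 (\<lambda>x l. f x - ?S (j + m0) x l) \<epsilon>"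
    proof (rule m0)
      have "m0 \<le> j + m0" by simp
      also have "\<dots> \<le> 2 ^ (j + m0)" by (rule less_imp_le[OF less_exp])
      finally show "m0 \<le> 2 ^ (j + m0)" .
    qed
    have chain: "bnd2 (\<lambda>x l. f x - ?S (j + (m0 - d)) x l) (\<epsilon> + (\<Sum>i\<in>{m0 - d..<m0}. 2 * C * \<epsilon> * c ^ i))" if "d \<le> m0" for d
      using that
    proof (induction d)
      case 0 then show ?case using start by simp
    next
      case (Suc d)
      define i where "i = m0 - Suc d"
      have i: "m0 - d = Suc i" "i < m0" using Suc.prems by (auto simp: i_def)
      have s1: "nq (fdiff k (grid (nodes (2 ^ (j + i))) 1) f) \<le> A * c ^ (j + i)"
        by (rule small) simp
      have "nq (fdiff k (grid (nodes (2 ^ (j + Suc i))) 1) f) \<le> A * c ^ (j + Suc i)"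
        by (rule small) simp
      also have "\<dots> \<le> A * c ^ (j + i)" using A c by (intro mult_left_mono power_decreasing) auto
      finally have "C * (nq (fdiff k (grid (nodes (2 ^ (j + i))) 1) f) + nq (fdiff k (grid (nodes (2 * 2 ^ (j + i))) 1) f))
          \<le> C * (A * c ^ (j + i) + A * c ^ (j + i))"
        using C s1 by (intro mult_left_mono add_mono) auto
      also have "\<dots> = 2 * C * \<epsilon> * c ^ i" by (simp add: \<epsilon>_def power_add)
      finally have "bnd2 (\<lambda>x l. ?S (j + Suc i) x l - ?S (j + i) x l) (2 * C * \<epsilon> * c ^ i)"
        using bnd2_mono[OF refine[of "2 ^ (j + i)", OF _ f]] by simp
      from bnd2_add[OF Suc.IH[unfolded i(1)] this]
      have "bnd2 (\<lambda>x l. f x - ?S (j + i) x l) (\<epsilon> + (\<Sum>i\<in>{Suc i..<m0}. 2 * C * \<epsilon> * c ^ i) + 2 * C * \<epsilon> * c ^ i)"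
        using Suc.prems by simp
      then show ?case using i(2) unfolding i_def[symmetric]
        by (simp add: sum.atLeast_Suc_lessThan[of i m0] add_ac)
    qed
    have "bnd2 (\<lambda>x l. f x - ?S j x l) (\<epsilon> + (\<Sum>i<m0. 2 * C * \<epsilon> * c ^ i))"
      using chain[of m0] by (simp add: lessThan_atLeast0)
    moreover have "\<epsilon> + (\<Sum>i<m0. 2 * C * \<epsilon> * c ^ i) \<le> \<epsilon> * (1 + 2 * C / (1 - c))"
    proof -
      have "(\<Sum>i<m0. c ^ i) = (1 - c ^ m0) / (1 - c)" using c by (simp add: sum_gp_strict)
      also have "\<dots> \<le> 1 / (1 - c)" using c by (intro divide_right_mono) auto
      finally have "2 * C * \<epsilon> * (\<Sum>i<m0. c ^ i) \<le> 2 * C * \<epsilon> * (1 / (1 - c))"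
        using C \<epsilon> by (intro mult_left_mono) auto
      then show ?thesis by (simp add: sum_distrib_left algebra_simps)
    qed
    ultimately have "bnd2 (\<lambda>x l. f x - ?S j x l) (\<epsilon> * (1 + 2 * C / (1 - c)))" by (rule bnd2_mono)
    moreover have "0 < \<epsilon> * (1 + 2 * C / (1 - c))" using \<epsilon> C c by (intro mult_pos_pos add_pos_nonneg) auto
    \<comment> \<open>A single offset is fixed only after all levels have been added in the averaged
      sense. Positivity of the bound is what \<open>bnd2_slice\<close> asks for.\<close>
    ultimately obtain l where "nq (\<lambda>x. f x - ?S j x l) \<le> 2 * (\<epsilon> * (1 + 2 * C / (1 - c)))"
      using bnd2_slice by blast
    also have "\<dots> = C' * A * (1 / 2 ^ j) powr \<beta>" by (simp add: C'_def \<epsilon>_def cj)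
    finally show "\<exists>T\<in>trig_poly (2 * Q * (2 ^ j - 1)). nq (\<lambda>x. f x - T x) \<le> C' * A * (1 / 2 ^ j) powr \<beta>"
      by (intro bexI[of _ "\<lambda>x. ?S j x l"] sampled_trig_poly)
  qed
qed

end

section \<open>Approximation in Hoelder spaces\<close>

lemma sum_powr_geometric_le:
  assumes "d > 0"
  shows "(\<Sum>i<n. 2 powr (real i * d)) \<le> 2 powr (real n * d) / (2 powr d - 1)"
proof -
  have x: "2 powr d > (1::real)" using assms powr_less_mono[of 0 d "2::real"] by simp
  have e: "2 powr (real i * d) = (2 powr d) ^ i" for i
    using powr_realpow[of "2 powr d" i] by (simp add: powr_powr mult.commute)
  have "(\<Sum>i<n. 2 powr (real i * d)) = ((2 powr d) ^ n - 1) / (2 powr d - 1)"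
    unfolding e using x assms geometric_sum[of "2 powr d" n] by auto
  also have "\<dots> \<le> (2 powr d) ^ n / (2 powr d - 1)" using x by (intro divide_right_mono) auto
  finally show ?thesis unfolding e .
qed

lemma inverse_power2_powr: "(1 / 2 ^ j) powr \<beta> = 2 powr (- (real j * \<beta>))"
proof -
  have "(1 / 2 ^ j :: real) = 2 powr (- real j)" by (simp add: powr_minus_divide powr_realpow)
  then show ?thesis by (simp add: powr_powr)
qed

lemma power2_powr: "((2::real) ^ j) powr \<beta> = 2 powr (real j * \<beta>)"
  using powr_realpow[of 2 j] powr_powr[of 2 "real j" \<beta>] by simp

lemma trig_poly_0_const:
  assumes "T \<in> trig_poly 0" obtains c where "T = (\<lambda>x. c)"
proof -
  have "\<exists>c. T = (\<lambda>x. c)" using assms unfolding trig_poly_cis by auto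
  then show ?thesis using that by blast
qed

section \<open>Differences bounded by a power of the step\<close>

context shift_quasinorm
begin

text \<open>With an explicit \<open>A\<close>, an inequality between two \<theta> can be read as an
  implication between two bounds, without suprema and infinite values.\<close>

definition hol :: "nat \<Rightarrow> real \<Rightarrow> real \<Rightarrow> real \<Rightarrow> (real \<Rightarrow> complex) \<Rightarrow> bool" where
  "hol k \<beta> A \<delta> f \<longleftrightarrow> (\<forall>t. 0 < t \<and> t < \<delta> \<longrightarrow> nq (fdiff k t f) \<le> A * t powr \<beta>)"

lemma hol_mono: "hol k \<beta> A \<delta> f \<Longrightarrow> A \<le> B \<Longrightarrow> \<epsilon> \<le> \<delta> \<Longrightarrow> hol k \<beta> B \<epsilon> f"
  unfolding hol_def
proof (intro allI impI)
  fix t assume *: "\<forall>t. 0 < t \<and> t < \<delta> \<longrightarrow> nq (fdiff k t f) \<le> A * t powr \<beta>"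
    and "A \<le> B" "\<epsilon> \<le> \<delta>" "0 < t \<and> t < \<epsilon>"
  then have "nq (fdiff k t f) \<le> A * t powr \<beta>" by simp
  also have "\<dots> \<le> B * t powr \<beta>" using \<open>A \<le> B\<close> by (intro mult_right_mono) auto
  finally show "nq (fdiff k t f) \<le> B * t powr \<beta>" .
qed

lemma hol_mono_order: "f \<in> X \<Longrightarrow> j \<le> k \<Longrightarrow> hol j \<beta> A \<delta> f \<Longrightarrow> hol k \<beta> (2 ^ (k - j) * A) \<delta> f"
  unfolding hol_def
proof (intro allI impI)
  fix t assume f: "f \<in> X" "j \<le> k" and *: "\<forall>t. 0 < t \<and> t < \<delta> \<longrightarrow> nq (fdiff j t f) \<le> A * t powr \<beta>"
    and t: "0 < t \<and> t < \<delta>"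
  have "nq (fdiff k t f) \<le> 2 ^ (k - j) * nq (fdiff j t f)" using f by (rule nq_fdiff_mono)
  also have "\<dots> \<le> 2 ^ (k - j) * (A * t powr \<beta>)" using * t by (intro mult_left_mono) auto
  finally show "nq (fdiff k t f) \<le> 2 ^ (k - j) * A * t powr \<beta>" by simp
qed

text \<open>Besides measuring growth, this extends a bound to steps larger by the factor
  \<open>n\<close>; fixed \<open>n\<close> serve to pass between dyadic, integer and real
  scales.\<close>

lemma hol_growth:
  assumes f: "f \<in> X" and "s \<ge> 1" "n \<ge> 1" and hol: "hol s \<beta> A \<delta> f"
  shows "hol s \<beta> (real s * real n powr (q * (real s - 1) + 1 - \<beta>) * A) (real n * \<delta>) f"
  unfolding hol_def
proof (intro allI impI)
  fix t assume t: "0 < t \<and> t < real n * \<delta>"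
  define u where "u = t / real n"
  have u: "0 < u" "u < \<delta>" "t = real n * u" using t assms by (auto simp: u_def field_simps)
  have "nq (fdiff s t f) \<le> real s * real n powr (q * (real s - 1) + 1) * nq (fdiff s u f)"
    unfolding u(3) by (rule nq_fdiff_growth) fact+
  also have "\<dots> \<le> real s * real n powr (q * (real s - 1) + 1) * (A * u powr \<beta>)"
    using hol u unfolding hol_def by (intro mult_left_mono) auto
  also have "\<dots> = real s * real n powr (q * (real s - 1) + 1 - \<beta>) * A * t powr \<beta>"
  proof -
    have "t powr \<beta> = real n powr \<beta> * u powr \<beta>" unfolding u(3) using u(1) by (simp add: powr_mult)
    moreover have "real n powr (q * (real s - 1) + 1) = real n powr (q * (real s - 1) + 1 - \<beta>) * real n powr \<beta>"
      by (simp add: powr_add[symmetric])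
    ultimately show ?thesis by simp
  qed
  finally show "nq (fdiff s t f) \<le> \<dots>" .
qed

end

section \<open>Direct and inverse estimates in Hoelder seminorms\<close>

context sampling_quasinorm
begin

text \<open>The order \<open>r\<close> of the seminorm may differ from the order \<open>k\<close> of
  the hypothesis. For \<open>h \<ge> 1 / 2 ^ j\<close> the bound on the norm suffices. For smaller
  \<open>h\<close> the approximants are telescoped from level \<open>j\<close> to the level of
  \<open>h\<close>; by Bernstein's inequality the i-th term grows like
  \<open>2 powr (i * (q * r - \<beta>))\<close>, so \<open>\<beta> < q * r\<close> makes the last
  one dominate.\<close>

lemma smooth_approx:
  assumes k: "k \<ge> 1" and \<beta>: "0 < \<beta>" "\<beta> < q * real r"
  shows "\<exists>C>0. \<forall>j A. \<forall>f\<in>X. 0 < A \<longrightarrow> hol k \<beta> A (1 / 2 ^ j) f \<longrightarrow>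
    (\<exists>T\<in>trig_poly (2 * Q * (2 ^ j - 1)). nq (\<lambda>x. f x - T x) \<le> C * A * (1 / 2 ^ j) powr \<beta> \<and>
       (\<forall>h>0. nq (fdiff r h (\<lambda>x. f x - T x)) \<le> C * A * h powr \<beta>))"
proof -
  obtain C0 where C0: "C0 > 0" and wj: "\<forall>j A. \<forall>f\<in>X. 0 < A \<longrightarrow> hol k \<beta> A (1 / 2 ^ j) f \<longrightarrow>
    (\<exists>T\<in>trig_poly (2 * Q * (2 ^ j - 1)). nq (\<lambda>x. f x - T x) \<le> C0 * A * (1 / 2 ^ j) powr \<beta>)"
    using weak_jackson[OF k \<beta>(1), folded hol_def] by (elim exE conjE)
  obtain Cb where Cb: "Cb \<ge> 0" and bern: "\<And>n T h. n \<ge> 1 \<Longrightarrow> T \<in> trig_poly n \<Longrightarrow> h \<noteq> 0 \<Longrightarrow>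
      nq (fdiff r h T) \<le> Cb * (real n * \<bar>h\<bar>) powr (q * real r) * nq T"
    using bernstein[of r] by blast
  define d where "d = q * real r - \<beta>"
  have d: "d > 0" using \<beta> by (simp add: d_def)
  have x: "2 powr d > (1::real)" using d powr_less_mono[of 0 d "2::real"] by simp
  \<comment> \<open>\<open>2 ^ r * C0\<close> bounds the remainder, the second summand the
    telescoped part: \<open>4 * Q\<close> is from the degree \<open>2 * Q * 2 ^ Suc i\<close>,
    \<open>2 * C0\<close> from two consecutive errors, the quotient from the geometric sum and
    \<open>2 ^ I \<le> 2 / h\<close>.\<close>
  define C1 where "C1 = 2 ^ r * C0 + Cb * (4 * real Q) powr (q * real r) * (2 * C0) * (2 powr d / (2 powr d - 1))"
  define C where "C = max C0 C1"
  have C: "C > 0" "C0 \<le> C" "C1 \<le> C" using C0 by (auto simp: C_def)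
  have C1r: "2 ^ r * C0 \<le> C1" using C0 Cb x by (simp add: C1_def)
  show ?thesis
  proof (intro exI[of _ C] conjI allI ballI impI)
    show "0 < C" by (rule C)
    fix j A f assume f: "f \<in> X" and A: "0 < A" and hol: "hol k \<beta> A (1 / 2 ^ j) f"
    have "\<exists>T. T \<in> trig_poly (2 * Q * (2 ^ i - 1)) \<and> nq (\<lambda>x. f x - T x) \<le> C0 * A * (1 / 2 ^ i) powr \<beta>" if "i \<ge> j" for i
    proof -
      have "hol k \<beta> A (1 / 2 ^ i) f"
        by (rule hol_mono[OF hol]) (use that in \<open>auto intro!: divide_left_mono power_increasing\<close>)
      from wj[rule_format, OF f A this] show ?thesis by (elim bexE) (intro exI conjI)
    qed
    then have "\<forall>i. \<exists>T. i \<ge> j \<longrightarrow> T \<in> trig_poly (2 * Q * (2 ^ i - 1)) \<and> nq (\<lambda>x. f x - T x) \<le> C0 * A * (1 / 2 ^ i) powr \<beta>"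
      by simp
    from choice[OF this] obtain V where V': "\<forall>i. i \<ge> j \<longrightarrow> V i \<in> trig_poly (2 * Q * (2 ^ i - 1)) \<and> nq (\<lambda>x. f x - V i x) \<le> C0 * A * (1 / 2 ^ i) powr \<beta>" ..
    have V: "V i \<in> trig_poly (2 * Q * (2 ^ i - 1))" and nqV: "nq (\<lambda>x. f x - V i x) \<le> C0 * A * (1 / 2 ^ i) powr \<beta>" if "i \<ge> j" for i
      using V' that by simp_all
    have VX: "V i \<in> X" if "i \<ge> j" for i using X_trig_poly[OF V[OF that]] .
    have main: "nq (fdiff r h (\<lambda>x. f x - V j x)) \<le> C1 * A * h powr \<beta>" if h: "h > 0" for h
    proof (cases "h \<ge> 1 / 2 ^ j")
      case True
      have "nq (fdiff r h (\<lambda>x. f x - V j x)) \<le> 2 ^ r * nq (\<lambda>x. f x - V j x)"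
        using f VX[of j] by (intro nq_fdiff_le) auto
      also have "\<dots> \<le> 2 ^ r * (C0 * A * (1 / 2 ^ j) powr \<beta>)" by (intro mult_left_mono nqV) auto
      also have "\<dots> \<le> 2 ^ r * (C0 * A * h powr \<beta>)"
        using True \<beta> C0 A by (intro mult_left_mono powr_mono2) auto
      also have "\<dots> = (2 ^ r * C0) * A * h powr \<beta>" by simp
      also have "\<dots> \<le> C1 * A * h powr \<beta>" using C1r A by (intro mult_right_mono) auto
      finally show ?thesis .
    next
      case False
      \<comment> \<open>The first level whose scale is at most \<open>h\<close>; minimality gives
        \<open>2 ^ I \<le> 2 / h\<close>, so both parts of the estimate have the size
        \<open>h powr \<beta>\<close>.\<close>
      define I where "I = (LEAST i. 1 / 2 ^ i \<le> h)"
      have "\<exists>i. 1 / 2 ^ i \<le> h"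
        using real_arch_pow_inv[OF h, of "1/2"] by (auto simp: power_one_over intro: less_imp_le)
      then have I1: "1 / 2 ^ I \<le> h" unfolding I_def by (rule LeastI_ex)
      have I0: "I > j"
      proof (rule ccontr)
        assume "\<not> I > j"
        then have "1 / 2 ^ j \<le> 1 / (2 ^ I :: real)" by (intro divide_left_mono power_increasing) auto
        with I1 False show False by linarith
      qed
      then have "\<not> 1 / 2 ^ (I - 1) \<le> h" unfolding I_def using not_less_Least[of "I - 1"] I_def by (metis diff_less less_nat_zero_code neq0_conv zero_less_one)
      moreover have "(2::real) ^ I = 2 * 2 ^ (I - 1)" using I0 by (cases I) auto
      ultimately have I2: "2 ^ I \<le> 2 / h" using h by (simp add: field_simps)
      define D where "D i x = V (Suc i) x - V i x" for i x
      have DT: "D i \<in> trig_poly (2 * Q * 2 ^ Suc i)" if "i \<ge> j" for i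
        unfolding D_def[abs_def]
      proof (rule trig_poly_diff)
        show "V (Suc i) \<in> trig_poly (2 * Q * 2 ^ Suc i)"
          using that by (intro trig_poly_mono[OF V]) auto
        have "(2::nat) ^ i - 1 \<le> 2 ^ Suc i" by (simp add: le_diff_conv)
        then have "2 * Q * (2 ^ i - 1) \<le> 2 * Q * 2 ^ Suc i" by (rule mult_le_mono2)
        then show "V i \<in> trig_poly (2 * Q * 2 ^ Suc i)"
          using that by (intro trig_poly_mono[OF V]) auto
      qed
      have DX: "D i \<in> X" if "i \<ge> j" for i using X_trig_poly[OF DT[OF that]] .
      have nqD: "nq (D i) \<le> 2 * C0 * A * (1 / 2 ^ i) powr \<beta>" if "i \<ge> j" for i
      proof -
        have "D i = (\<lambda>x. (f x - V i x) - (f x - V (Suc i) x))" by (simp add: D_def fun_eq_iff)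
        then have "nq (D i) \<le> nq (\<lambda>x. f x - V i x) + nq (\<lambda>x. f x - V (Suc i) x)"
          using nq_diff[OF X_diff[OF f VX[OF that]] X_diff[OF f VX[of "Suc i"]]] that by simp
        also have "\<dots> \<le> C0 * A * (1 / 2 ^ i) powr \<beta> + C0 * A * (1 / 2 ^ Suc i) powr \<beta>"
          using that by (intro add_mono nqV) auto
        also have "\<dots> \<le> C0 * A * (1 / 2 ^ i) powr \<beta> + C0 * A * (1 / 2 ^ i) powr \<beta>"
          using C0 A \<beta> by (intro add_mono mult_left_mono powr_mono2) (auto intro!: divide_left_mono)
        finally show ?thesis by linarith
      qed
      have dec: "f x - V j x = (f x - V I x) + (\<Sum>i\<in>{j..<I}. D i x)" for x
        unfolding D_def using sum_Suc_diff'[of j I "\<lambda>i. V i x"] I0 by simp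
      have summand: "nq (fdiff r h (D i)) \<le> (Cb * (4 * real Q) powr (q * real r) * (2 * C0)) * A * h powr (q * real r) * 2 powr (real i * d)" if "i \<ge> j" for i
      proof -
        have "nq (fdiff r h (D i)) \<le> Cb * (real (2 * Q * 2 ^ Suc i) * \<bar>h\<bar>) powr (q * real r) * nq (D i)"
          using Q_ge_1 h by (intro bern DT that) auto
        also have "real (2 * Q * 2 ^ Suc i) * \<bar>h\<bar> = (4 * real Q) * (2 ^ i * h)" using h by simp
        also have "((4 * real Q) * (2 ^ i * h)) powr (q * real r) = (4 * real Q) powr (q * real r) * (2 powr (real i * (q * real r)) * h powr (q * real r))"
          using h by (simp add: powr_mult power2_powr)
        also have "Cb * ((4 * real Q) powr (q * real r) * (2 powr (real i * (q * real r)) * h powr (q * real r))) * nq (D i)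
           \<le> Cb * ((4 * real Q) powr (q * real r) * (2 powr (real i * (q * real r)) * h powr (q * real r))) * (2 * C0 * A * (1 / 2 ^ i) powr \<beta>)"
          using Cb by (intro mult_left_mono nqD that) auto
        also have "\<dots> = (Cb * (4 * real Q) powr (q * real r) * (2 * C0)) * A * h powr (q * real r) * (2 powr (real i * (q * real r)) * 2 powr (- (real i * \<beta>)))"
          by (simp add: inverse_power2_powr)
        also have "2 powr (real i * (q * real r)) * 2 powr (- (real i * \<beta>)) = 2 powr (real i * d)"
          by (simp add: powr_add[symmetric] d_def algebra_simps)
        finally show ?thesis .
      qed
      have "nq (fdiff r h (\<lambda>x. f x - V j x)) = nq (\<lambda>x. fdiff r h (\<lambda>x. f x - V I x) x + (\<Sum>i\<in>{j..<I}. fdiff r h (D i) x))"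
        unfolding dec fdiff_add fdiff_sum ..
      also have "\<dots> \<le> nq (fdiff r h (\<lambda>x. f x - V I x)) + nq (\<lambda>x. \<Sum>i\<in>{j..<I}. fdiff r h (D i) x)"
        using f VX[of I] DX I0 by (intro nq_add X_fdiff X_sum X_diff) auto
      also have "nq (\<lambda>x. \<Sum>i\<in>{j..<I}. fdiff r h (D i) x) \<le> (\<Sum>i\<in>{j..<I}. nq (fdiff r h (D i)))"
        using DX by (intro nq_sum X_fdiff) auto
      also have "\<dots> \<le> (\<Sum>i\<in>{j..<I}. (Cb * (4 * real Q) powr (q * real r) * (2 * C0)) * A * h powr (q * real r) * 2 powr (real i * d))"
        using summand by (intro sum_mono) auto
      also have "\<dots> \<le> (\<Sum>i<I. (Cb * (4 * real Q) powr (q * real r) * (2 * C0)) * A * h powr (q * real r) * 2 powr (real i * d))"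
        using Cb C0 A by (intro sum_mono2) auto
      also have "\<dots> = (Cb * (4 * real Q) powr (q * real r) * (2 * C0)) * A * h powr (q * real r) * (\<Sum>i<I. 2 powr (real i * d))"
        by (rule sum_distrib_left[symmetric])
      also have "\<dots> \<le> (Cb * (4 * real Q) powr (q * real r) * (2 * C0)) * A * h powr (q * real r) * ((2 powr d * h powr (- d)) / (2 powr d - 1))"
      proof (intro mult_left_mono order.trans[OF sum_powr_geometric_le[OF d]] divide_right_mono)
        have "2 powr (real I * d) = (2 ^ I) powr d" by (simp add: power2_powr)
        also have "\<dots> \<le> (2 / h) powr d" using I2 d by (intro powr_mono2) auto
        finally show "2 powr (real I * d) \<le> 2 powr d * h powr (- d)" using h by (simp add: powr_divide powr_minus_divide)
      qed (use Cb C0 A x in auto)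
      also have "\<dots> = (Cb * (4 * real Q) powr (q * real r) * (2 * C0)) * (2 powr d / (2 powr d - 1)) * A * (h powr (q * real r) * h powr (- d))"
        by simp
      also have "h powr (q * real r) * h powr (- d) = h powr \<beta>" using h by (simp add: powr_add[symmetric] d_def)
      finally have "nq (fdiff r h (\<lambda>x. f x - V j x)) \<le> nq (fdiff r h (\<lambda>x. f x - V I x)) +
          (Cb * (4 * real Q) powr (q * real r) * (2 * C0)) * (2 powr d / (2 powr d - 1)) * A * h powr \<beta>" by simp
      moreover have "nq (fdiff r h (\<lambda>x. f x - V I x)) \<le> 2 ^ r * C0 * A * h powr \<beta>"
      proof -
        have "nq (fdiff r h (\<lambda>x. f x - V I x)) \<le> 2 ^ r * nq (\<lambda>x. f x - V I x)"
          using f VX[of I] I0 by (intro nq_fdiff_le) auto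
        also have "\<dots> \<le> 2 ^ r * (C0 * A * (1 / 2 ^ I) powr \<beta>)" using I0 by (intro mult_left_mono nqV) auto
        also have "\<dots> \<le> 2 ^ r * (C0 * A * h powr \<beta>)"
          using I1 \<beta> C0 A by (intro mult_left_mono powr_mono2) auto
        finally show ?thesis by simp
      qed
      ultimately show ?thesis by (simp add: C1_def distrib_right)
    qed
    show "\<exists>T\<in>trig_poly (2 * Q * (2 ^ j - 1)). nq (\<lambda>x. f x - T x) \<le> C * A * (1 / 2 ^ j) powr \<beta> \<and>
       (\<forall>h>0. nq (fdiff r h (\<lambda>x. f x - T x)) \<le> C * A * h powr \<beta>)"
    proof (intro bexI[of _ "V j"] conjI allI impI)
      have "nq (\<lambda>x. f x - V j x) \<le> C0 * A * (1 / 2 ^ j) powr \<beta>" by (rule nqV) simp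
      also have "\<dots> \<le> C * A * (1 / 2 ^ j) powr \<beta>" using C A by (intro mult_right_mono) auto
      finally show "nq (\<lambda>x. f x - V j x) \<le> C * A * (1 / 2 ^ j) powr \<beta>" .
      fix h :: real assume "h > 0"
      then have "nq (fdiff r h (\<lambda>x. f x - V j x)) \<le> C1 * A * h powr \<beta>" by (rule main)
      also have "\<dots> \<le> C * A * h powr \<beta>" using C A by (intro mult_right_mono) auto
      finally show "nq (fdiff r h (\<lambda>x. f x - V j x)) \<le> C * A * h powr \<beta>" .
    qed (rule V, simp)
  qed
qed

lemma jackson_hoelder:
  assumes k: "k \<ge> 1" and \<beta>: "0 < \<beta>" "\<beta> < q * real r"
  shows "\<exists>C>0. \<forall>n\<ge>1. \<forall>A>0. \<forall>f\<in>X. hol k \<beta> A (1 / real n) f \<longrightarrow>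
    (\<exists>T\<in>trig_poly n. nq (\<lambda>x. f x - T x) \<le> C * A \<and> (\<forall>h>0. nq (fdiff r h (\<lambda>x. f x - T x)) \<le> C * A * h powr \<beta>))"
proof -
  obtain C where C: "C > 0" and sa: "\<forall>j A. \<forall>f\<in>X. 0 < A \<longrightarrow> hol k \<beta> A (1 / 2 ^ j) f \<longrightarrow>
    (\<exists>T\<in>trig_poly (2 * Q * (2 ^ j - 1)). nq (\<lambda>x. f x - T x) \<le> C * A * (1 / 2 ^ j) powr \<beta> \<and>
       (\<forall>h>0. nq (fdiff r h (\<lambda>x. f x - T x)) \<le> C * A * h powr \<beta>))"
    using smooth_approx[OF k \<beta>] by (elim exE conjE)
  define C1 where "C1 = real k * real (4 * Q) powr (q * (real k - 1) + 1 - \<beta>)"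
  have C1: "C1 > 0" using k Q_ge_1 by (simp add: C1_def)
  show ?thesis
  proof (intro exI[of _ "C * C1"] conjI allI ballI impI)
    show "0 < C * C1" using C C1 by simp
    fix n :: nat and A :: real and f assume n: "n \<ge> 1" and A: "A > 0" and f: "f \<in> X"
      and hol: "hol k \<beta> A (1 / real n) f"
    \<comment> \<open>The largest level whose degree \<open>2 * Q * (2 ^ j - 1)\<close> is at most
      \<open>n\<close>. Its scale is below \<open>4 * Q / n\<close>, which \<open>hol_growth\<close>
      bridges at the cost of \<open>C1\<close>.\<close>
    define j where "j = (LEAST j. n < 2 * Q * (2 ^ Suc j - 1))"
    have "n < 2 * Q * (2 ^ Suc n - 1)"
    proof -
      have "n < 2 ^ Suc n - (1::nat)" by (simp add: less_diff_conv) (use less_exp[of n] in linarith)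
      also have "\<dots> \<le> 2 * Q * (2 ^ Suc n - 1)" using Q_ge_1 by simp
      finally show ?thesis .
    qed
    then have j1: "n < 2 * Q * (2 ^ Suc j - 1)" unfolding j_def by (rule LeastI)
    have j2: "2 * Q * (2 ^ j - 1) \<le> n"
    proof (cases j)
      case (Suc i)
      then have "\<not> n < 2 * Q * (2 ^ Suc i - 1)" using not_less_Least[of i "\<lambda>j. n < 2 * Q * (2 ^ Suc j - 1)"] unfolding j_def by simp
      then show ?thesis using Suc by simp
    qed simp
    have "n < 2 * Q * 2 ^ Suc j" using j1 by (rule less_le_trans) (intro mult_left_mono, auto)
    then have "real n < real (2 * Q * 2 ^ Suc j)" by (simp only: of_nat_less_iff)
    then have le: "1 / 2 ^ j \<le> real (4 * Q) * (1 / real n)" using n by (simp add: field_simps)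
    have "hol k \<beta> (C1 * A) (real (4 * Q) * (1 / real n)) f"
      unfolding C1_def using Q_ge_1 by (intro hol_growth f k hol) auto
    then have "hol k \<beta> (C1 * A) (1 / 2 ^ j) f" using le by (rule hol_mono[OF _ order.refl])
    from sa[rule_format, OF f mult_pos_pos[OF C1 A] this]
    obtain T where T: "T \<in> trig_poly (2 * Q * (2 ^ j - 1))"
      and 1: "nq (\<lambda>x. f x - T x) \<le> C * (C1 * A) * (1 / 2 ^ j) powr \<beta>"
      and 2: "\<forall>h>0. nq (fdiff r h (\<lambda>x. f x - T x)) \<le> C * (C1 * A) * h powr \<beta>"
      by (elim bexE conjE)
    have "(1 / 2 ^ j) powr \<beta> \<le> 1 powr \<beta>" using \<beta> by (intro powr_mono2) auto
    then have "C * (C1 * A) * (1 / 2 ^ j) powr \<beta> \<le> C * (C1 * A) * 1" using C C1 A by (intro mult_left_mono) auto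
    with 1 2 show "\<exists>T\<in>trig_poly n. nq (\<lambda>x. f x - T x) \<le> C * C1 * A \<and> (\<forall>h>0. nq (fdiff r h (\<lambda>x. f x - T x)) \<le> C * C1 * A * h powr \<beta>)"
      by (intro bexI[of _ T] trig_poly_mono[OF T j2]) (auto simp: mult.assoc)
  qed
qed

text \<open>For \<open>n = \<lceil>1 / h\<rceil>\<close> one has
  \<open>1 / n \<le> h \<le> 2 / n\<close>; the hypothesis is used at \<open>1 / n\<close>, and
  \<open>hol_growth\<close> covers the factor 2.\<close>

lemma theta_comparison_real_steps:
  assumes f: "f \<in> X" and s: "s \<ge> 1" and \<beta>: "\<beta> > 0"
    and cmp: "\<And>n A. n \<ge> 1 \<Longrightarrow> 0 < A \<Longrightarrow> hol k \<beta> A (1 / real n) f \<Longrightarrow> hol s \<beta> (L * A) (1 / real n) f"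
  shows "\<exists>M. \<forall>h A. 0 < h \<longrightarrow> h \<le> 1 \<longrightarrow> 0 < A \<longrightarrow> hol k \<beta> A h f \<longrightarrow> hol s \<beta> (M * A) h f"
proof (intro exI allI impI)
  fix h A :: real assume h: "0 < h" "h \<le> 1" and A: "0 < A" and hol: "hol k \<beta> A h f"
  define n where "n = nat \<lceil>1 / h\<rceil>"
  have n1: "1 / h \<le> real n" unfolding n_def by (rule real_nat_ceiling_ge)
  have "0 < 1 / h" using h by simp
  with n1 have n: "n \<ge> 1" by (cases n) auto
  have "real n = of_int \<lceil>1 / h\<rceil>" using \<open>0 < 1 / h\<close> by (simp add: n_def)
  then have "real n < 1 / h + 1" using ceiling_correct[of "1 / h"] by linarith
  then have "real n * h < 1 + h" using h by (simp add: field_simps)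
  then have le2: "h \<le> real 2 * (1 / real n)" using h n by (simp add: field_simps)
  have "1 / real n \<le> h" using n1 h n by (simp add: field_simps)
  then have "hol k \<beta> A (1 / real n) f" by (rule hol_mono[OF hol order.refl])
  then have "hol s \<beta> (L * A) (1 / real n) f" by (rule cmp[OF n A])
  from hol_growth[OF f s _ this, of 2]
  have "hol s \<beta> (real s * real 2 powr (q * (real s - 1) + 1 - \<beta>) * (L * A)) (real 2 * (1 / real n)) f" by simp
  then have "hol s \<beta> (real s * real 2 powr (q * (real s - 1) + 1 - \<beta>) * (L * A)) h f"
    using le2 by (rule hol_mono[OF _ order.refl])
  then show "hol s \<beta> (real s * real 2 powr (q * (real s - 1) + 1 - \<beta>) * L * A) h f" by (simp add: mult.assoc)
qed

text \<open>Comparing \<open>f\<close> with its polynomial approximants at the scales \<open>2 ^ (-i)\<close>, \<open>i \<le> J\<close>, bounds the \<open>k\<close>-th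
  moduli below the scale \<open>2 ^ (-J - I)\<close> by the approximation error plus a multiple
  \<open>2 ^ (-I (q k - \<beta>))\<close> of the modulus at \<open>2 ^ (-J)\<close>. The hypothesis \<open>cmp\<close> makes the modulus at \<open>2 ^ (-J)\<close>
  at most \<open>2 ^ (I (q (s - 1) + 1 - \<beta>))\<close> times that at \<open>2 ^ (-J - I)\<close>, so it can be absorbed for large \<open>I\<close>.\<close>

lemma theta_le_approx:
  assumes f: "f \<in> X" and rks: "r \<ge> 1" "k \<ge> 1" "s \<ge> 1"
    and \<beta>: "0 < \<beta>" "\<beta> < q * real r" "\<beta> \<le> q * real s"
    and ks: "q * (real s - 1) + 1 < q * real k"
    and M: "0 < M"
    and hol_r: "0 < A0" "\<And>\<delta>. hol r \<beta> A0 \<delta> f"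
    and cmp: "\<And>h A. 0 < h \<Longrightarrow> h \<le> 1 \<Longrightarrow> 0 < A \<Longrightarrow> hol k \<beta> A h f \<Longrightarrow> hol s \<beta> (M * A) h f"
  shows "\<exists>L>0. \<forall>n\<ge>1. \<forall>T\<in>trig_poly n. \<forall>E>0.
    (\<forall>h>0. nq (fdiff r h (\<lambda>x. f x - T x)) \<le> E * h powr \<beta>) \<longrightarrow> hol s \<beta> (L * E) (1 / real n) f"
proof -
  \<comment> \<open>The growth exponent of \<open>hol_growth\<close> for the order \<open>s\<close>;
    \<open>ks\<close> puts it below the Bernstein exponent \<open>q * k\<close>.\<close>
  define \<gamma> where "\<gamma> = q * (real s - 1) + 1"
  have \<gamma>: "\<beta> \<le> \<gamma>" "\<gamma> < q * real k" using \<beta> ks q_le_1 by (auto simp: \<gamma>_def algebra_simps)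
  then have \<beta>k: "\<beta> < q * real k" by simp
  have "q * real s < q * real k" using ks q_le_1 by (simp add: algebra_simps)
  then have sk: "s \<le> k" using q_pos by simp
  \<comment> \<open>Here \<open>smooth_approx\<close> leads from order \<open>r\<close> to order
    \<open>k\<close>, since the error \<open>f - T\<close> is known to be small in the seminorm of
    order \<open>r\<close>.\<close>
  obtain C where C: "C > 0" and sa: "\<forall>j A. \<forall>f\<in>X. 0 < A \<longrightarrow> hol r \<beta> A (1 / 2 ^ j) f \<longrightarrow>
    (\<exists>T\<in>trig_poly (2 * Q * (2 ^ j - 1)). nq (\<lambda>x. f x - T x) \<le> C * A * (1 / 2 ^ j) powr \<beta> \<and>
       (\<forall>h>0. nq (fdiff k h (\<lambda>x. f x - T x)) \<le> C * A * h powr \<beta>))"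
    using smooth_approx[OF rks(1) \<beta>(1) \<beta>k] by (elim exE conjE)
  obtain C0 where C0: "C0 > 0" and wj: "\<forall>j A. \<forall>f\<in>X. 0 < A \<longrightarrow> hol k \<beta> A (1 / 2 ^ j) f \<longrightarrow>
    (\<exists>T\<in>trig_poly (2 * Q * (2 ^ j - 1)). nq (\<lambda>x. f x - T x) \<le> C0 * A * (1 / 2 ^ j) powr \<beta>)"
    using weak_jackson[OF rks(2) \<beta>(1), folded hol_def] by (elim exE conjE)
  obtain Cb where Cb: "Cb \<ge> 0" and bern: "\<And>n T h. n \<ge> 1 \<Longrightarrow> T \<in> trig_poly n \<Longrightarrow> h \<noteq> 0 \<Longrightarrow>
      nq (fdiff k h T) \<le> Cb * (real n * \<bar>h\<bar>) powr (q * real k) * nq T"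
    using bernstein[of k] by blast
  \<comment> \<open>\<open>\<Theta> j\<close> is \<theta> of order \<open>k\<close> at the scale
    \<open>2 ^ (-j)\<close>, measured by \<open>nq\<close>, as a real supremum. Boundedness of
    \<open>S j\<close> comes from \<open>B\<close> below.\<close>
  define S where "S j = {nq (fdiff k t f) / t powr \<beta> | t. 0 < t \<and> t < 1 / 2 ^ j}" for j :: nat
  define \<Theta> where "\<Theta> j = Sup (S j)" for j
  \<comment> \<open>The k-th moduli are finite even for \<open>k < r\<close>: at level 0 the
    approximant is a constant, which differences of order \<open>k\<close> annihilate.\<close>
  obtain B where B: "\<And>t. t > 0 \<Longrightarrow> nq (fdiff k t f) \<le> B * t powr \<beta>"
  proof -
    from sa[rule_format, OF f hol_r(1), of 0] hol_r(2)
    obtain T where T: "T \<in> trig_poly 0" and *: "\<And>h. h > 0 \<Longrightarrow> nq (fdiff k h (\<lambda>x. f x - T x)) \<le> C * A0 * h powr \<beta>"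
      by auto
    obtain c where c: "T = (\<lambda>x. c)" using trig_poly_0_const[OF T] .
    have "fdiff k h (\<lambda>x. f x - T x) = fdiff k h f" for h
      unfolding fdiff_diff c fdiff_const[OF rks(2)] by simp
    with * show ?thesis by (intro that[of "C * A0"]) simp
  qed
  have S_ne: "S j \<noteq> {}" for j
  proof -
    have "0 < (1::real) / 2 ^ j" by simp
    then obtain t :: real where "0 < t" "t < 1 / 2 ^ j" using dense by blast
    then show ?thesis unfolding S_def by blast
  qed
  have S_bdd: "bdd_above (S j)" for j
    by (rule bdd_aboveI[of _ B]) (use B in \<open>auto simp: S_def divide_le_eq\<close>)
  have hol_\<Theta>: "hol k \<beta> (\<Theta> j) (1 / 2 ^ j) f" for j
    unfolding hol_def
  proof (intro allI impI)
    fix t :: real assume t: "0 < t \<and> t < 1 / 2 ^ j"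
    have "nq (fdiff k t f) / t powr \<beta> \<le> \<Theta> j" unfolding \<Theta>_def
      by (rule cSup_upper[OF _ S_bdd]) (use t in \<open>auto simp: S_def\<close>)
    then show "nq (fdiff k t f) \<le> \<Theta> j * t powr \<beta>" using t by (simp add: divide_le_eq)
  qed
  have \<Theta>_le: "\<Theta> j \<le> A" if "hol k \<beta> A (1 / 2 ^ j) f" for j A
    unfolding \<Theta>_def by (rule cSup_least[OF S_ne]) (use that in \<open>auto simp: S_def hol_def divide_le_eq\<close>)
  have \<Theta>_nonneg: "0 \<le> \<Theta> j" for j
  proof -
    obtain x where x: "x \<in> S j" using S_ne by blast
    then have "0 \<le> x" by (auto simp: S_def)
    also have "x \<le> \<Theta> j" unfolding \<Theta>_def by (rule cSup_upper[OF x S_bdd])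
    finally show ?thesis .
  qed
  have \<Theta>_mono: "\<Theta> j \<le> \<Theta> i" if "i \<le> j" for i j
    by (rule \<Theta>_le, rule hol_mono[OF hol_\<Theta>]) (use that in \<open>auto intro!: divide_left_mono power_increasing\<close>)
  define D where "D = 2 ^ k * real s * M + 1"
  have D: "D \<ge> 1" using M by (simp add: D_def)
  \<comment> \<open>\<open>cmp\<close> is applied at the fine scale to pass to order
    \<open>s\<close>, where enlarging the step has the exponent \<gamma>;
    \<open>hol_mono_order\<close> then returns to order \<open>k\<close>.\<close>
  have grow: "\<Theta> i \<le> D * 2 powr (real (j - i) * (\<gamma> - \<beta>)) * A"
    if "i \<le> j" "0 < A" "hol k \<beta> A (1 / 2 ^ j) f" for i j A
  proof (rule \<Theta>_le)
    have "hol s \<beta> (M * A) (1 / 2 ^ j) f" by (rule cmp) (use that in auto)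
    from hol_growth[OF f rks(3) _ this, of "2 ^ (j - i)"]
    have "hol s \<beta> (real s * 2 powr (real (j - i) * (\<gamma> - \<beta>)) * (M * A)) (real (2 ^ (j - i)) * (1 / 2 ^ j)) f"
      by (simp add: \<gamma>_def power2_powr)
    moreover have "real (2 ^ (j - i)) * (1 / 2 ^ j) = 1 / 2 ^ i"
      using that(1) unfolding of_nat_power of_nat_numeral by (simp add: power_diff)
    ultimately have "hol s \<beta> (real s * 2 powr (real (j - i) * (\<gamma> - \<beta>)) * (M * A)) (1 / 2 ^ i) f" by simp
    from hol_mono_order[OF f sk this]
    show "hol k \<beta> (D * 2 powr (real (j - i) * (\<gamma> - \<beta>)) * A) (1 / 2 ^ i) f"
    proof (rule hol_mono[OF _ _ order.refl])
      have "2 ^ (k - s) * (real s * 2 powr (real (j - i) * (\<gamma> - \<beta>)) * (M * A))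
         \<le> 2 ^ k * (real s * 2 powr (real (j - i) * (\<gamma> - \<beta>)) * (M * A))"
        using M that(2) by (intro mult_right_mono power_increasing) auto
      also have "\<dots> = (2 ^ k * real s * M) * 2 powr (real (j - i) * (\<gamma> - \<beta>)) * A" by simp
      also have "\<dots> \<le> D * 2 powr (real (j - i) * (\<gamma> - \<beta>)) * A"
        using that(2) by (intro mult_right_mono) (auto simp: D_def)
      finally show "2 ^ (k - s) * (real s * 2 powr (real (j - i) * (\<gamma> - \<beta>)) * (M * A))
        \<le> D * 2 powr (real (j - i) * (\<gamma> - \<beta>)) * A" .
    qed
  qed
  define \<eta> where "\<eta> = q * real k - \<gamma>"
  have \<eta>: "\<eta> > 0" using \<gamma> by (simp add: \<eta>_def)
  have x: "2 powr \<eta> > (1::real)" using \<eta> powr_less_mono[of 0 \<eta> "2::real"] by simp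
  define K1 where "K1 = Cb * (2 * real Q) powr (q * real k) * (C + C0)"
  define K2 where "K2 = Cb * (4 * real Q) powr (q * real k) * (2 * C0 * (D + 1)) / (2 powr \<eta> - 1)"
  define K where "K = K1 + K2"
  have K12: "0 \<le> K1" "0 \<le> K2" using Cb C C0 D x by (auto simp: K1_def K2_def)
  \<comment> \<open>\<open>f\<close> is decomposed into an error part \<open>g - U'\<close>, a
    polynomial \<open>W\<close> of degree comparable to \<open>2 ^ J\<close>, the dyadic differences
    \<open>Dv i\<close> for \<open>i < J\<close>, and a constant. For steps below
    \<open>2 ^ (-J - I)\<close> Bernstein's inequality makes the polynomial parts small.\<close>
  have core: "\<Theta> (J + I) \<le> C * E + K * 2 powr (- (real I * (q * real k - \<beta>))) * (\<Theta> J + E)"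
    if T: "T \<in> trig_poly (2 ^ J)" and E: "E > 0" and err: "\<forall>h>0. nq (fdiff r h (\<lambda>x. f x - T x)) \<le> E * h powr \<beta>"
    for J I T E
  proof (rule \<Theta>_le)
    define g where "g x = f x - T x" for x
    have gX: "g \<in> X" unfolding g_def[abs_def] using f X_trig_poly[OF T] by auto
    \<comment> \<open>\<open>T\<close> is close to \<open>f\<close> only in the seminorm of order
      \<open>r\<close>. The correction \<open>U'\<close> gives a remainder that is also small in
      norm, as the estimate of \<open>W\<close> requires, and bounded in order
      \<open>k\<close>.\<close>
    have "hol r \<beta> E (1 / 2 ^ J) g" using err by (simp add: hol_def g_def[abs_def])
    from sa[rule_format, OF gX E this] obtain U' where U': "U' \<in> trig_poly (2 * Q * (2 ^ J - 1))"
      and U'1: "nq (\<lambda>x. g x - U' x) \<le> C * E * (1 / 2 ^ J) powr \<beta>"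
      and U'2: "\<forall>h>0. nq (fdiff k h (\<lambda>x. g x - U' x)) \<le> C * E * h powr \<beta>" by (elim bexE conjE)
    have "\<exists>T. T \<in> trig_poly (2 * Q * (2 ^ i - 1)) \<and> nq (\<lambda>x. f x - T x) \<le> C0 * (\<Theta> i + E) * (1 / 2 ^ i) powr \<beta>" for i
    proof -
      \<comment> \<open>Adding \<open>E\<close> keeps the bound positive, since
        \<open>\<Theta> i\<close> may vanish.\<close>
      have "0 < \<Theta> i + E" using \<Theta>_nonneg[of i] E by simp
      moreover have "hol k \<beta> (\<Theta> i + E) (1 / 2 ^ i) f" by (rule hol_mono[OF hol_\<Theta>]) (use E in auto)
      ultimately show ?thesis by (rule bexE[OF wj[rule_format, OF f]]) (intro exI conjI)
    qed
    then have "\<forall>i. \<exists>T. T \<in> trig_poly (2 * Q * (2 ^ i - 1)) \<and> nq (\<lambda>x. f x - T x) \<le> C0 * (\<Theta> i + E) * (1 / 2 ^ i) powr \<beta>" ..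
    from choice[OF this] obtain V where V': "\<forall>i. V i \<in> trig_poly (2 * Q * (2 ^ i - 1)) \<and> nq (\<lambda>x. f x - V i x) \<le> C0 * (\<Theta> i + E) * (1 / 2 ^ i) powr \<beta>" ..
    have V: "V i \<in> trig_poly (2 * Q * (2 ^ i - 1))" and nqV: "nq (\<lambda>x. f x - V i x) \<le> C0 * (\<Theta> i + E) * (1 / 2 ^ i) powr \<beta>" for i
      using V' by simp_all
    have VX: "V i \<in> X" for i by (rule X_trig_poly[OF V])
    define U where "U x = T x + U' x" for x
    define W where "W x = U x - V J x" for x
    have W: "W \<in> trig_poly (2 * Q * 2 ^ J)"
      unfolding W_def[abs_def] U_def
    proof (intro trig_poly_diff trig_poly_add)
      have "(2::nat) ^ J * 1 \<le> 2 ^ J * (2 * Q)" using Q_ge_1 by (intro mult_le_mono2) auto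
      then show "T \<in> trig_poly (2 * Q * 2 ^ J)" by (intro trig_poly_mono[OF T]) (simp add: mult.commute)
      show "U' \<in> trig_poly (2 * Q * 2 ^ J)" by (rule trig_poly_mono[OF U']) simp
      show "V J \<in> trig_poly (2 * Q * 2 ^ J)" by (rule trig_poly_mono[OF V]) simp
    qed
    have UX: "U \<in> X" "U' \<in> X" unfolding U_def[abs_def] using X_trig_poly[OF T] X_trig_poly[OF U'] by auto
    have nqW: "nq W \<le> (C + C0) * (\<Theta> J + E) * (1 / 2 ^ J) powr \<beta>"
    proof -
      have "W = (\<lambda>x. (f x - V J x) - (g x - U' x))" by (simp add: W_def U_def g_def fun_eq_iff)
      then have "nq W \<le> nq (\<lambda>x. f x - V J x) + nq (\<lambda>x. g x - U' x)"
        using nq_diff[OF X_diff[OF f VX[of J]] X_diff[OF gX UX(2)]] by simp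
      also have "\<dots> \<le> C0 * (\<Theta> J + E) * (1 / 2 ^ J) powr \<beta> + C * E * (1 / 2 ^ J) powr \<beta>"
        by (intro add_mono nqV U'1)
      also have "\<dots> \<le> C0 * (\<Theta> J + E) * (1 / 2 ^ J) powr \<beta> + C * (\<Theta> J + E) * (1 / 2 ^ J) powr \<beta>"
        using C \<Theta>_nonneg[of J] by (intro add_left_mono mult_right_mono mult_left_mono) auto
      finally show ?thesis by (simp add: algebra_simps)
    qed
    define Dv where "Dv i x = V (Suc i) x - V i x" for i x
    have DT: "Dv i \<in> trig_poly (2 * Q * 2 ^ Suc i)" for i
      unfolding Dv_def[abs_def]
    proof (rule trig_poly_diff)
      show "V (Suc i) \<in> trig_poly (2 * Q * 2 ^ Suc i)" by (intro trig_poly_mono[OF V]) auto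
      have "(2::nat) ^ i - 1 \<le> 2 ^ Suc i" by (simp add: le_diff_conv)
      then have "2 * Q * (2 ^ i - 1) \<le> 2 * Q * 2 ^ Suc i" by (rule mult_le_mono2)
      then show "V i \<in> trig_poly (2 * Q * 2 ^ Suc i)" by (intro trig_poly_mono[OF V]) auto
    qed
    have DX: "Dv i \<in> X" for i by (rule X_trig_poly[OF DT])
    \<comment> \<open>In the Bernstein estimate of \<open>Dv i\<close> this growth leaves the
      exponent \<eta> per level; as \<eta> is positive, the sum over \<open>i < J\<close> is
      governed by its upper end.\<close>
    have grow': "\<Theta> i + E \<le> (D + 1) * 2 powr (real (J - i) * (\<gamma> - \<beta>)) * (\<Theta> J + E)" if "i \<le> J" for i
    proof -
      have pos: "0 < \<Theta> J + E" using \<Theta>_nonneg[of J] E by simp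
      have "\<Theta> i \<le> D * 2 powr (real (J - i) * (\<gamma> - \<beta>)) * (\<Theta> J + E)"
        by (rule grow[OF that pos hol_mono[OF hol_\<Theta>]]) (use E in auto)
      moreover have "E \<le> 2 powr (real (J - i) * (\<gamma> - \<beta>)) * (\<Theta> J + E)"
      proof -
        have "1 \<le> 2 powr (real (J - i) * (\<gamma> - \<beta>))" using \<gamma> by (intro ge_one_powr_ge_zero) auto
        then have "1 * (\<Theta> J + E) \<le> 2 powr (real (J - i) * (\<gamma> - \<beta>)) * (\<Theta> J + E)"
          using pos by (intro mult_right_mono) auto
        then show ?thesis using \<Theta>_nonneg[of J] by simp
      qed
      ultimately show ?thesis by (simp add: distrib_right)
    qed
    have nqD: "nq (Dv i) \<le> 2 * C0 * (\<Theta> i + E) * (1 / 2 ^ i) powr \<beta>" for i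
    proof -
      have "Dv i = (\<lambda>x. (f x - V i x) - (f x - V (Suc i) x))" by (simp add: Dv_def fun_eq_iff)
      then have "nq (Dv i) \<le> nq (\<lambda>x. f x - V i x) + nq (\<lambda>x. f x - V (Suc i) x)"
        using nq_diff[OF X_diff[OF f VX[of i]] X_diff[OF f VX[of "Suc i"]]] by simp
      also have "\<dots> \<le> C0 * (\<Theta> i + E) * (1 / 2 ^ i) powr \<beta> + C0 * (\<Theta> (Suc i) + E) * (1 / 2 ^ Suc i) powr \<beta>"
        by (intro add_mono nqV)
      also have "\<dots> \<le> C0 * (\<Theta> i + E) * (1 / 2 ^ i) powr \<beta> + C0 * (\<Theta> i + E) * (1 / 2 ^ i) powr \<beta>"
        using C0 E \<beta> \<Theta>_nonneg \<Theta>_mono[of i "Suc i"]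
        by (intro add_mono mult_mono powr_mono2) (auto intro!: divide_left_mono add_nonneg_nonneg)
      finally show ?thesis by simp
    qed
    have dec: "f x = (g x - U' x) + W x + (\<Sum>i<J. Dv i x) + V 0 x" for x
      using sum_lessThan_telescope[of "\<lambda>i. V i x" J] by (simp add: g_def W_def U_def Dv_def)
    obtain c where c: "V 0 = (\<lambda>x. c)" using trig_poly_0_const[of "V 0"] V[of 0] by auto
    show "hol k \<beta> (C * E + K * 2 powr (- (real I * (q * real k - \<beta>))) * (\<Theta> J + E)) (1 / 2 ^ (J + I)) f"
      unfolding hol_def
    proof (intro allI impI)
      fix h :: real assume "0 < h \<and> h < 1 / 2 ^ (J + I)"
      then have h: "0 < h" "h < 1 / 2 ^ (J + I)" by auto
      have scale: "h powr (q * real k) * 2 powr (real J * (q * real k - \<beta>)) \<le> 2 powr (- (real I * (q * real k - \<beta>))) * h powr \<beta>"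
      proof -
        have "2 ^ J * h \<le> 1 / 2 ^ I" using h by (simp add: power_add field_simps)
        then have "(2 ^ J * h) powr (q * real k - \<beta>) \<le> (1 / 2 ^ I) powr (q * real k - \<beta>)"
          using \<beta>k h by (intro powr_mono2) auto
        then have "2 powr (real J * (q * real k - \<beta>)) * h powr (q * real k - \<beta>) \<le> 2 powr (- (real I * (q * real k - \<beta>)))"
          using h by (simp add: powr_mult power2_powr inverse_power2_powr)
        then have "2 powr (real J * (q * real k - \<beta>)) * h powr (q * real k - \<beta>) * h powr \<beta> \<le> 2 powr (- (real I * (q * real k - \<beta>))) * h powr \<beta>"
          by (intro mult_right_mono) auto
        moreover have "h powr (q * real k) = h powr (q * real k - \<beta>) * h powr \<beta>" by (simp add: powr_add[symmetric])
        ultimately show ?thesis by (simp only: mult_ac)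
      qed
      have W_le: "nq (fdiff k h W) \<le> K1 * (\<Theta> J + E) * (h powr (q * real k) * 2 powr (real J * (q * real k - \<beta>)))"
      proof -
        have "nq (fdiff k h W) \<le> Cb * (real (2 * Q * 2 ^ J) * \<bar>h\<bar>) powr (q * real k) * nq W"
          using Q_ge_1 h by (intro bern W) auto
        also have "\<dots> \<le> Cb * (real (2 * Q * 2 ^ J) * \<bar>h\<bar>) powr (q * real k) * ((C + C0) * (\<Theta> J + E) * (1 / 2 ^ J) powr \<beta>)"
          using Cb by (intro mult_left_mono nqW) auto
        also have "real (2 * Q * 2 ^ J) * \<bar>h\<bar> = (2 * real Q) * (2 ^ J * h)" using h by simp
        also have "((2 * real Q) * (2 ^ J * h)) powr (q * real k) = (2 * real Q) powr (q * real k) * (2 powr (real J * (q * real k)) * h powr (q * real k))"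
          using h by (simp add: powr_mult power2_powr)
        also have "Cb * ((2 * real Q) powr (q * real k) * (2 powr (real J * (q * real k)) * h powr (q * real k))) * ((C + C0) * (\<Theta> J + E) * (1 / 2 ^ J) powr \<beta>)
          = K1 * (\<Theta> J + E) * (h powr (q * real k) * (2 powr (real J * (q * real k)) * 2 powr (- (real J * \<beta>))))"
          by (simp add: K1_def inverse_power2_powr)
        also have "2 powr (real J * (q * real k)) * 2 powr (- (real J * \<beta>)) = 2 powr (real J * (q * real k - \<beta>))"
          by (simp add: powr_add[symmetric] algebra_simps)
        finally show ?thesis .
      qed
      have summand: "nq (fdiff k h (Dv i)) \<le> Cb * (4 * real Q) powr (q * real k) * (2 * C0 * (D + 1)) * (\<Theta> J + E) *
          (h powr (q * real k) * 2 powr (real J * (\<gamma> - \<beta>))) * 2 powr (real i * \<eta>)" if i: "i < J" for i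
      proof -
        have "nq (fdiff k h (Dv i)) \<le> Cb * (real (2 * Q * 2 ^ Suc i) * \<bar>h\<bar>) powr (q * real k) * nq (Dv i)"
          using Q_ge_1 h by (intro bern DT) auto
        also have "\<dots> \<le> Cb * (real (2 * Q * 2 ^ Suc i) * \<bar>h\<bar>) powr (q * real k) *
            (2 * C0 * ((D + 1) * 2 powr (real (J - i) * (\<gamma> - \<beta>)) * (\<Theta> J + E)) * (1 / 2 ^ i) powr \<beta>)"
          using Cb C0 i by (intro mult_left_mono order.trans[OF nqD] mult_right_mono grow') auto
        also have "real (2 * Q * 2 ^ Suc i) * \<bar>h\<bar> = (4 * real Q) * (2 ^ i * h)" using h by simp
        also have "((4 * real Q) * (2 ^ i * h)) powr (q * real k) = (4 * real Q) powr (q * real k) * (2 powr (real i * (q * real k)) * h powr (q * real k))"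
          using h by (simp add: powr_mult power2_powr)
        also have "Cb * ((4 * real Q) powr (q * real k) * (2 powr (real i * (q * real k)) * h powr (q * real k))) *
            (2 * C0 * ((D + 1) * 2 powr (real (J - i) * (\<gamma> - \<beta>)) * (\<Theta> J + E)) * (1 / 2 ^ i) powr \<beta>)
          = Cb * (4 * real Q) powr (q * real k) * (2 * C0 * (D + 1)) * (\<Theta> J + E) * h powr (q * real k) *
            (2 powr (real i * (q * real k)) * 2 powr (real (J - i) * (\<gamma> - \<beta>)) * 2 powr (- (real i * \<beta>)))"
          by (simp add: inverse_power2_powr)
        also have "2 powr (real i * (q * real k)) * 2 powr (real (J - i) * (\<gamma> - \<beta>)) * 2 powr (- (real i * \<beta>))
          = 2 powr (real J * (\<gamma> - \<beta>)) * 2 powr (real i * \<eta>)"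
          using i by (simp add: powr_add[symmetric] \<eta>_def of_nat_diff algebra_simps)
        finally show ?thesis by (simp add: mult.assoc)
      qed
      have D_le: "nq (\<lambda>x. \<Sum>i<J. fdiff k h (Dv i) x) \<le> K2 * (\<Theta> J + E) * (h powr (q * real k) * 2 powr (real J * (q * real k - \<beta>)))"
      proof -
        have "nq (\<lambda>x. \<Sum>i<J. fdiff k h (Dv i) x) \<le> (\<Sum>i<J. nq (fdiff k h (Dv i)))"
          using DX by (intro nq_sum X_fdiff)
        also have "\<dots> \<le> (\<Sum>i<J. Cb * (4 * real Q) powr (q * real k) * (2 * C0 * (D + 1)) * (\<Theta> J + E) *
          (h powr (q * real k) * 2 powr (real J * (\<gamma> - \<beta>))) * 2 powr (real i * \<eta>))"
          using summand by (intro sum_mono) auto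
        also have "\<dots> = Cb * (4 * real Q) powr (q * real k) * (2 * C0 * (D + 1)) * (\<Theta> J + E) *
          (h powr (q * real k) * 2 powr (real J * (\<gamma> - \<beta>))) * (\<Sum>i<J. 2 powr (real i * \<eta>))"
          by (rule sum_distrib_left[symmetric])
        also have "\<dots> \<le> Cb * (4 * real Q) powr (q * real k) * (2 * C0 * (D + 1)) * (\<Theta> J + E) *
          (h powr (q * real k) * 2 powr (real J * (\<gamma> - \<beta>))) * (2 powr (real J * \<eta>) / (2 powr \<eta> - 1))"
          using Cb C0 D E \<Theta>_nonneg[of J] by (intro mult_left_mono sum_powr_geometric_le \<eta>) auto
        also have "\<dots> = K2 * (\<Theta> J + E) * (h powr (q * real k) * (2 powr (real J * (\<gamma> - \<beta>)) * 2 powr (real J * \<eta>)))"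
          by (simp add: K2_def)
        also have "2 powr (real J * (\<gamma> - \<beta>)) * 2 powr (real J * \<eta>) = 2 powr (real J * (q * real k - \<beta>))"
          by (simp add: powr_add[symmetric] \<eta>_def algebra_simps)
        finally show ?thesis .
      qed
      have "nq (fdiff k h f) = nq (\<lambda>x. fdiff k h (\<lambda>x. g x - U' x) x + fdiff k h W x + (\<Sum>i<J. fdiff k h (Dv i) x))"
      proof -
        have "fdiff k h f = fdiff k h (\<lambda>x. (g x - U' x) + W x + (\<Sum>i<J. Dv i x) + V 0 x)" using dec by presburger
        also have "\<dots> = (\<lambda>x. fdiff k h (\<lambda>x. g x - U' x) x + fdiff k h W x + (\<Sum>i<J. fdiff k h (Dv i) x) + fdiff k h (V 0) x)"
          unfolding fdiff_add fdiff_sum ..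
        also have "fdiff k h (V 0) = (\<lambda>x. 0)" unfolding c by (rule fdiff_const[OF rks(2)])
        finally show ?thesis by simp
      qed
      also have "\<dots> \<le> nq (\<lambda>x. fdiff k h (\<lambda>x. g x - U' x) x + fdiff k h W x) + nq (\<lambda>x. \<Sum>i<J. fdiff k h (Dv i) x)"
        using gX UX X_trig_poly[OF W] DX by (intro nq_add X_fdiff X_sum X_diff X_add)
      also have "nq (\<lambda>x. fdiff k h (\<lambda>x. g x - U' x) x + fdiff k h W x) \<le> nq (fdiff k h (\<lambda>x. g x - U' x)) + nq (fdiff k h W)"
        using gX UX X_trig_poly[OF W] by (intro nq_add X_fdiff X_diff)
      finally have "nq (fdiff k h f) \<le> C * E * h powr \<beta> + (K1 + K2) * (\<Theta> J + E) * (h powr (q * real k) * 2 powr (real J * (q * real k - \<beta>)))"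
        using U'2[rule_format, OF h(1)] W_le D_le by (simp add: distrib_right)
      also have "\<dots> \<le> C * E * h powr \<beta> + (K1 + K2) * (\<Theta> J + E) * (2 powr (- (real I * (q * real k - \<beta>))) * h powr \<beta>)"
        using K12 E \<Theta>_nonneg[of J] by (intro add_left_mono mult_left_mono scale) auto
      also have "\<dots> = (C * E + K * 2 powr (- (real I * (q * real k - \<beta>))) * (\<Theta> J + E)) * h powr \<beta>"
        by (simp add: K_def algebra_simps)
      finally show "nq (fdiff k h f) \<le> \<dots>" .
    qed
  qed
  \<comment> \<open>Chosen so that the contribution of \<open>\<Theta> J\<close> below is at most
    half of \<open>\<Theta> J\<close>; it depends on neither \<open>n\<close> nor
    \<open>T\<close>.\<close>
  obtain I :: nat where I: "2 * (D * K) * 2 powr (- (real I * \<eta>)) \<le> 1"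
  proof -
    obtain I :: nat where "(2 powr \<eta>) ^ I > 2 * (D * K)" using real_arch_pow[OF x] by blast
    moreover have "(2 powr \<eta>) ^ I = 2 powr (real I * \<eta>)" by (simp add: powr_power)
    ultimately have "2 * (D * K) * 2 powr (- (real I * \<eta>)) \<le> 1" by (simp add: powr_minus_divide)
    then show ?thesis by (rule that)
  qed
  define G where "G = D * 2 powr (real I * (\<gamma> - \<beta>))"
  have G: "G > 0" using D by (simp add: G_def)
  \<comment> \<open>The 2 comes from moving half of \<open>\<Theta> J\<close> to the left-hand
    side.\<close>
  define L1 where "L1 = 2 * G * (C + K)"
  have L1: "L1 > 0" using G C K12 by (simp add: L1_def K_def add_pos_nonneg)
  define L where "L = real s * 2 powr (\<gamma> - \<beta>) * (M * L1)"
  show ?thesis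
  proof (intro exI[of _ L] conjI allI impI ballI)
    show "L > 0" using L1 M rks by (simp add: L_def)
    fix n :: nat and T and E :: real assume n: "n \<ge> 1" and T: "T \<in> trig_poly n" and E: "E > 0"
      and err: "\<forall>h>0. nq (fdiff r h (\<lambda>x. f x - T x)) \<le> E * h powr \<beta>"
    \<comment> \<open>The first dyadic degree that admits \<open>T\<close>;
      \<open>2 ^ J < 2 * n\<close>, so going back to \<open>1 / n\<close> costs one
      doubling.\<close>
    define J where "J = (LEAST J. n \<le> 2 ^ J)"
    have "n \<le> 2 ^ n" by (rule less_imp_le[OF less_exp])
    then have J1: "n \<le> 2 ^ J" unfolding J_def by (rule LeastI)
    have J2: "2 ^ J < 2 * n"
    proof (cases J)
      case 0 then show ?thesis using n by simp
    next
      case (Suc i)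
      then have "\<not> n \<le> 2 ^ i" using not_less_Least[of i "\<lambda>J. n \<le> 2 ^ J"] unfolding J_def by simp
      then show ?thesis using Suc by simp
    qed
    define A where "A = C * E + K * 2 powr (- (real I * (q * real k - \<beta>))) * (\<Theta> J + E)"
    have cr: "\<Theta> (J + I) \<le> A" unfolding A_def by (rule core[OF trig_poly_mono[OF T J1] E err])
    have "0 < A" using C E K12 \<Theta>_nonneg[of J] by (simp add: A_def K_def add_pos_nonneg)
    \<comment> \<open>\<open>core\<close> bounds the modulus at the finer level
      \<open>J + I\<close>; \<open>grow\<close> carries the bound back to \<open>J\<close>.\<close>
    then have "\<Theta> J \<le> D * 2 powr (real (J + I - J) * (\<gamma> - \<beta>)) * A"
      by (intro grow hol_mono[OF hol_\<Theta>]) (use cr in auto)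
    then have "\<Theta> J \<le> G * A" by (simp add: G_def)
    also have "G * A = G * C * E + D * K * (2 powr (real I * (\<gamma> - \<beta>)) * 2 powr (- (real I * (q * real k - \<beta>)))) * (\<Theta> J + E)"
      by (simp add: A_def G_def algebra_simps)
    also have "2 powr (real I * (\<gamma> - \<beta>)) * 2 powr (- (real I * (q * real k - \<beta>))) = 2 powr (- (real I * \<eta>))"
      by (simp add: powr_add[symmetric] \<eta>_def algebra_simps)
    also have "G * C * E + D * K * 2 powr (- (real I * \<eta>)) * (\<Theta> J + E)
        = G * C * E + D * K * 2 powr (- (real I * \<eta>)) * E + D * K * 2 powr (- (real I * \<eta>)) * \<Theta> J"
      by (simp add: algebra_simps)
    also have "D * K * 2 powr (- (real I * \<eta>)) * \<Theta> J \<le> 1 / 2 * \<Theta> J"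
      using I by (intro mult_right_mono \<Theta>_nonneg) simp
    also have "D * K * 2 powr (- (real I * \<eta>)) * E \<le> G * K * E"
    proof -
      have "2 powr (- (real I * \<eta>)) \<le> 2 powr (real I * (\<gamma> - \<beta>))"
      proof (rule powr_mono)
        have "- (real I * \<eta>) \<le> 0" using \<eta> by simp
        also have "0 \<le> real I * (\<gamma> - \<beta>)" using \<gamma> by simp
        finally show "- (real I * \<eta>) \<le> real I * (\<gamma> - \<beta>)" .
      qed simp
      then have "(D * K * E) * 2 powr (- (real I * \<eta>)) \<le> (D * K * E) * 2 powr (real I * (\<gamma> - \<beta>))"
        using D K12 E by (intro mult_left_mono) (auto simp: K_def)
      then show ?thesis by (simp add: G_def mult_ac)
    qed
    finally have "\<Theta> J \<le> L1 * E" by (simp add: L1_def algebra_simps)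
    then have "hol k \<beta> (L1 * E) (1 / 2 ^ J) f" by (rule hol_mono[OF hol_\<Theta> _ order.refl])
    then have "hol s \<beta> (M * (L1 * E)) (1 / 2 ^ J) f" using L1 E by (intro cmp) auto
    from hol_growth[OF f rks(3) _ this, of 2]
    have "hol s \<beta> (L * E) (2 * (1 / 2 ^ J)) f" by (simp add: L_def \<gamma>_def mult.assoc)
    then show "hol s \<beta> (L * E) (1 / real n) f"
    proof (rule hol_mono[OF _ order.refl])
      have "real (2 ^ J) < real (2 * n)" using J2 by (simp only: of_nat_less_iff)
      then show "1 / real n \<le> 2 * (1 / 2 ^ J)" using n by (simp add: field_simps)
    qed
  qed
qed

end

section \<open>The spaces \<open>L_p\<close> for finite \<open>p\<close>\<close>

definition circ :: "real measure" where
  "circ = uniform_measure lborel {0..<2 * pi}"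

lemma sets_circ [measurable_cong, simp]: "sets circ = sets borel"
  by (simp add: circ_def)

lemma space_circ [simp]: "space circ = UNIV"
  by (simp add: circ_def)

interpretation circ: prob_space circ
  unfolding circ_def by (rule prob_space_uniform_measure) auto

interpretation circ2: pair_prob_space circ circ ..

lemma nn_integral_circ:
  "f \<in> borel_measurable borel \<Longrightarrow> (\<integral>\<^sup>+x. f x \<partial>circ) = (\<integral>\<^sup>+x\<in>{0..<2 * pi}. f x \<partial>lborel) / ennreal (2 * pi)"
  unfolding circ_def by (subst nn_integral_uniform_measure) (simp_all add: measurable_lborel1)

lemma nn_integral_lborel_shift:
  fixes f :: "real \<Rightarrow> ennreal"
  assumes "f \<in> borel_measurable borel"
  shows "(\<integral>\<^sup>+x. f (x + h) \<partial>lborel) = (\<integral>\<^sup>+x. f x \<partial>lborel)"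
  using nn_integral_real_affine[OF assms, of 1 h] by (simp add: add.commute)

lemma periodic_mod_2pi:
  fixes f :: "real \<Rightarrow> 'a"
  assumes "\<And>x. f (x + 2 * pi) = f x"
  shows "f (x + 2 * pi * of_int k) = f x"
proof -
  have nat: "f (x + 2 * pi * real n) = f x" for n x
  proof (induction n)
    case (Suc n)
    have "x + 2 * pi * real (Suc n) = (x + 2 * pi * real n) + 2 * pi" by (simp add: algebra_simps)
    then have "f (x + 2 * pi * real (Suc n)) = f (x + 2 * pi * real n)" by (simp only: assms)
    then show ?case using Suc.IH by (rule trans)
  qed simp
  show ?thesis
  proof (cases "k \<ge> 0")
    case True
    then show ?thesis using nat[of x "nat k"] by simp
  next
    case False
    then show ?thesis using nat[of "x + 2 * pi * of_int k" "nat (- k)"] by simp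
  qed
qed

lemma nn_integral_circ_shift:
  fixes f :: "real \<Rightarrow> ennreal"
  assumes [measurable]: "f \<in> borel_measurable borel" and per: "\<And>x. f (x + 2 * pi) = f x"
  shows "(\<integral>\<^sup>+x. f (x + h) \<partial>circ) = (\<integral>\<^sup>+x. f x \<partial>circ)"
proof -
  \<comment> \<open>By periodicity the shift may be taken in \<open>[0, 2 * pi)\<close>; the part of
    the interval pushed beyond \<open>2 * pi\<close> is then moved back by one period.\<close>
  define k where "k = \<lfloor>h / (2 * pi)\<rfloor>"
  define u where "u = h - 2 * pi * of_int k"
  have "of_int k \<le> h / (2 * pi)" "h / (2 * pi) < of_int k + 1"
    unfolding k_def by linarith+
  then have u: "0 \<le> u" "u < 2 * pi" unfolding u_def by (simp_all add: field_simps)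
  have fh: "f (x + h) = f (x + u)" for x
    using periodic_mod_2pi[of f "x + u" k, OF per] by (simp add: u_def)
  have "(\<integral>\<^sup>+x\<in>{0..<2 * pi}. f (x + u) \<partial>lborel) = (\<integral>\<^sup>+x. f (x + u) * indicator {u..<2 * pi + u} (x + u) \<partial>lborel)"
    by (intro nn_integral_cong) (auto simp: indicator_def)
  also have "\<dots> = (\<integral>\<^sup>+x. f x * indicator {u..<2 * pi + u} x \<partial>lborel)"
    by (rule nn_integral_lborel_shift[of "\<lambda>x. f x * indicator {u..<2 * pi + u} x"]) measurable
  also have "\<dots> = (\<integral>\<^sup>+x. f x * indicator {u..<2 * pi} x + f x * indicator {2 * pi..<2 * pi + u} x \<partial>lborel)"
    using u by (intro nn_integral_cong) (auto simp: indicator_def)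
  also have "\<dots> = (\<integral>\<^sup>+x. f x * indicator {u..<2 * pi} x \<partial>lborel) + (\<integral>\<^sup>+x. f x * indicator {2 * pi..<2 * pi + u} x \<partial>lborel)"
    by (rule nn_integral_add) measurable
  also have "(\<integral>\<^sup>+x. f x * indicator {2 * pi..<2 * pi + u} x \<partial>lborel) = (\<integral>\<^sup>+x. f (x + 2 * pi) * indicator {2 * pi..<2 * pi + u} (x + 2 * pi) \<partial>lborel)"
    by (rule nn_integral_lborel_shift[symmetric, of "\<lambda>x. f x * indicator {2 * pi..<2 * pi + u} x"]) measurable
  also have "\<dots> = (\<integral>\<^sup>+x. f x * indicator {0..<u} x \<partial>lborel)"
    by (intro nn_integral_cong) (auto simp: indicator_def per)
  also have "(\<integral>\<^sup>+x. f x * indicator {u..<2 * pi} x \<partial>lborel) + \<dots> = (\<integral>\<^sup>+x. f x * indicator {u..<2 * pi} x + f x * indicator {0..<u} x \<partial>lborel)"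
    by (rule nn_integral_add[symmetric]) measurable
  also have "\<dots> = (\<integral>\<^sup>+x\<in>{0..<2 * pi}. f x \<partial>lborel)"
    using u by (intro nn_integral_cong) (auto simp: indicator_def)
  finally show ?thesis unfolding fh by (simp add: nn_integral_circ)
qed

section \<open>Power inequalities and Minkowski's inequality\<close>

lemma powr_add_le:
  fixes a b q :: real
  assumes "0 \<le> a" "0 \<le> b" "0 < q" "q \<le> 1"
  shows "(a + b) powr q \<le> a powr q + b powr q"
proof (cases "a + b = 0")
  case True
  then show ?thesis by simp
next
  case False
  then have s: "a + b > 0" using assms by simp
  \<comment> \<open>As \<open>q - 1 \<le> 0\<close>, replacing \<open>x\<close> by the larger
    \<open>a + b\<close> does not increase \<open>x powr (q - 1)\<close>; adding this for
    \<open>a\<close> and \<open>b\<close> gives the claim.\<close>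
  have *: "x * (a + b) powr (q - 1) \<le> x powr q" if x: "0 \<le> x" "x \<le> a + b" for x
  proof (cases "x = 0")
    case False
    then have "(a + b) powr (q - 1) \<le> x powr (q - 1)" using assms x by (intro powr_mono2') auto
    then have "x * (a + b) powr (q - 1) \<le> x * x powr (q - 1)" using x by (intro mult_left_mono) auto
    also have "\<dots> = x powr q" using x False by (simp add: powr_mult_base)
    finally show ?thesis .
  qed simp
  have "(a + b) powr q = a * (a + b) powr (q - 1) + b * (a + b) powr (q - 1)"
    using s by (simp add: powr_mult_base distrib_right[symmetric])
  also have "\<dots> \<le> a powr q + b powr q" using assms by (intro add_mono *) auto
  finally show ?thesis .
qed

lemma powr_convex_nonneg:
  fixes x y P \<theta> :: real
  assumes "1 \<le> P" "0 \<le> x" "0 \<le> y" "0 < \<theta>" "\<theta> < 1"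
  shows "(\<theta> * x + (1 - \<theta>) * y) powr P \<le> \<theta> * x powr P + (1 - \<theta>) * y powr P"
proof -
  have scale: "(t * z) powr P \<le> t * z powr P" if "0 < t" "t < 1" "0 \<le> z" for t z :: real
  proof -
    have "t powr P \<le> t powr 1" using that assms by (intro powr_mono') auto
    then have "t powr P * z powr P \<le> t * z powr P" using that by (intro mult_right_mono) auto
    then show ?thesis using that by (simp add: powr_mult)
  qed
  consider "x = 0" | "y = 0" | "x > 0" "y > 0" using assms by fastforce
  then show ?thesis
  proof cases
    case 1 then show ?thesis using scale[of "1 - \<theta>" y] assms by simp
  next
    case 2 then show ?thesis using scale[of "\<theta>" x] assms by simp
  next
    case 3
    have "(\<lambda>x. x powr P) ((1 - \<theta>) *\<^sub>R y + \<theta> *\<^sub>R x) \<le> (1 - \<theta>) * y powr P + \<theta> * x powr P"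
      using convex_onD[OF powr_convex[OF assms(1)], of \<theta> y x] assms 3 by simp
    then show ?thesis by (simp add: add.commute)
  qed
qed

text \<open>Stated with bounds \<open>a\<close> and \<open>b\<close> for the two norms, so that no
  root of an extended integral is taken. The core is convexity of the P-th power with weights
  proportional to \<open>a\<close> and \<open>b\<close>.\<close>

lemma nn_integral_minkowski:
  fixes u v :: "'a \<Rightarrow> real" and a b P :: real
  assumes P: "1 \<le> P" and [measurable]: "u \<in> borel_measurable M" "v \<in> borel_measurable M"
    and nonneg: "\<And>x. 0 \<le> u x" "\<And>x. 0 \<le> v x" "0 \<le> a" "0 \<le> b"
    and u: "(\<integral>\<^sup>+x. ennreal (u x powr P) \<partial>M) \<le> ennreal (a powr P)"
    and v: "(\<integral>\<^sup>+x. ennreal (v x powr P) \<partial>M) \<le> ennreal (b powr P)"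
  shows "(\<integral>\<^sup>+x. ennreal ((u x + v x) powr P) \<partial>M) \<le> ennreal ((a + b) powr P)"
proof -
  have null: "AE x in M. w x = 0" if [measurable]: "w \<in> borel_measurable M" and "\<And>x. 0 \<le> w x"
    "(\<integral>\<^sup>+x. ennreal (w x powr P) \<partial>M) \<le> ennreal (0 powr P)" for w :: "'a \<Rightarrow> real"
  proof -
    have "(\<integral>\<^sup>+x. ennreal (w x powr P) \<partial>M) = 0" using that(3) by simp
    then have "AE x in M. ennreal (w x powr P) = 0" by (subst (asm) nn_integral_0_iff_AE) auto
    then show ?thesis by eventually_elim (simp add: ennreal_eq_0_iff)
  qed
  \<comment> \<open>If \<open>a\<close> or \<open>b\<close> is 0 the weights degenerate, but then
    the corresponding function vanishes almost everywhere.\<close>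
  consider "a = 0" | "b = 0" | "a > 0" "b > 0" using nonneg by fastforce
  then show ?thesis
  proof cases
    case 1
    then have "AE x in M. u x = 0" using u nonneg by (intro null) auto
    then have "(\<integral>\<^sup>+x. ennreal ((u x + v x) powr P) \<partial>M) = (\<integral>\<^sup>+x. ennreal (v x powr P) \<partial>M)"
      by (intro nn_integral_cong_AE) (auto elim: eventually_mono)
    then show ?thesis using v 1 by simp
  next
    case 2
    then have "AE x in M. v x = 0" using v nonneg by (intro null) auto
    then have "(\<integral>\<^sup>+x. ennreal ((u x + v x) powr P) \<partial>M) = (\<integral>\<^sup>+x. ennreal (u x powr P) \<partial>M)"
      by (intro nn_integral_cong_AE) (auto elim: eventually_mono)
    then show ?thesis using u 2 by simp
  next
    case 3
    define \<theta> where "\<theta> = a / (a + b)"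
    have \<theta>: "0 < \<theta>" "\<theta> < 1" "1 - \<theta> = b / (a + b)" using 3 by (auto simp: \<theta>_def field_simps)
    define c where "c = (a + b) powr P"
    have c: "c \<ge> 0" by (simp add: c_def)
    define c1 c2 where "c1 = c * \<theta> / a powr P" and "c2 = c * (1 - \<theta>) / b powr P"
    have c12: "0 \<le> c1" "0 \<le> c2" using c \<theta>(1,2) by (auto simp: c1_def c2_def)
    have pt: "(u x + v x) powr P \<le> c1 * u x powr P + c2 * v x powr P" for x
    proof -
      have "(u x + v x) = (a + b) * (\<theta> * (u x / a) + (1 - \<theta>) * (v x / b))"
      proof -
        have "\<theta> * (u x / a) = u x / (a + b)" "(1 - \<theta>) * (v x / b) = v x / (a + b)"
          using 3 unfolding \<theta>(3) by (simp_all add: \<theta>_def)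
        then show ?thesis using 3 by (simp add: add_divide_distrib[symmetric])
      qed
      then have "(u x + v x) powr P = c * (\<theta> * (u x / a) + (1 - \<theta>) * (v x / b)) powr P"
        using 3 \<theta>(1,2) nonneg by (simp add: powr_mult c_def)
      also have "\<dots> \<le> c * (\<theta> * (u x / a) powr P + (1 - \<theta>) * (v x / b) powr P)"
        using 3 \<theta> nonneg c by (intro mult_left_mono powr_convex_nonneg P) auto
      finally show ?thesis using 3 nonneg by (simp add: powr_divide distrib_left c1_def c2_def)
    qed
    have "(\<integral>\<^sup>+x. ennreal ((u x + v x) powr P) \<partial>M)
      \<le> (\<integral>\<^sup>+x. ennreal c1 * ennreal (u x powr P) + ennreal c2 * ennreal (v x powr P) \<partial>M)"
      using c12 pt by (intro nn_integral_mono) (simp flip: ennreal_mult ennreal_plus)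
    also have "\<dots> = ennreal c1 * (\<integral>\<^sup>+x. ennreal (u x powr P) \<partial>M) + ennreal c2 * (\<integral>\<^sup>+x. ennreal (v x powr P) \<partial>M)"
      by (simp add: nn_integral_add nn_integral_cmult)
    also have "\<dots> \<le> ennreal c1 * ennreal (a powr P) + ennreal c2 * ennreal (b powr P)"
      by (intro add_mono mult_left_mono u v) auto
    also have "\<dots> = ennreal (c1 * a powr P + c2 * b powr P)"
      using c12 by (simp flip: ennreal_mult ennreal_plus)
    also have "c1 * a powr P + c2 * b powr P = (a + b) powr P"
      using 3 by (simp add: c1_def c2_def) (simp add: c_def algebra_simps)
    finally show ?thesis .
  qed
qed

text \<open>The grid identity with \<open>N = m\<close> is integrated: the \<open>m\<close> rotated
  terms have equal integrals, and the integrands add up to 1.\<close>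

lemma nn_integral_circ_avg_exp_sq:
  assumes "m \<ge> 1"
  shows "(\<integral>\<^sup>+x. ennreal ((norm (avg_exp m (x + z)))\<^sup>2) \<partial>circ) = ennreal (1 / real m)"
proof -
  let ?W = "\<lambda>x. ennreal ((norm (avg_exp m x))\<^sup>2)"
  have [measurable]: "avg_exp m \<in> borel_measurable borel"
    by (intro borel_measurable_continuous_onI trig_poly_continuous[OF avg_exp_trig_poly])
  have per: "?W (x + 2 * pi) = ?W x" for x
    using trig_poly_periodic[OF avg_exp_trig_poly[of m]] by (simp add: periodic_2pi_def)
  have shift: "(\<integral>\<^sup>+x. ?W (x + h) \<partial>circ) = (\<integral>\<^sup>+x. ?W x \<partial>circ)" for h
    by (rule nn_integral_circ_shift[of ?W, OF _ per]) measurable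
  have "of_nat m * (\<integral>\<^sup>+x. ?W x \<partial>circ) = (\<Sum>i<m. \<integral>\<^sup>+x. ?W (x + (- grid m i)) \<partial>circ)"
    unfolding shift by simp
  also have "\<dots> = (\<integral>\<^sup>+x. (\<Sum>i<m. ?W (x + (- grid m i))) \<partial>circ)"
    by (rule nn_integral_sum[symmetric]) measurable
  also have "\<dots> = (\<integral>\<^sup>+x. 1 \<partial>circ)"
    using sum_norm_avg_exp_sq[OF assms order.refl] assms by (intro nn_integral_cong) (simp add: sum_ennreal)
  also have "\<dots> = 1" using circ.emeasure_space_1 by simp
  finally have e: "of_nat m * (\<integral>\<^sup>+x. ?W x \<partial>circ) = 1" .
  have "(\<integral>\<^sup>+x. ?W x \<partial>circ) = ennreal (1 / real m) * (of_nat m * (\<integral>\<^sup>+x. ?W x \<partial>circ))"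
    using assms by (simp add: mult.assoc[symmetric] ennreal_of_nat_eq_real_of_nat ennreal_mult[symmetric])
  then show ?thesis unfolding e shift by simp
qed

lemma trig_poly_bounded:
  assumes "T \<in> trig_poly n" shows "\<exists>B\<ge>0. \<forall>x. norm (T x) \<le> B"
proof -
  obtain c where T: "T = (\<lambda>x. \<Sum>\<nu>\<in>{- int n..int n}. c \<nu> * cis (of_int \<nu> * x))"
    using assms unfolding trig_poly_cis by auto
  have "norm (T x) \<le> (\<Sum>\<nu>\<in>{- int n..int n}. norm (c \<nu>))" for x
    unfolding T by (rule order.trans[OF norm_sum]) (simp add: norm_mult)
  then show ?thesis by (intro exI[of _ "\<Sum>\<nu>\<in>{- int n..int n}. norm (c \<nu>)"]) (auto intro: sum_nonneg)
qed

section \<open>The quasi-norm of L_p for finite p\<close>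

locale lp_circle =
  fixes p :: real
  assumes p_pos: "0 < p"
begin

definition q :: real where "q = min p 1"

text \<open>The function \<bar>f\<bar>^q lies in L_P with \<open>P \<ge> 1\<close>, and
  \<open>nq f\<close> is its norm there. The triangle inequality for \<open>nq\<close> is thus
  Minkowski's inequality after (a + b)^q \<le> a^q + b^q, for \<open>p < 1\<close> and
  \<open>p \<ge> 1\<close> alike.\<close>

definition P :: real where "P = p / q"

definition Ip :: "(real \<Rightarrow> complex) \<Rightarrow> ennreal" where
  "Ip f = (\<integral>\<^sup>+x. ennreal (norm (f x) powr p) \<partial>circ)"

definition X :: "(real \<Rightarrow> complex) set" where
  "X = {f. periodic_2pi f \<and> f \<in> borel_measurable borel \<and> Ip f < \<infinity>}"

definition nq :: "(real \<Rightarrow> complex) \<Rightarrow> real" where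
  "nq f = enn2real (Ip f) powr (1 / P)"

definition bnd2 :: "(real \<Rightarrow> real \<Rightarrow> complex) \<Rightarrow> real \<Rightarrow> bool" where
  "bnd2 F c \<longleftrightarrow> meas2 F \<and> 0 \<le> c \<and>
     (\<integral>\<^sup>+l. (\<integral>\<^sup>+x. ennreal (norm (F x l) powr p) \<partial>circ) \<partial>circ) \<le> ennreal (c powr P)"

text \<open>As \<open>a0 * p \<ge> 2\<close>, the a0-th power of a number in [0, 1], raised to
  \<open>p\<close>, is at most its square. \<open>Q = 2 * a0 + 2\<close> leaves one further squared
  modulus for the discrete Parseval identity.\<close>

definition a0 :: nat where "a0 = nat \<lceil>2 / q\<rceil>"

definition Q :: nat where "Q = 2 * a0 + 2"

lemma q: "0 < q" "q \<le> 1" "q \<le> p" using p_pos by (auto simp: q_def)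

lemma P: "1 \<le> P" "0 < P" "q * P = p" using q p_pos by (auto simp: P_def field_simps)

lemma a0: "2 \<le> real a0 * p" "3 \<le> real Q * q"
proof -
  have "2 / q \<le> real a0" unfolding a0_def by (rule real_nat_ceiling_ge)
  then have "2 \<le> real a0 * q" using q by (simp add: field_simps)
  also have "\<dots> \<le> real a0 * p" using q by (intro mult_left_mono) auto
  finally show "2 \<le> real a0 * p" .
  show "3 \<le> real Q * q" using \<open>2 \<le> real a0 * q\<close> q by (simp add: Q_def algebra_simps)
qed

lemma Ip_eq: "f \<in> X \<Longrightarrow> Ip f = ennreal (nq f powr P)"
proof -
  assume f: "f \<in> X"
  have "nq f powr P = enn2real (Ip f)" using P by (simp add: nq_def powr_powr)
  then show ?thesis using f by (simp add: X_def ennreal_enn2real)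
qed

lemma nq_le_iff: "f \<in> X \<Longrightarrow> 0 \<le> c \<Longrightarrow> nq f \<le> c \<longleftrightarrow> Ip f \<le> ennreal (c powr P)"
proof -
  assume f: "f \<in> X" and c: "0 \<le> c"
  have n0: "0 \<le> nq f" by (simp add: nq_def)
  have "nq f powr P \<le> c powr P \<longleftrightarrow> nq f \<le> c"
  proof
    assume "nq f powr P \<le> c powr P"
    then show "nq f \<le> c" using powr_less_mono2[OF P(2) c, of "nq f"] by (meson not_le)
  next
    assume "nq f \<le> c" then show "nq f powr P \<le> c powr P" using n0 P by (intro powr_mono2) auto
  qed
  then show ?thesis using f by (simp add: Ip_eq)
qed

lemma powr_p: "0 \<le> x \<Longrightarrow> x powr p = (x powr q) powr P"
  using P by (simp add: powr_powr)

lemma norm_add_powr_p: "norm (a + b :: complex) powr p \<le> (norm a powr q + norm b powr q) powr P"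
proof -
  have "norm (a + b) powr q \<le> (norm a + norm b) powr q" using q by (intro powr_mono2 norm_triangle_ineq) auto
  also have "\<dots> \<le> norm a powr q + norm b powr q" using q by (intro powr_add_le) auto
  finally show ?thesis using P by (simp add: powr_p powr_mono2)
qed

lemma Ip_add_le:
  assumes [measurable]: "f \<in> borel_measurable borel" "g \<in> borel_measurable borel"
    and "Ip f \<le> ennreal (a powr P)" "Ip g \<le> ennreal (b powr P)" "0 \<le> a" "0 \<le> b"
  shows "Ip (\<lambda>x. f x + g x) \<le> ennreal ((a + b) powr P)"
proof -
  have "Ip (\<lambda>x. f x + g x) \<le> (\<integral>\<^sup>+x. ennreal ((norm (f x) powr q + norm (g x) powr q) powr P) \<partial>circ)"
    unfolding Ip_def by (intro nn_integral_mono ennreal_leI norm_add_powr_p)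
  also have "\<dots> \<le> ennreal ((a + b) powr P)"
    using assms(3-6) P unfolding Ip_def by (intro nn_integral_minkowski) (auto simp: powr_powr)
  finally show ?thesis .
qed

lemma X_memI: "periodic_2pi f \<Longrightarrow> f \<in> borel_measurable borel \<Longrightarrow> Ip f \<le> ennreal c \<Longrightarrow> f \<in> X"
  using le_less_trans[of "Ip f" "ennreal c" \<infinity>] by (simp add: X_def)

lemma X_add: "f \<in> X \<Longrightarrow> g \<in> X \<Longrightarrow> (\<lambda>x. f x + g x) \<in> X"
  and nq_add: "f \<in> X \<Longrightarrow> g \<in> X \<Longrightarrow> nq (\<lambda>x. f x + g x) \<le> nq f + nq g"
proof -
  assume f: "f \<in> X" and g: "g \<in> X"
  have le: "Ip (\<lambda>x. f x + g x) \<le> ennreal ((nq f + nq g) powr P)"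
    using f g by (intro Ip_add_le) (auto simp: Ip_eq, auto simp: X_def nq_def)
  show X: "(\<lambda>x. f x + g x) \<in> X"
    using f g by (intro X_memI[OF _ _ le]) (auto simp: X_def periodic_2pi_def)
  show "nq (\<lambda>x. f x + g x) \<le> nq f + nq g"
    using le by (subst nq_le_iff[OF X]) (auto simp: nq_def)
qed

lemma Ip_scale: "f \<in> borel_measurable borel \<Longrightarrow> Ip (\<lambda>x. c * f x) = ennreal (norm c powr p) * Ip f"
  unfolding Ip_def by (subst nn_integral_cmult[symmetric]) (auto simp: norm_mult powr_mult ennreal_mult)

lemma X_scale: "f \<in> X \<Longrightarrow> (\<lambda>x. c * f x) \<in> X"
  by (auto simp: X_def Ip_scale periodic_2pi_def ennreal_mult_less_top)

lemma nq_scale: "f \<in> X \<Longrightarrow> nq (\<lambda>x. c * f x) = norm c powr q * nq f"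
proof -
  assume f: "f \<in> X"
  have "nq (\<lambda>x. c * f x) = (norm c powr p * enn2real (Ip f)) powr (1 / P)"
    using f by (simp add: nq_def X_def Ip_scale enn2real_mult)
  also have "\<dots> = norm c powr (p / P) * nq f" by (simp add: powr_mult powr_powr nq_def)
  also have "p / P = q" using P by (simp add: field_simps)
  finally show ?thesis .
qed

lemma Ip_shift: "f \<in> borel_measurable borel \<Longrightarrow> periodic_2pi f \<Longrightarrow> Ip (\<lambda>x. f (x + h)) = Ip f"
  unfolding Ip_def by (rule nn_integral_circ_shift) (auto simp: periodic_2pi_def)

lemma X_shift: "f \<in> X \<Longrightarrow> (\<lambda>x. f (x + h)) \<in> X"
  and nq_shift: "f \<in> X \<Longrightarrow> nq (\<lambda>x. f (x + h)) = nq f"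
proof -
  assume f: "f \<in> X"
  then have [measurable]: "f \<in> borel_measurable borel" by (simp add: X_def)
  have "periodic_2pi (\<lambda>x. f (x + h))"
    using f by (simp add: X_def periodic_2pi_def) (metis add.assoc add.commute)
  moreover have "(\<lambda>x. f (x + h)) \<in> borel_measurable borel" by measurable
  ultimately show "(\<lambda>x. f (x + h)) \<in> X" using f by (simp add: X_def Ip_shift)
  show "nq (\<lambda>x. f (x + h)) = nq f" using f by (simp add: X_def nq_def Ip_shift)
qed

lemma X_zero: "(\<lambda>x. 0) \<in> X"
  by (simp add: X_def Ip_def periodic_2pi_def)

lemma X_trig_poly: "T \<in> trig_poly n \<Longrightarrow> T \<in> X"
proof -
  assume T: "T \<in> trig_poly n"
  obtain B where B: "B \<ge> 0" "\<And>x. norm (T x) \<le> B" using trig_poly_bounded[OF T] by blast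
  have "Ip T \<le> (\<integral>\<^sup>+x. ennreal (B powr p) \<partial>circ)"
    unfolding Ip_def using B p_pos by (intro nn_integral_mono ennreal_leI powr_mono2) auto
  also have "\<dots> = ennreal (B powr p)" using circ.emeasure_space_1 by simp
  finally show ?thesis
    by (intro X_memI trig_poly_periodic[OF T] borel_measurable_continuous_onI trig_poly_continuous[OF T])
qed

section \<open>Averages over the grid offset\<close>

lemma bnd2_add:
  assumes "bnd2 F a" "bnd2 G b" shows "bnd2 (\<lambda>x l. F x l + G x l) (a + b)"
proof -
  have [measurable]: "(\<lambda>(x, l). F x l) \<in> borel_measurable (borel \<Otimes>\<^sub>M borel)" "(\<lambda>(x, l). G x l) \<in> borel_measurable (borel \<Otimes>\<^sub>M borel)"
    using assms by (auto simp: bnd2_def meas2_def)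
  have swap: "(\<integral>\<^sup>+l. (\<integral>\<^sup>+x. H x l \<partial>circ) \<partial>circ) = (\<integral>\<^sup>+z. case_prod H z \<partial>(circ \<Otimes>\<^sub>M circ))"
    if "case_prod H \<in> borel_measurable (circ \<Otimes>\<^sub>M circ)" for H :: "real \<Rightarrow> real \<Rightarrow> ennreal"
    using circ2.nn_integral_snd[of "case_prod H"] that by simp
  have F: "(\<integral>\<^sup>+z. ennreal ((norm (case_prod F z) powr q) powr P) \<partial>(circ \<Otimes>\<^sub>M circ)) \<le> ennreal (a powr P)"
    using assms(1) swap[of "\<lambda>x l. ennreal (norm (F x l) powr p)"]
    by (simp add: bnd2_def powr_p[symmetric] case_prod_beta)
  have G: "(\<integral>\<^sup>+z. ennreal ((norm (case_prod G z) powr q) powr P) \<partial>(circ \<Otimes>\<^sub>M circ)) \<le> ennreal (b powr P)"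
    using assms(2) swap[of "\<lambda>x l. ennreal (norm (G x l) powr p)"]
    by (simp add: bnd2_def powr_p[symmetric] case_prod_beta)
  have "(\<integral>\<^sup>+l. (\<integral>\<^sup>+x. ennreal (norm (F x l + G x l) powr p) \<partial>circ) \<partial>circ)
      = (\<integral>\<^sup>+z. ennreal (norm (case_prod F z + case_prod G z) powr p) \<partial>(circ \<Otimes>\<^sub>M circ))"
    using swap[of "\<lambda>x l. ennreal (norm (F x l + G x l) powr p)"] by (simp add: case_prod_beta)
  also have "\<dots> \<le> (\<integral>\<^sup>+z. ennreal ((norm (case_prod F z) powr q + norm (case_prod G z) powr q) powr P) \<partial>(circ \<Otimes>\<^sub>M circ))"
    by (intro nn_integral_mono ennreal_leI norm_add_powr_p)
  also have "\<dots> \<le> ennreal ((a + b) powr P)"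
    using assms P by (intro nn_integral_minkowski F G) (auto simp: bnd2_def)
  finally have "(\<integral>\<^sup>+l. (\<integral>\<^sup>+x. ennreal (norm (F x l + G x l) powr p) \<partial>circ) \<partial>circ) \<le> ennreal ((a + b) powr P)" .
  moreover have "meas2 (\<lambda>x l. F x l + G x l)"
    using assms by (auto simp: bnd2_def meas2_def periodic_2pi_def case_prod_beta)
  ultimately show ?thesis using assms by (simp add: bnd2_def)
qed

lemma bnd2_mono: "bnd2 F a \<Longrightarrow> a \<le> b \<Longrightarrow> bnd2 F b"
proof -
  assume F: "bnd2 F a" and ab: "a \<le> b"
  then have "ennreal (a powr P) \<le> ennreal (b powr P)"
    using P by (intro ennreal_leI powr_mono2) (auto simp: bnd2_def)
  with F ab show ?thesis unfolding bnd2_def by (auto intro: order.trans)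
qed

lemma bnd2_const: "f \<in> X \<Longrightarrow> bnd2 (\<lambda>x l. f x) c \<Longrightarrow> nq f \<le> c"
  by (subst nq_le_iff) (auto simp: bnd2_def Ip_def circ.emeasure_space_1[simplified])

text \<open>A mean value argument: if every slice exceeded \<open>2 * c\<close>, the average over
  \<open>l\<close> could not be bounded by \<open>c\<close>. The factor 2 with \<open>c > 0\<close>
  makes the contradiction strict.\<close>

lemma bnd2_slice:
  assumes "bnd2 F c" "0 < c" shows "\<exists>l. (\<lambda>x. F x l) \<in> X \<and> nq (\<lambda>x. F x l) \<le> 2 * c"
proof -
  have "\<exists>l. Ip (\<lambda>x. F x l) \<le> ennreal ((2 * c) powr P)"
  proof (rule ccontr)
    assume "\<nexists>l. Ip (\<lambda>x. F x l) \<le> ennreal ((2 * c) powr P)"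
    then have "(\<integral>\<^sup>+l. ennreal ((2 * c) powr P) \<partial>circ) \<le> (\<integral>\<^sup>+l. Ip (\<lambda>x. F x l) \<partial>circ)"
      by (intro nn_integral_mono) (auto simp: not_le intro: less_imp_le)
    also have "\<dots> \<le> ennreal (c powr P)" using assms by (simp add: bnd2_def Ip_def)
    finally have "ennreal ((2 * c) powr P) \<le> ennreal (c powr P)" using circ.emeasure_space_1 by simp
    then have "(2 * c) powr P \<le> c powr P" by simp
    moreover have "c powr P < (2 * c) powr P" using assms P by (intro powr_less_mono2) auto
    ultimately show False by simp
  qed
  then obtain l where l: "Ip (\<lambda>x. F x l) \<le> ennreal ((2 * c) powr P)" ..
  have "(\<lambda>(x, l). F x l) \<in> borel_measurable (borel \<Otimes>\<^sub>M borel)" using assms by (simp add: bnd2_def meas2_def)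
  from measurable_Pair_compose_split[OF this measurable_ident measurable_const[of l]]
  have "(\<lambda>x. F x l) \<in> borel_measurable borel" by simp
  then have X: "(\<lambda>x. F x l) \<in> X" using assms by (intro X_memI[OF _ _ l]) (auto simp: bnd2_def meas2_def)
  moreover have "nq (\<lambda>x. F x l) \<le> 2 * c" using l assms by (subst nq_le_iff[OF X]) auto
  ultimately show ?thesis by blast
qed

text \<open>A substitute for the inequalities of Hoelder and Jensen that works for every
  \<open>p > 0\<close>: one factor \<open>W i\<close> is summed, the rest is estimated by its
  maximum, and the maximum by an l_p sum.\<close>

lemma sum_kernel_powr_le:
  fixes g W :: "nat \<Rightarrow> real"
  assumes g: "\<And>i. 0 \<le> g i" and W: "\<And>i. 0 \<le> W i" "\<And>i. W i \<le> 1" and sum: "(\<Sum>i<N. W i) = real M"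
  shows "(\<Sum>i<N. g i * W i ^ Suc a0) powr p \<le> real M powr p * (\<Sum>i<N. g i powr p * (W i)\<^sup>2)"
proof -
  define S where "S = (\<Sum>i<N. (g i * W i ^ a0) powr p)"
  have S0: "S \<ge> 0" unfolding S_def by (intro sum_nonneg) auto
  have "g i * W i ^ a0 \<le> S powr (1 / p)" if "i < N" for i
  proof -
    have "g i * W i ^ a0 = ((g i * W i ^ a0) powr p) powr (1 / p)" using g W p_pos by (simp add: powr_powr)
    also have "\<dots> \<le> S powr (1 / p)"
      unfolding S_def using that p_pos by (intro powr_mono2 member_le_sum) auto
    finally show ?thesis .
  qed
  then have "(\<Sum>i<N. g i * W i ^ a0 * W i) \<le> (\<Sum>i<N. S powr (1 / p) * W i)"
    using W by (intro sum_mono mult_right_mono) auto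
  also have "\<dots> = S powr (1 / p) * real M" by (simp add: sum_distrib_left[symmetric] sum)
  finally have "(\<Sum>i<N. g i * W i ^ Suc a0) \<le> S powr (1 / p) * real M" by (simp add: mult_ac)
  then have "(\<Sum>i<N. g i * W i ^ Suc a0) powr p \<le> (S powr (1 / p) * real M) powr p"
    using g W p_pos by (intro powr_mono2 sum_nonneg) auto
  also have "\<dots> = real M powr p * S" using p_pos S0 by (simp add: powr_mult powr_powr)
  also have "S \<le> (\<Sum>i<N. g i powr p * (W i)\<^sup>2)"
    unfolding S_def
  proof (rule sum_mono)
    fix i
    have "(W i ^ a0) powr p \<le> (W i)\<^sup>2"
    proof (cases "W i = 0")
      case True
      have "a0 \<noteq> 0" using a0(1) by (cases "a0 = 0") auto
      then show ?thesis using True by simp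
    next
      case False
      then have pos: "W i > 0" using W(1)[of i] by simp
      have "(W i ^ a0) powr p = W i powr (real a0 * p)" using pos by (simp add: powr_powr flip: powr_realpow)
      also have "\<dots> \<le> W i powr real 2" using pos a0 W by (intro powr_mono') auto
      also have "\<dots> = (W i)\<^sup>2" using pos by (subst powr_realpow) auto
      finally show ?thesis .
    qed
    then show "(g i * W i ^ a0) powr p \<le> g i powr p * (W i)\<^sup>2"
      using g W by (simp add: powr_mult mult_left_mono)
  qed
  finally show ?thesis by (simp add: mult_left_mono)
qed

text \<open>After \<open>sum_kernel_powr_le\<close> every node contributes the same double integral,
  because a change of node is a rotation in \<open>l\<close>; this gives the factor
  \<open>M * m\<close>. The weight \<open>g\<close> has two arguments so as to cover both
  \<open>b l\<close> and \<open>f x - f l\<close>.\<close>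

lemma nn_integral_sample_le:
  fixes g :: "real \<Rightarrow> real \<Rightarrow> real"
  assumes m: "m \<ge> 1" and M: "M \<ge> 1"
    and meas: "\<And>c. (\<lambda>(x, l). g x (l + c)) \<in> borel_measurable (borel \<Otimes>\<^sub>M borel)"
    and g0: "\<And>x y. 0 \<le> g x y" and per: "\<And>x y. g x (y + 2 * pi) = g x y"
    and F: "\<And>x l. 0 \<le> F x l" "\<And>x l. F x l \<le> (\<Sum>i<M * m. g x (l + grid (M * m) i) * norm (avg_exp m (x - l - grid (M * m) i + c)) ^ Q)"
  shows "(\<integral>\<^sup>+l. (\<integral>\<^sup>+x. ennreal (F x l powr p) \<partial>circ) \<partial>circ)
    \<le> ennreal (real M powr p * real (M * m)) *
      (\<integral>\<^sup>+l. (\<integral>\<^sup>+x. ennreal (g x l powr p * ((norm (avg_exp m (x - l + c)))\<^sup>2)\<^sup>2) \<partial>circ) \<partial>circ)"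
proof -
  define N where "N = M * m"
  have N: "m \<le> N" "real N / real m = real M" using M m by (auto simp: N_def)
  define W where "W u = (norm (avg_exp m u))\<^sup>2" for u
  have W: "0 \<le> W u" "W u \<le> 1" for u
    using norm_avg_exp_le_1[of m u] by (auto simp: W_def power_le_one)
  have Wsum: "(\<Sum>i<N. W (z - grid N i)) = real M" for z
    unfolding W_def using sum_norm_avg_exp_sq[OF m N(1), of z] N by simp
  have WQ: "norm (avg_exp m u) ^ Q = W u ^ Suc a0" for u
    unfolding W_def Q_def power_mult[symmetric] by simp
  have [measurable]: "avg_exp m \<in> borel_measurable borel"
    by (intro borel_measurable_continuous_onI trig_poly_continuous[OF avg_exp_trig_poly])
  have Wm [measurable]: "W \<in> borel_measurable borel" unfolding W_def by measurable
  have meas': "(\<lambda>z. g (fst z) (snd z + c)) \<in> borel_measurable (borel \<Otimes>\<^sub>M borel)" for c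
    using meas[of c] by (simp add: case_prod_beta')
  have hm: "(\<lambda>z. ennreal (g (fst z) (snd z + d) powr p * (W (fst z - snd z - d + c))\<^sup>2)) \<in> borel_measurable (borel \<Otimes>\<^sub>M borel)" for d
    using meas'[of d] by measurable
  have hm': "(\<lambda>(x, l). ennreal (g x (l + d) powr p * (W (x - l - d + c))\<^sup>2)) \<in> borel_measurable (circ \<Otimes>\<^sub>M circ)" for d
    using hm[of d] by (simp add: case_prod_beta' cong: measurable_cong_sets)
  define h where "h l = (\<integral>\<^sup>+x. ennreal (g x l powr p * (W (x - l + c))\<^sup>2) \<partial>circ)" for l
  have h_eq: "h (l + d) = (\<integral>\<^sup>+x. ennreal (g x (l + d) powr p * (W (x - l - d + c))\<^sup>2) \<partial>circ)" for l d
    by (simp add: h_def algebra_simps)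
  have hmeas: "h \<in> borel_measurable borel"
  proof -
    have "case_prod (\<lambda>l x. ennreal (g x (l + 0) powr p * (W (x - l - 0 + c))\<^sup>2)) \<in> borel_measurable (circ \<Otimes>\<^sub>M circ)"
      using measurable_pair_swap[OF hm'[of 0]] by (simp add: case_prod_beta')
    then have "(\<lambda>l. \<integral>\<^sup>+x. ennreal (g x (l + 0) powr p * (W (x - l - 0 + c))\<^sup>2) \<partial>circ) \<in> borel_measurable circ"
      by (rule circ.borel_measurable_nn_integral)
    then show ?thesis by (simp add: h_def[abs_def] cong: measurable_cong_sets)
  qed
  have hper: "h (l + 2 * pi) = h l" for l
  proof -
    have "W (x - (l + 2 * pi) + c) = W (x - l + c)" for x
    proof -
      have "avg_exp m (x - (l + 2 * pi) + c + 2 * pi) = avg_exp m (x - (l + 2 * pi) + c)"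
        using trig_poly_periodic[OF avg_exp_trig_poly[of m]] by (simp only: periodic_2pi_def)
      moreover have "x - (l + 2 * pi) + c + 2 * pi = x - l + c" by simp
      ultimately show ?thesis by (simp only: W_def)
    qed
    then show ?thesis by (simp add: h_def per)
  qed
  have "(\<integral>\<^sup>+l. (\<integral>\<^sup>+x. ennreal (F x l powr p) \<partial>circ) \<partial>circ)
     \<le> (\<integral>\<^sup>+l. (\<integral>\<^sup>+x. ennreal (real M powr p) * (\<Sum>i<N. ennreal (g x (l + grid N i) powr p * (W (x - l - grid N i + c))\<^sup>2)) \<partial>circ) \<partial>circ)"
  proof (intro nn_integral_mono)
    fix x l
    have "F x l powr p \<le> (\<Sum>i<N. g x (l + grid N i) * W (x - l - grid N i + c) ^ Suc a0) powr p"
      using F p_pos unfolding WQ N_def[symmetric] by (intro powr_mono2) auto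
    also have "\<dots> \<le> real M powr p * (\<Sum>i<N. g x (l + grid N i) powr p * (W (x - l - grid N i + c))\<^sup>2)"
      using Wsum[of "x - l + c"] by (intro sum_kernel_powr_le g0 W) (simp add: algebra_simps)
    finally show "ennreal (F x l powr p) \<le> ennreal (real M powr p) * (\<Sum>i<N. ennreal (g x (l + grid N i) powr p * (W (x - l - grid N i + c))\<^sup>2))"
      by (subst sum_ennreal) (auto simp flip: ennreal_mult' intro: ennreal_leI)
  qed
  also have "\<dots> = (\<integral>\<^sup>+l. ennreal (real M powr p) * (\<Sum>i<N. h (l + grid N i)) \<partial>circ)"
  proof (intro nn_integral_cong)
    fix l
    have sl: "(\<lambda>x. ennreal (g x (l + d) powr p * (W (x - l - d + c))\<^sup>2)) \<in> borel_measurable circ" for d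
      using measurable_Pair_compose_split[OF hm'[of d] measurable_ident measurable_const[of l]] by simp
    show "(\<integral>\<^sup>+x. ennreal (real M powr p) * (\<Sum>i<N. ennreal (g x (l + grid N i) powr p * (W (x - l - grid N i + c))\<^sup>2)) \<partial>circ)
      = ennreal (real M powr p) * (\<Sum>i<N. h (l + grid N i))"
      unfolding h_eq nn_integral_sum[OF sl, symmetric]
      by (rule nn_integral_cmult) (intro borel_measurable_sum sl)
  qed
  also have "\<dots> = ennreal (real M powr p) * (\<Sum>i<N. \<integral>\<^sup>+l. h (l + grid N i) \<partial>circ)"
    using hmeas by (subst nn_integral_cmult) (auto simp: nn_integral_sum)
  also have "\<dots> = ennreal (real M powr p) * (of_nat N * (\<integral>\<^sup>+l. h l \<partial>circ))"
    by (simp add: nn_integral_circ_shift[OF hmeas hper])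
  also have "\<dots> = ennreal (real M powr p * real N) * (\<integral>\<^sup>+l. h l \<partial>circ)"
    by (simp add: ennreal_mult ennreal_of_nat_eq_real_of_nat mult.assoc)
  finally show ?thesis unfolding h_def W_def N_def .
qed

lemma bnd2I:
  assumes "meas2 F" "0 \<le> A"
    and "(\<integral>\<^sup>+l. (\<integral>\<^sup>+x. ennreal (norm (F x l) powr p) \<partial>circ) \<partial>circ) \<le> ennreal A"
    and "A powr (1 / P) \<le> c"
  shows "bnd2 F c"
proof -
  have "A = (A powr (1 / P)) powr P" using assms(2) P by (simp add: powr_powr)
  also have "\<dots> \<le> c powr P" using assms(4) P by (intro powr_mono2) auto
  finally have "ennreal A \<le> ennreal (c powr P)" by (rule ennreal_leI)
  moreover have "0 \<le> c" using assms(4) powr_ge_zero order.trans by blast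
  ultimately show ?thesis using assms by (auto simp: bnd2_def intro: order.trans)
qed

lemma bnd2_sample:
  assumes M: "M \<ge> 1"
  shows "\<exists>C\<ge>0. \<forall>m\<ge>1. \<forall>b\<in>X. \<forall>c F. meas2 F \<longrightarrow>
        (\<forall>x l. norm (F x l) \<le> (\<Sum>i<M * m. norm (b (l + grid (M * m) i)) *
            (norm (avg_exp m (x - l - grid (M * m) i)) ^ Q
              + norm (avg_exp m (x - l - grid (M * m) i + c)) ^ Q))) \<longrightarrow>
        bnd2 F (C * nq b)"
proof -
  \<comment> \<open>\<open>2 powr p * 2\<close> accounts for the two kernel terms; in the factor
    \<open>M powr p * (M * m)\<close> the \<open>m\<close> is cancelled by the integral
    \<open>1 / m\<close> of the kernel.\<close>
  define K where "K = 2 powr p * 2 * (real M powr p * real M)"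
  have K: "K \<ge> 0" by (simp add: K_def)
  show ?thesis
  proof (intro exI[of _ "K powr (1 / P)"] conjI allI impI ballI)
    show "0 \<le> K powr (1 / P)" by simp
    fix m :: nat and b c F assume m: "m \<ge> 1" and b: "b \<in> X" and F: "meas2 F"
      and F_le: "\<forall>x l. norm (F x l) \<le> (\<Sum>i<M * m. norm (b (l + grid (M * m) i)) *
            (norm (avg_exp m (x - l - grid (M * m) i)) ^ Q
              + norm (avg_exp m (x - l - grid (M * m) i + c)) ^ Q))"
    have [measurable]: "b \<in> borel_measurable borel" and bper: "\<And>x. b (x + 2 * pi) = b x"
      using b by (auto simp: X_def periodic_2pi_def)
    have Gm [measurable]: "avg_exp m \<in> borel_measurable borel"
      by (intro borel_measurable_continuous_onI trig_poly_continuous[OF avg_exp_trig_poly])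
    define H where "H c x l = (\<Sum>i<M * m. norm (b (l + grid (M * m) i)) * norm (avg_exp m (x - l - grid (M * m) i + c)) ^ Q)" for c x l
    have H0: "0 \<le> H c x l" for c x l unfolding H_def by (intro sum_nonneg) auto
    have Hm: "(\<lambda>z. H c (fst z) (snd z)) \<in> borel_measurable (borel \<Otimes>\<^sub>M borel)" for c
      unfolding H_def by measurable
    have Hm1: "(\<lambda>x. H c x l) \<in> borel_measurable borel" for c l unfolding H_def by measurable
    have Hm2: "(\<lambda>l. \<integral>\<^sup>+x. ennreal (H c x l powr p) \<partial>circ) \<in> borel_measurable circ" for c
    proof -
      have "(\<lambda>(x, l). ennreal (H c x l powr p)) \<in> borel_measurable (circ \<Otimes>\<^sub>M circ)"
        using Hm[of c] by (simp add: case_prod_beta' cong: measurable_cong_sets)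
      from measurable_pair_swap[OF this]
      have "case_prod (\<lambda>l x. ennreal (H c x l powr p)) \<in> borel_measurable (circ \<Otimes>\<^sub>M circ)"
        by (simp add: case_prod_beta')
      then show ?thesis by (rule circ.borel_measurable_nn_integral)
    qed
    have part: "(\<integral>\<^sup>+l. (\<integral>\<^sup>+x. ennreal (H c x l powr p) \<partial>circ) \<partial>circ) \<le> ennreal (real M powr p * real M) * Ip b" for c
    proof -
      have "(\<integral>\<^sup>+l. (\<integral>\<^sup>+x. ennreal (H c x l powr p) \<partial>circ) \<partial>circ)
        \<le> ennreal (real M powr p * real (M * m)) *
          (\<integral>\<^sup>+l. (\<integral>\<^sup>+x. ennreal (norm (b l) powr p * ((norm (avg_exp m (x - l + c)))\<^sup>2)\<^sup>2) \<partial>circ) \<partial>circ)"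
        by (rule nn_integral_sample_le[OF m M, where c = c]) (auto simp: H0 bper, auto simp: H_def)
      also have "(\<integral>\<^sup>+l. (\<integral>\<^sup>+x. ennreal (norm (b l) powr p * ((norm (avg_exp m (x - l + c)))\<^sup>2)\<^sup>2) \<partial>circ) \<partial>circ)
        \<le> (\<integral>\<^sup>+l. ennreal (norm (b l) powr p) * ennreal (1 / real m) \<partial>circ)"
      proof (rule nn_integral_mono)
        fix l
        have "(\<integral>\<^sup>+x. ennreal (norm (b l) powr p * ((norm (avg_exp m (x - l + c)))\<^sup>2)\<^sup>2) \<partial>circ)
          \<le> (\<integral>\<^sup>+x. ennreal (norm (b l) powr p) * ennreal ((norm (avg_exp m (x + (c - l))))\<^sup>2) \<partial>circ)"
        proof (rule nn_integral_mono)
          fix x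
          have "((norm (avg_exp m (x - l + c)))\<^sup>2)\<^sup>2 \<le> (norm (avg_exp m (x - l + c)))\<^sup>2"
            using norm_avg_exp_le_1[of m "x - l + c"] power_decreasing[of 1 2 "(norm (avg_exp m (x - l + c)))\<^sup>2"]
            by (simp add: power_le_one)
          then show "ennreal (norm (b l) powr p * ((norm (avg_exp m (x - l + c)))\<^sup>2)\<^sup>2)
            \<le> ennreal (norm (b l) powr p) * ennreal ((norm (avg_exp m (x + (c - l))))\<^sup>2)"
            by (subst ennreal_mult[symmetric]) (auto intro!: ennreal_leI mult_left_mono simp: algebra_simps)
        qed
        also have "\<dots> = ennreal (norm (b l) powr p) * ennreal (1 / real m)"
          by (subst nn_integral_cmult) (simp_all only: nn_integral_circ_avg_exp_sq[OF m], measurable)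
        finally show "(\<integral>\<^sup>+x. ennreal (norm (b l) powr p * ((norm (avg_exp m (x - l + c)))\<^sup>2)\<^sup>2) \<partial>circ) \<le> \<dots>" .
      qed
      also have "\<dots> = Ip b * ennreal (1 / real m)"
        unfolding Ip_def by (rule nn_integral_multc) measurable
      also have "ennreal (real M powr p * real (M * m)) * (Ip b * ennreal (1 / real m)) = ennreal (real M powr p * real M) * Ip b"
      proof -
        have "ennreal (real M powr p * real (M * m)) * ennreal (1 / real m) = ennreal (real M powr p * real M)"
          using m by (simp flip: ennreal_mult)
        then show ?thesis by (metis mult.assoc mult.commute)
      qed
      finally show ?thesis by (simp add: mult_left_mono)
    qed
    have "(\<integral>\<^sup>+l. (\<integral>\<^sup>+x. ennreal (norm (F x l) powr p) \<partial>circ) \<partial>circ)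
      \<le> (\<integral>\<^sup>+l. (\<integral>\<^sup>+x. ennreal (2 powr p) * (ennreal (H 0 x l powr p) + ennreal (H c x l powr p)) \<partial>circ) \<partial>circ)"
    proof (intro nn_integral_mono)
      fix x l
      have "norm (F x l) \<le> H 0 x l + H c x l"
        using F_le[rule_format, of x l] by (simp add: H_def distrib_left sum.distrib)
      also have "\<dots> \<le> 2 * max (H 0 x l) (H c x l)" by simp
      finally have "norm (F x l) powr p \<le> (2 * max (H 0 x l) (H c x l)) powr p" using p_pos by (intro powr_mono2) auto
      also have "\<dots> = 2 powr p * max (H 0 x l) (H c x l) powr p" using H0 by (simp add: powr_mult le_max_iff_disj)
      also have "\<dots> \<le> 2 powr p * (H 0 x l powr p + H c x l powr p)" by (intro mult_left_mono) (auto simp: max_def)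
      finally show "ennreal (norm (F x l) powr p) \<le> ennreal (2 powr p) * (ennreal (H 0 x l powr p) + ennreal (H c x l powr p))"
        by (simp flip: ennreal_plus ennreal_mult' add: ennreal_leI)
    qed
    also have "\<dots> = ennreal (2 powr p) * ((\<integral>\<^sup>+l. (\<integral>\<^sup>+x. ennreal (H 0 x l powr p) \<partial>circ) \<partial>circ) + (\<integral>\<^sup>+l. (\<integral>\<^sup>+x. ennreal (H c x l powr p) \<partial>circ) \<partial>circ))"
      using Hm1 Hm2 by (simp add: nn_integral_cmult nn_integral_add)
    also have "\<dots> \<le> ennreal (2 powr p) * (ennreal (real M powr p * real M) * Ip b + ennreal (real M powr p * real M) * Ip b)"
      by (intro mult_left_mono add_mono part) auto
    also have "\<dots> = ennreal (2 powr p) * (2 * (ennreal (real M powr p * real M) * Ip b))"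
      by (simp only: mult_2)
    also have "\<dots> = ennreal (K * nq b powr P)"
      unfolding Ip_eq[OF b] K_def by (simp add: ennreal_mult mult.assoc)
    finally have "(\<integral>\<^sup>+l. (\<integral>\<^sup>+x. ennreal (norm (F x l) powr p) \<partial>circ) \<partial>circ) \<le> ennreal (K * nq b powr P)" .
    then show "bnd2 F (K powr (1 / P) * nq b)"
    proof (rule bnd2I[OF F, rotated])
      show "0 \<le> K * nq b powr P" using K by simp
      have "(K * nq b powr P) powr (1 / P) = K powr (1 / P) * (nq b powr P) powr (1 / P)" using K by (simp add: powr_mult)
      also have "(nq b powr P) powr (1 / P) = nq b" using P by (simp add: powr_powr nq_def)
      finally show "(K * nq b powr P) powr (1 / P) \<le> K powr (1 / P) * nq b" by simp
    qed
  qed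
qed

sublocale shift_quasinorm X nq q
proof
  show "0 < q" "q \<le> 1" using q by auto
qed (auto simp: nq_def X_zero X_add X_scale X_shift nq_add nq_scale[unfolded nq_def] nq_shift[unfolded nq_def] X_trig_poly intro: nq_add[unfolded nq_def], simp add: X_def)

text \<open>Substituting \<open>x + l\<close> for \<open>x\<close> and integrating over
  \<open>l\<close> first turns the difference into a first modulus at \<open>x\<close>. It is small
  near 0 and \<open>2 * pi\<close>; elsewhere the squared kernel is O(1 / (m \<delta>)^2). One
  squared kernel is kept, since its integral \<open>1 / m\<close> has to cancel the number of
  nodes.\<close>

lemma bnd2_null:
  assumes M: "M \<ge> 1" and f: "f \<in> X" and null: "null_mod 1 f" and \<epsilon>: "0 < \<epsilon>"
  shows "\<exists>m0. \<forall>m\<ge>m0. \<forall>F. meas2 F \<longrightarrow>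
        (\<forall>x l. norm (F x l) \<le> (\<Sum>i<M * m. norm (f x - f (l + grid (M * m) i)) *
            norm (avg_exp m (x - l - grid (M * m) i)) ^ Q)) \<longrightarrow>
        bnd2 F \<epsilon>"
proof -
  have fm [measurable]: "f \<in> borel_measurable borel" and fper: "\<And>x. f (x + 2 * pi) = f x"
    using f by (auto simp: X_def periodic_2pi_def)
  define K where "K = real M powr p * real M"
  have K: "K > 0" using M by (simp add: K_def)
  \<comment> \<open>Half of \<open>\<epsilon> powr P\<close> is reserved for the points near the
    origin, half for the tail.\<close>
  define \<epsilon>1 where "\<epsilon>1 = (\<epsilon> powr P / (2 * K)) powr (1 / P)"
  have \<epsilon>1: "\<epsilon>1 > 0" "K * \<epsilon>1 powr P = \<epsilon> powr P / 2"
    using \<epsilon> K P by (auto simp: \<epsilon>1_def powr_powr)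
  obtain \<delta> where \<delta>: "\<delta> > 0" and d: "\<And>t. 0 < t \<Longrightarrow> t < \<delta> \<Longrightarrow> nq (\<lambda>x. f x - f (x + t)) \<le> \<epsilon>1"
    using null \<epsilon>1(1) unfolding null_mod_def fdiff_1 by blast
  define B where "B = (2 * nq f) powr P"
  have B: "B \<ge> 0" by (simp add: B_def)
  define R where "R m = (6 / (real m * \<delta>))\<^sup>2" for m :: nat
  have R: "R m = (6 / \<delta> * (1 / real m))\<^sup>2" for m by (simp add: R_def mult.commute)
  have "(\<lambda>m. K * (R m * B)) \<longlonglongrightarrow> K * ((6 / \<delta> * 0)\<^sup>2 * B)"
    unfolding R by (intro tendsto_mult tendsto_power tendsto_const lim_1_over_n)
  then have "eventually (\<lambda>m. K * (R m * B) < \<epsilon> powr P / 2) sequentially"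
    by (rule order_tendstoD(2)) (use \<epsilon> in auto)
  then obtain m0 where m0: "\<And>m. m \<ge> m0 \<Longrightarrow> K * (R m * B) < \<epsilon> powr P / 2"
    unfolding eventually_sequentially by blast
  show ?thesis
  proof (intro exI[of _ "max 1 m0"] allI impI)
    fix m F assume "max 1 m0 \<le> m" and F: "meas2 F"
      and F_le: "\<forall>x l. norm (F x l) \<le> (\<Sum>i<M * m. norm (f x - f (l + grid (M * m) i)) *
            norm (avg_exp m (x - l - grid (M * m) i)) ^ Q)"
    then have m: "m \<ge> 1" "m \<ge> m0" by auto
    have Gm [measurable]: "avg_exp m \<in> borel_measurable borel"
      by (intro borel_measurable_continuous_onI trig_poly_continuous[OF avg_exp_trig_poly])
    have Gper: "avg_exp m (u + 2 * pi) = avg_exp m u" for u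
      using trig_poly_periodic[OF avg_exp_trig_poly] by (simp add: periodic_2pi_def)
    define W where "W u = (norm (avg_exp m u))\<^sup>2" for u
    have W: "0 \<le> W u" "W u \<le> 1" for u
      using norm_avg_exp_le_1[of m u] by (auto simp: W_def power_le_one)
    have [measurable]: "W \<in> borel_measurable borel" unfolding W_def by measurable
    have Wper: "W (u + 2 * pi) = W u" for u by (simp add: W_def Gper)
    define \<omega> where "\<omega> u = nq (\<lambda>x. f x - f (x + u)) powr P" for u
    have \<omega>B: "\<omega> u \<le> B" for u
    proof -
      have "nq (\<lambda>x. f x - f (x + u)) \<le> 2 * nq f"
        using nq_diff[OF f X_shift[OF f, of u]] nq_shift[OF f, of u] by simp
      then show ?thesis unfolding \<omega>_def B_def using P by (intro powr_mono2) auto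
    qed
    have near: "\<omega> u \<le> \<epsilon>1 powr P" if "0 \<le> u" "u < \<delta>" for u
    proof -
      have "nq (\<lambda>x. f x - f (x + u)) \<le> \<epsilon>1" using that d[of u] \<epsilon>1 by (cases "u = 0") auto
      then show ?thesis unfolding \<omega>_def using P by (intro powr_mono2) auto
    qed
    \<comment> \<open>Steps near \<open>2 * pi\<close> are small negative steps, for which the
      modulus is the same.\<close>
    have refl: "\<omega> u = \<omega> (2 * pi - u)" for u
    proof -
      have "f (x + u) = f (x - (2 * pi - u))" for x using fper[of "x - (2 * pi - u)"] by simp
      then show ?thesis unfolding \<omega>_def using nq_fdiff_minus[OF f, of "2 * pi - u"] by simp
    qed
    have far: "W u \<le> R m" if "\<delta> \<le> \<bar>u\<bar>" "\<bar>u\<bar> \<le> pi" for u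
    proof -
      have "norm (avg_exp m u) * \<delta> \<le> norm (avg_exp m u) * \<bar>u\<bar>" using that by (intro mult_left_mono) auto
      also have "\<dots> \<le> 6 / real m" by (rule norm_avg_exp_decay) (use that in auto)
      finally have "norm (avg_exp m u) \<le> 6 / (real m * \<delta>)" using \<delta> m by (simp add: field_simps)
      then show ?thesis unfolding W_def R_def by (intro power_mono) auto
    qed
    have pt: "(W u)\<^sup>2 * \<omega> u \<le> W u * (\<epsilon>1 powr P + R m * B)" if u: "0 \<le> u" "u \<le> 2 * pi" for u
    proof -
      have "W u * \<omega> u \<le> \<epsilon>1 powr P + R m * B"
      proof (cases "u < \<delta> \<or> 2 * pi - u < \<delta>")
        case True
        then have "\<omega> u \<le> \<epsilon>1 powr P" using near[of u] near[of "2 * pi - u"] refl[of u] u by auto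
        then have "W u * \<omega> u \<le> 1 * \<epsilon>1 powr P" using W[of u] by (intro mult_mono) (auto simp: \<omega>_def)
        also have "\<dots> \<le> \<epsilon>1 powr P + R m * B" using B by (simp add: R_def)
        finally show ?thesis .
      next
        case False
        have "W u \<le> R m"
        proof (cases "u \<le> pi")
          case True then show ?thesis using False u by (intro far) auto
        next
          case False': False
          have "W (u - 2 * pi) \<le> R m" using False False' u by (intro far) auto
          then show ?thesis using Wper[of "u - 2 * pi"] by simp
        qed
        then have "W u * \<omega> u \<le> R m * B" using W \<omega>B by (intro mult_mono) (auto simp: R_def \<omega>_def)
        then show ?thesis by (simp add: add_increasing)
      qed
      then have "W u * (W u * \<omega> u) \<le> W u * (\<epsilon>1 powr P + R m * B)" using W by (intro mult_left_mono) auto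
      then show ?thesis by (simp add: power2_eq_square mult.assoc)
    qed
    have "(\<integral>\<^sup>+l. (\<integral>\<^sup>+x. ennreal (norm (F x l) powr p) \<partial>circ) \<partial>circ)
        \<le> ennreal (real M powr p * real (M * m)) *
          (\<integral>\<^sup>+l. (\<integral>\<^sup>+x. ennreal (norm (f x - f l) powr p * ((norm (avg_exp m (x - l + 0)))\<^sup>2)\<^sup>2) \<partial>circ) \<partial>circ)"
    proof (rule nn_integral_sample_le[OF m(1) M, where c = 0])
      show "(\<lambda>(x, l). norm (f x - f (l + c))) \<in> borel_measurable (borel \<Otimes>\<^sub>M borel)" for c by measurable
    qed (use F_le in \<open>auto simp: fper\<close>)
    also have "(\<integral>\<^sup>+l. (\<integral>\<^sup>+x. ennreal (norm (f x - f l) powr p * ((norm (avg_exp m (x - l + 0)))\<^sup>2)\<^sup>2) \<partial>circ) \<partial>circ)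
       = (\<integral>\<^sup>+l. (\<integral>\<^sup>+x. ennreal (norm (f (x + l) - f l) powr p * (W x)\<^sup>2) \<partial>circ) \<partial>circ)"
    proof (rule nn_integral_cong)
      fix l
      let ?g = "\<lambda>x. ennreal (norm (f x - f l) powr p * (W (x - l))\<^sup>2)"
      have gper: "?g (x + 2 * pi) = ?g x" for x
      proof -
        have "W (x + 2 * pi - l) = W (x - l)" using Wper[of "x - l"] by (simp add: algebra_simps)
        then show ?thesis by (simp add: fper)
      qed
      have "(\<integral>\<^sup>+x. ?g (x + l) \<partial>circ) = (\<integral>\<^sup>+x. ?g x \<partial>circ)"
        by (rule nn_integral_circ_shift[of ?g, OF _ gper]) measurable
      then show "(\<integral>\<^sup>+x. ennreal (norm (f x - f l) powr p * ((norm (avg_exp m (x - l + 0)))\<^sup>2)\<^sup>2) \<partial>circ)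
         = (\<integral>\<^sup>+x. ennreal (norm (f (x + l) - f l) powr p * (W x)\<^sup>2) \<partial>circ)" by (simp add: W_def)
    qed
    \<comment> \<open>The integrations are exchanged so that the inner one is the p-th power mean of
      a difference with the fixed step \<open>x\<close>.\<close>
    also have "\<dots> = (\<integral>\<^sup>+x. (\<integral>\<^sup>+l. ennreal (norm (f (x + l) - f l) powr p * (W x)\<^sup>2) \<partial>circ) \<partial>circ)"
    proof (rule circ2.Fubini')
      have "(\<lambda>z. ennreal (norm (f (fst z + snd z) - f (snd z)) powr p * (W (fst z))\<^sup>2)) \<in> borel_measurable (borel \<Otimes>\<^sub>M borel)"
        by measurable
      then show "(\<lambda>(x, l). ennreal (norm (f (x + l) - f l) powr p * (W x)\<^sup>2)) \<in> borel_measurable (circ \<Otimes>\<^sub>M circ)"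
        by (simp add: case_prod_beta' cong: measurable_cong_sets)
    qed
    also have "\<dots> = (\<integral>\<^sup>+x. ennreal ((W x)\<^sup>2 * \<omega> x) \<partial>circ)"
    proof (rule nn_integral_cong)
      fix x
      have "Ip (\<lambda>l. f l - f (l + x)) = ennreal (\<omega> x)"
        unfolding \<omega>_def by (rule Ip_eq) (rule X_diff[OF f X_shift[OF f]])
      then have "(\<integral>\<^sup>+l. ennreal (norm (f (x + l) - f l) powr p) \<partial>circ) = ennreal (\<omega> x)"
        by (simp add: Ip_def norm_minus_commute add.commute)
      moreover have "(\<integral>\<^sup>+l. ennreal (norm (f (x + l) - f l) powr p * (W x)\<^sup>2) \<partial>circ)
         = (\<integral>\<^sup>+l. ennreal ((W x)\<^sup>2) * ennreal (norm (f (x + l) - f l) powr p) \<partial>circ)"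
        by (simp add: ennreal_mult mult.commute)
      moreover have "\<dots> = ennreal ((W x)\<^sup>2) * (\<integral>\<^sup>+l. ennreal (norm (f (x + l) - f l) powr p) \<partial>circ)"
        by (rule nn_integral_cmult) measurable
      ultimately show "(\<integral>\<^sup>+l. ennreal (norm (f (x + l) - f l) powr p * (W x)\<^sup>2) \<partial>circ) = ennreal ((W x)\<^sup>2 * \<omega> x)"
        by (simp add: ennreal_mult \<omega>_def)
    qed
    also have "\<dots> \<le> (\<integral>\<^sup>+x. ennreal (W x) * ennreal (\<epsilon>1 powr P + R m * B) \<partial>circ)"
    proof (rule nn_integral_mono_AE)
      have "AE x in circ. x \<in> {0..<2 * pi}"
        unfolding circ_def by (intro AE_uniform_measureI) auto
      then show "AE x in circ. ennreal ((W x)\<^sup>2 * \<omega> x) \<le> ennreal (W x) * ennreal (\<epsilon>1 powr P + R m * B)"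
      proof eventually_elim
        case (elim x)
        then have "(W x)\<^sup>2 * \<omega> x \<le> W x * (\<epsilon>1 powr P + R m * B)" by (intro pt) auto
        then show ?case using W[of x] by (simp flip: ennreal_mult' add: ennreal_leI)
      qed
    qed
    also have "\<dots> = (\<integral>\<^sup>+x. ennreal (W x) \<partial>circ) * ennreal (\<epsilon>1 powr P + R m * B)"
      by (rule nn_integral_multc) measurable
    also have "(\<integral>\<^sup>+x. ennreal (W x) \<partial>circ) = ennreal (1 / real m)"
      using nn_integral_circ_avg_exp_sq[OF m(1), of 0] by (simp add: W_def)
    also have "ennreal (real M powr p * real (M * m)) * (ennreal (1 / real m) * ennreal (\<epsilon>1 powr P + R m * B))
        = ennreal (K * (\<epsilon>1 powr P + R m * B))"
    proof -
      have "0 \<le> \<epsilon>1 powr P + R m * B" using B by (simp add: R_def)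
      then obtain S where S: "0 \<le> S" "S = \<epsilon>1 powr P + R m * B" by blast
      show ?thesis unfolding S(2)[symmetric] using m S(1) by (simp add: K_def flip: ennreal_mult)
    qed
    finally have "(\<integral>\<^sup>+l. (\<integral>\<^sup>+x. ennreal (norm (F x l) powr p) \<partial>circ) \<partial>circ) \<le> ennreal (K * (\<epsilon>1 powr P + R m * B))"
      by (simp add: mult_left_mono)
    then show "bnd2 F \<epsilon>"
    proof (rule bnd2I[OF F, rotated])
      show "0 \<le> K * (\<epsilon>1 powr P + R m * B)" using K B by (simp add: R_def)
      have "K * (\<epsilon>1 powr P + R m * B) \<le> \<epsilon> powr P"
        using m0[OF m(2)] \<epsilon>1(2) by (simp add: distrib_left)
      then have "(K * (\<epsilon>1 powr P + R m * B)) powr (1 / P) \<le> (\<epsilon> powr P) powr (1 / P)"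
        using K B P by (intro powr_mono2) (auto simp: R_def)
      then show "(K * (\<epsilon>1 powr P + R m * B)) powr (1 / P) \<le> \<epsilon>" using P \<epsilon> by (simp add: powr_powr)
    qed
  qed
qed

sublocale sampling_quasinorm X nq q bnd2 Q
proof
  show "f \<in> X \<Longrightarrow> f \<in> borel_measurable borel" for f by (simp add: X_def)
qed (fact a0 bnd2_add bnd2_mono bnd2_const bnd2_slice bnd2_sample bnd2_null)+

end

section \<open>The uniform norm\<close>

text \<open>The space is larger than that of the continuous functions because slices of jointly
  measurable functions have to belong to it.\<close>

definition sup_X :: "(real \<Rightarrow> complex) set" where
  "sup_X = {f. periodic_2pi f \<and> f \<in> borel_measurable borel \<and> bounded (range f)}"

text \<open>\<open>max 0\<close> guarantees nonnegativity also for unbounded functions, whose real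
  \<open>SUP\<close> has no meaning.\<close>

definition sup_nq :: "(real \<Rightarrow> complex) \<Rightarrow> real" where
  "sup_nq f = max 0 (SUP x. norm (f x))"

definition sup_bnd2 :: "(real \<Rightarrow> real \<Rightarrow> complex) \<Rightarrow> real \<Rightarrow> bool" where
  "sup_bnd2 F c \<longleftrightarrow> meas2 F \<and> (\<forall>x l. norm (F x l) \<le> c)"

lemma sup_X_iff: "f \<in> sup_X \<longleftrightarrow> periodic_2pi f \<and> f \<in> borel_measurable borel \<and> (\<exists>B. \<forall>x. norm (f x) \<le> B)"
  by (auto simp: sup_X_def bounded_iff)

lemma norm_le_sup_nq: "f \<in> sup_X \<Longrightarrow> norm (f x) \<le> sup_nq f"
proof -
  assume "f \<in> sup_X"
  then have "norm (f x) \<le> (SUP x. norm (f x))" by (intro cSUP_upper) (auto simp: sup_X_iff bdd_above_def)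
  then show ?thesis by (simp add: sup_nq_def)
qed

lemma sup_nq_nonneg: "0 \<le> sup_nq f"
  by (simp add: sup_nq_def)

lemma sup_nq_least: "(\<And>x. norm (f x) \<le> c) \<Longrightarrow> sup_nq f \<le> c"
proof -
  assume f: "\<And>x. norm (f x) \<le> c"
  have "0 \<le> c" using f[of 0] norm_ge_zero[of "f 0"] by linarith
  moreover have "(SUP x. norm (f x)) \<le> c" by (rule cSUP_least) (auto simp: f)
  ultimately show ?thesis by (simp add: sup_nq_def)
qed

interpretation sup: shift_quasinorm sup_X sup_nq 1
proof
  fix f g :: "real \<Rightarrow> complex" and c h n
  show "(\<lambda>x. f x + g x) \<in> sup_X" if fg: "f \<in> sup_X" "g \<in> sup_X"
  proof -
    have "norm (f x + g x) \<le> sup_nq f + sup_nq g" for x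
      by (intro norm_triangle_mono norm_le_sup_nq fg)
    then show ?thesis using fg by (auto simp: sup_X_iff periodic_2pi_def)
  qed
  show "f \<in> sup_X \<Longrightarrow> g \<in> sup_X \<Longrightarrow> sup_nq (\<lambda>x. f x + g x) \<le> sup_nq f + sup_nq g"
    by (intro sup_nq_least norm_triangle_mono norm_le_sup_nq)
  show scale: "(\<lambda>x. c * f x) \<in> sup_X" if f: "f \<in> sup_X" for f c
  proof -
    have "norm (c * f x) \<le> norm c * sup_nq f" for x
      unfolding norm_mult by (intro mult_left_mono norm_le_sup_nq f) auto
    then show ?thesis using f by (auto simp: sup_X_iff periodic_2pi_def)
  qed
  have scale_le: "sup_nq (\<lambda>x. c * f x) \<le> norm c * sup_nq f" if f: "f \<in> sup_X" for f c
    unfolding norm_mult by (intro sup_nq_least) (auto simp: norm_mult intro!: mult_left_mono norm_le_sup_nq f)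
  show "sup_nq (\<lambda>x. c * f x) = norm c powr 1 * sup_nq f" if f: "f \<in> sup_X"
  proof (cases "c = 0")
    case True
    then show ?thesis by (simp add: sup_nq_def)
  next
    case False
    \<comment> \<open>The reverse inequality is the first one applied to the inverse scalar.\<close>
    have "sup_nq f \<le> norm (inverse c) * sup_nq (\<lambda>x. c * f x)"
      using scale_le[OF scale[OF f, of c], of "inverse c"] False by (simp add: mult.assoc[symmetric])
    then have "norm c * sup_nq f \<le> norm c * (norm (inverse c) * sup_nq (\<lambda>x. c * f x))"
      by (rule mult_left_mono) simp
    also have "\<dots> = sup_nq (\<lambda>x. c * f x)" using False by (simp add: norm_inverse)
    finally have "norm c * sup_nq f \<le> sup_nq (\<lambda>x. c * f x)" .
    then show ?thesis using scale_le[OF f, of c] by simp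
  qed
  show "f \<in> sup_X \<Longrightarrow> (\<lambda>x. f (x + h)) \<in> sup_X"
  proof -
    assume f: "f \<in> sup_X"
    have "f (x + 2 * pi + h) = f (x + h)" for x
    proof -
      have "x + 2 * pi + h = x + h + 2 * pi" by simp
      then show ?thesis using f by (simp only: sup_X_iff periodic_2pi_def)
    qed
    then show ?thesis using f by (auto simp: sup_X_iff periodic_2pi_def)
  qed
  show "sup_nq (\<lambda>x. f (x + h)) = sup_nq f"
  proof -
    have "range (\<lambda>x. norm (f (x + h))) = range (\<lambda>x. norm (f x))"
      using surj_plus_right[of h] image_comp[of "\<lambda>x. norm (f x)" "\<lambda>x. x + h" UNIV] by (simp add: comp_def)
    then show ?thesis by (simp add: sup_nq_def)
  qed
  show "f \<in> trig_poly n \<Longrightarrow> f \<in> sup_X"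
  proof -
    assume T: "f \<in> trig_poly n"
    obtain B where "\<And>x. norm (f x) \<le> B" using trig_poly_bounded[OF T] by blast
    then show ?thesis using trig_poly_periodic[OF T] trig_poly_continuous[OF T]
      by (auto simp: sup_X_iff intro: borel_measurable_continuous_onI)
  qed
qed (auto simp: sup_nq_nonneg sup_X_iff periodic_2pi_def)

text \<open>Two of the four powers suffice: their sum over the grid is \<open>M\<close> for each of
  the two kernel terms, whatever \<open>x\<close> and \<open>l\<close> are.\<close>

lemma sup_bnd2_sample:
  assumes M: "M \<ge> 1"
  shows "\<exists>C\<ge>0. \<forall>m\<ge>1. \<forall>b\<in>sup_X. \<forall>c F. meas2 F \<longrightarrow>
        (\<forall>x l. norm (F x l) \<le> (\<Sum>i<M * m. norm (b (l + grid (M * m) i)) *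
            (norm (avg_exp m (x - l - grid (M * m) i)) ^ 4
              + norm (avg_exp m (x - l - grid (M * m) i + c)) ^ 4))) \<longrightarrow>
        sup_bnd2 F (C * sup_nq b)"
proof (intro exI[of _ "2 * real M"] conjI allI impI ballI)
  fix m :: nat and b c F assume m: "m \<ge> 1" and b: "b \<in> sup_X" and F: "meas2 F"
    and F_le: "\<forall>x l. norm (F x l) \<le> (\<Sum>i<M * m. norm (b (l + grid (M * m) i)) *
            (norm (avg_exp m (x - l - grid (M * m) i)) ^ 4
              + norm (avg_exp m (x - l - grid (M * m) i + c)) ^ 4))"
  define N where "N = M * m"
  have N: "m \<le> N" "real N / real m = real M" using M m by (auto simp: N_def)
  have sq: "norm (avg_exp m u) ^ 4 \<le> (norm (avg_exp m u))\<^sup>2" for u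
    using norm_avg_exp_le_1[of m u] by (intro power_decreasing) auto
  have "norm (F x l) \<le> 2 * real M * sup_nq b" for x l
  proof -
    have "norm (F x l) \<le> (\<Sum>i<N. norm (b (l + grid N i)) *
            (norm (avg_exp m (x - l - grid N i)) ^ 4 + norm (avg_exp m (x - l - grid N i + c)) ^ 4))"
      using F_le by (simp add: N_def)
    also have "\<dots> \<le> (\<Sum>i<N. sup_nq b * ((norm (avg_exp m (x - l - grid N i)))\<^sup>2 + (norm (avg_exp m (x - l + c - grid N i)))\<^sup>2))"
    proof (intro sum_mono mult_mono norm_le_sup_nq b add_mono sq)
      fix i
      have eq: "x - l - grid N i + c = x - l + c - grid N i" by simp
      show "norm (avg_exp m (x - l - grid N i + c)) ^ 4 \<le> (norm (avg_exp m (x - l + c - grid N i)))\<^sup>2"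
        unfolding eq by (rule sq)
    qed (auto simp: sup_nq_nonneg)
    also have "\<dots> = sup_nq b * ((\<Sum>i<N. (norm (avg_exp m (x - l - grid N i)))\<^sup>2) + (\<Sum>i<N. (norm (avg_exp m (x - l + c - grid N i)))\<^sup>2))"
      by (simp add: sum_distrib_left sum.distrib distrib_left)
    also have "\<dots> = sup_nq b * (real M + real M)"
      using sum_norm_avg_exp_sq[OF m N(1)] N by simp
    finally show ?thesis by (simp add: algebra_simps)
  qed
  then show "sup_bnd2 F (2 * real M * sup_nq b)" using F by (simp add: sup_bnd2_def)
qed simp

text \<open>The exponent 4 is split as 2 + 2: one square decays away from the origin, while
  \<open>f\<close> varies little near it, and the other is summed over the grid.\<close>

lemma sup_bnd2_null:
  assumes M: "M \<ge> 1" and f: "f \<in> sup_X" and null: "sup.null_mod 1 f" and \<epsilon>: "0 < \<epsilon>"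
  shows "\<exists>m0. \<forall>m\<ge>m0. \<forall>F. meas2 F \<longrightarrow>
        (\<forall>x l. norm (F x l) \<le> (\<Sum>i<M * m. norm (f x - f (l + grid (M * m) i)) *
            norm (avg_exp m (x - l - grid (M * m) i)) ^ 4)) \<longrightarrow>
        sup_bnd2 F \<epsilon>"
proof -
  have fper: "f (x + 2 * pi) = f x" for x using f by (simp add: sup_X_iff periodic_2pi_def)
  define \<epsilon>1 where "\<epsilon>1 = \<epsilon> / (2 * real M)"
  have \<epsilon>1: "\<epsilon>1 > 0" "real M * \<epsilon>1 = \<epsilon> / 2" using \<epsilon> M by (auto simp: \<epsilon>1_def)
  obtain \<delta> where \<delta>: "\<delta> > 0" and d: "\<And>t. 0 < t \<Longrightarrow> t < \<delta> \<Longrightarrow> sup_nq (\<lambda>x. f x - f (x + t)) \<le> \<epsilon>1"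
    using null[unfolded sup.null_mod_def fdiff_1, rule_format, OF \<epsilon>1(1)] by (elim exE conjE) simp
  have near: "norm (f x - f (x - u)) \<le> \<epsilon>1" if "\<bar>u\<bar> < \<delta>" for x u
  proof -
    consider "u = 0" | "u < 0" | "u > 0" by linarith
    then show ?thesis
    proof cases
      case 1 then show ?thesis using \<epsilon>1 by simp
    next
      case 2
      have "norm (f x - f (x + (- u))) \<le> sup_nq (\<lambda>x. f x - f (x + (- u)))"
        by (rule norm_le_sup_nq) (rule sup.X_diff[OF f sup.X_shift[OF f]])
      also have "\<dots> \<le> \<epsilon>1" using 2 that by (intro d) auto
      finally show ?thesis by simp
    next
      case 3
      have "norm (f x - f (x + (- u))) \<le> sup_nq (\<lambda>x. f x - f (x + (- u)))"
        by (rule norm_le_sup_nq) (rule sup.X_diff[OF f sup.X_shift[OF f]])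
      also have "\<dots> = sup_nq (\<lambda>x. f x - f (x + u))" using sup.nq_fdiff_minus[OF f, of u] by simp
      also have "\<dots> \<le> \<epsilon>1" using 3 that by (intro d) auto
      finally show ?thesis by simp
    qed
  qed
  define B where "B = 2 * sup_nq f"
  have B: "B \<ge> 0" by (simp add: B_def sup_nq_nonneg)
  define R where "R m = (6 / \<delta> * (1 / real m))\<^sup>2" for m :: nat
  have "(\<lambda>m. real M * (R m * B)) \<longlonglongrightarrow> real M * ((6 / \<delta> * 0)\<^sup>2 * B)"
    unfolding R_def by (intro tendsto_mult tendsto_power tendsto_const lim_1_over_n)
  then have "eventually (\<lambda>m. real M * (R m * B) < \<epsilon> / 2) sequentially"
    by (rule order_tendstoD(2)) (use \<epsilon> in auto)
  then obtain m0 where m0: "\<And>m. m \<ge> m0 \<Longrightarrow> real M * (R m * B) < \<epsilon> / 2"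
    unfolding eventually_sequentially by blast
  show ?thesis
  proof (intro exI[of _ "max 1 m0"] allI impI)
    fix m F assume "max 1 m0 \<le> m" and F: "meas2 F"
      and F_le: "\<forall>x l. norm (F x l) \<le> (\<Sum>i<M * m. norm (f x - f (l + grid (M * m) i)) *
            norm (avg_exp m (x - l - grid (M * m) i)) ^ 4)"
    then have m: "m \<ge> 1" "m \<ge> m0" by auto
    define N where "N = M * m"
    have N: "m \<le> N" "real N / real m = real M" using M m by (auto simp: N_def)
    have Gper: "avg_exp m (u + 2 * pi) = avg_exp m u" for u
      using trig_poly_periodic[OF avg_exp_trig_poly] by (simp add: periodic_2pi_def)
    have pt: "norm (f x - f y) * norm (avg_exp m (x - y)) ^ 4 \<le> (\<epsilon>1 + R m * B) * (norm (avg_exp m (x - y)))\<^sup>2" for x y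
    proof -
      \<comment> \<open>Reduction of \<open>x - y\<close> modulo \<open>2 * pi\<close> to
        \<open>[-pi, pi]\<close>, where the decay estimate of the kernel is valid.\<close>
      define k where "k = \<lfloor>(x - y + pi) / (2 * pi)\<rfloor>"
      define u where "u = x - y - 2 * pi * of_int k"
      have "of_int k \<le> (x - y + pi) / (2 * pi)" "(x - y + pi) / (2 * pi) < of_int k + 1"
        unfolding k_def by linarith+
      then have u: "\<bar>u\<bar> \<le> pi" unfolding u_def abs_le_iff by (simp_all add: field_simps)
      have Gu: "avg_exp m (x - y) = avg_exp m u"
        using periodic_mod_2pi[of "avg_exp m" u k, OF Gper] by (simp add: u_def)
      have fu: "f y = f (x - u)"
        using periodic_mod_2pi[of f y k, OF fper] by (simp add: u_def)
      have "norm (f x - f (x - u)) * (norm (avg_exp m u))\<^sup>2 \<le> \<epsilon>1 + R m * B"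
      proof (cases "\<bar>u\<bar> < \<delta>")
        case True
        have "norm (f x - f (x - u)) * (norm (avg_exp m u))\<^sup>2 \<le> \<epsilon>1 * 1"
          using near[OF True, of x] norm_avg_exp_le_1[of m u] \<epsilon>1 by (intro mult_mono) (auto simp: power_le_one)
        also have "\<dots> \<le> \<epsilon>1 + R m * B" using B by (simp add: R_def)
        finally show ?thesis .
      next
        case False
        have "norm (avg_exp m u) * \<delta> \<le> norm (avg_exp m u) * \<bar>u\<bar>" using False by (intro mult_left_mono) auto
        also have "\<dots> \<le> 6 / real m" by (rule norm_avg_exp_decay[OF u])
        finally have "norm (avg_exp m u) \<le> 6 / real m / \<delta>" using \<delta> by (simp only: pos_le_divide_eq)
        also have "\<dots> = 6 / \<delta> * (1 / real m)" by simp
        finally have "norm (avg_exp m u) \<le> 6 / \<delta> * (1 / real m)" .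
        then have "(norm (avg_exp m u))\<^sup>2 \<le> R m" unfolding R_def by (intro power_mono) auto
        moreover have "norm (f x - f (x - u)) \<le> B"
          using norm_triangle_ineq4[of "f x" "f (x - u)"] norm_le_sup_nq[OF f, of x] norm_le_sup_nq[OF f, of "x - u"]
          unfolding B_def by linarith
        ultimately have "norm (f x - f (x - u)) * (norm (avg_exp m u))\<^sup>2 \<le> B * R m" using B by (intro mult_mono) auto
        then show ?thesis using \<epsilon>1 by (simp add: mult.commute)
      qed
      then have "norm (f x - f (x - u)) * (norm (avg_exp m u))\<^sup>2 * (norm (avg_exp m u))\<^sup>2 \<le> (\<epsilon>1 + R m * B) * (norm (avg_exp m u))\<^sup>2"
        by (intro mult_right_mono) auto
      moreover have "norm (avg_exp m u) ^ 4 = (norm (avg_exp m u))\<^sup>2 * (norm (avg_exp m u))\<^sup>2"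
        using power_add[of "norm (avg_exp m u)" 2 2] by simp
      ultimately show ?thesis by (simp only: Gu fu mult.assoc)
    qed
    have "norm (F x l) \<le> \<epsilon>" for x l
    proof -
      have "norm (F x l) \<le> (\<Sum>i<N. norm (f x - f (l + grid N i)) * norm (avg_exp m (x - (l + grid N i))) ^ 4)"
        using F_le[rule_format, of x l] by (simp add: N_def diff_diff_eq)
      also have "\<dots> \<le> (\<Sum>i<N. (\<epsilon>1 + R m * B) * (norm (avg_exp m (x - (l + grid N i))))\<^sup>2)"
        by (intro sum_mono pt)
      also have "\<dots> = (\<epsilon>1 + R m * B) * (\<Sum>i<N. (norm (avg_exp m (x - l - grid N i)))\<^sup>2)"
        by (simp add: sum_distrib_left diff_diff_eq)
      also have "\<dots> = (\<epsilon>1 + R m * B) * real M" using sum_norm_avg_exp_sq[OF m(1) N(1), of "x - l"] N(2) by simp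
      also have "\<dots> \<le> \<epsilon>" using m0[OF m(2)] \<epsilon>1(2) by (simp add: algebra_simps)
      finally show ?thesis .
    qed
    then show "sup_bnd2 F \<epsilon>" using F by (simp add: sup_bnd2_def)
  qed
qed

interpretation sup: sampling_quasinorm sup_X sup_nq 1 sup_bnd2 4
proof
  fix F G :: "real \<Rightarrow> real \<Rightarrow> complex" and f a b c
  show "f \<in> sup_X \<Longrightarrow> f \<in> borel_measurable borel" by (simp add: sup_X_iff)
  show "sup_bnd2 (\<lambda>x l. F x l + G x l) (a + b)" if FG: "sup_bnd2 F a" "sup_bnd2 G b"
  proof -
    have "norm (F x l + G x l) \<le> a + b" for x l
      using FG unfolding sup_bnd2_def by (intro norm_triangle_mono) blast+
    moreover have "meas2 (\<lambda>x l. F x l + G x l)"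
      using FG by (auto simp: sup_bnd2_def meas2_def periodic_2pi_def case_prod_beta)
    ultimately show ?thesis by (simp add: sup_bnd2_def)
  qed
  show "sup_bnd2 F a \<Longrightarrow> a \<le> b \<Longrightarrow> sup_bnd2 F b" unfolding sup_bnd2_def by (meson order.trans)
  show "sup_bnd2 (\<lambda>x l. f x) c \<Longrightarrow> sup_nq f \<le> c" by (auto simp: sup_bnd2_def intro: sup_nq_least)
  show "\<exists>l. (\<lambda>x. F x l) \<in> sup_X \<and> sup_nq (\<lambda>x. F x l) \<le> 2 * c" if F: "sup_bnd2 F c" and c: "0 < c"
  proof -
    have "(\<lambda>(x, l). F x l) \<in> borel_measurable (borel \<Otimes>\<^sub>M borel)" using F by (simp add: sup_bnd2_def meas2_def)
    from measurable_Pair_compose_split[OF this measurable_ident measurable_const[of 0]]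
    have "(\<lambda>x. F x 0) \<in> sup_X" using F by (auto simp: sup_X_iff sup_bnd2_def meas2_def)
    moreover have "sup_nq (\<lambda>x. F x 0) \<le> 2 * c"
    proof (rule sup_nq_least)
      fix x
      have "norm (F x 0) \<le> c" using F by (simp add: sup_bnd2_def)
      then show "norm (F x 0) \<le> 2 * c" using c by simp
    qed
    ultimately show ?thesis by blast
  qed
qed (fact sup_bnd2_sample sup_bnd2_null | simp)+

section \<open>Comparison of the moduli \<open>\<theta>\<close>\<close>

text \<open>Turns an implication between real bounds into an inequality between extended reals. The
  infinite case is trivial, and for \<open>x = 0\<close> arbitrarily small positive bounds are
  available.\<close>

lemma ennreal_le_scaleI:
  fixes x y :: ennreal
  assumes "0 < M" and le: "\<And>A. 0 < A \<Longrightarrow> x \<le> ennreal A \<Longrightarrow> y \<le> ennreal (M * A)"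
  shows "y \<le> ennreal M * x"
proof (cases x)
  case (real a)
  show ?thesis
  proof (rule ennreal_le_epsilon)
    fix e :: real assume e: "0 < e"
    have "y \<le> ennreal (M * (a + e / M))"
      using real e \<open>0 < M\<close> by (intro le) (auto intro: add_nonneg_pos ennreal_leI)
    also have "M * (a + e / M) = M * a + e" using \<open>0 < M\<close> by (simp add: field_simps)
    also have "ennreal (M * a + e) = ennreal M * x + ennreal e"
      using real e \<open>0 < M\<close> by (simp add: ennreal_plus ennreal_mult)
    finally show "y \<le> ennreal M * x + ennreal e" .
  qed
next
  case top
  then show ?thesis using \<open>0 < M\<close> by (simp add: ennreal_mult_top)
qed

lemma powr_inverse_le_iff:
  fixes x y q :: real
  assumes "0 \<le> x" "0 \<le> y" "0 < q"
  shows "x powr (1 / q) \<le> y \<longleftrightarrow> x \<le> y powr q"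
proof
  assume "x powr (1 / q) \<le> y"
  then have "(x powr (1 / q)) powr q \<le> y powr q" using assms by (intro powr_mono2) auto
  then show "x \<le> y powr q" using assms by (simp add: powr_powr)
next
  assume "x \<le> y powr q"
  then have "x powr (1 / q) \<le> (y powr q) powr (1 / q)" using assms by (intro powr_mono2) auto
  then show "x powr (1 / q) \<le> y" using assms by (simp add: powr_powr)
qed

context sampling_quasinorm
begin

text \<open>\<open>norm\<close> is the link between the extended norm of the statement and the
  abstract \<open>nq\<close>; each of the two instances supplies it.\<close>

context
  fixes p :: ennreal and \<alpha> :: real
  assumes norm: "\<And>g. g \<in> X \<Longrightarrow> Lp_norm p g = ennreal (nq g powr (1 / q))"
    and \<alpha>: "0 < \<alpha>"
begin

lemma Lp_norm_le_iff:
  assumes "g \<in> X" "0 \<le> A" "0 < t"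
  shows "Lp_norm p g \<le> ennreal (A * t powr \<alpha>) \<longleftrightarrow> nq g \<le> A powr q * t powr (\<alpha> * q)"
proof -
  have "Lp_norm p g \<le> ennreal (A * t powr \<alpha>) \<longleftrightarrow> nq g powr (1 / q) \<le> A * t powr \<alpha>"
    using assms by (simp add: norm)
  also have "\<dots> \<longleftrightarrow> nq g \<le> (A * t powr \<alpha>) powr q"
    using assms q_pos by (intro powr_inverse_le_iff) auto
  also have "(A * t powr \<alpha>) powr q = A powr q * t powr (\<alpha> * q)"
    using assms by (simp add: powr_mult powr_powr)
  finally show ?thesis .
qed

lemma scaled_le_iff:
  assumes "0 < h" "0 \<le> A"
  shows "ennreal (h powr (- \<alpha>)) * x \<le> ennreal A \<longleftrightarrow> x \<le> ennreal (A * h powr \<alpha>)"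
proof
  assume "ennreal (h powr (- \<alpha>)) * x \<le> ennreal A"
  then have "ennreal (h powr \<alpha>) * (ennreal (h powr (- \<alpha>)) * x) \<le> ennreal (h powr \<alpha>) * ennreal A"
    by (rule mult_left_mono) simp
  moreover have "ennreal (h powr \<alpha>) * (ennreal (h powr (- \<alpha>)) * x) = x"
  proof -
    have "h powr \<alpha> * h powr (- \<alpha>) = 1" using assms by (simp add: powr_add[symmetric])
    then show ?thesis by (simp add: mult.assoc[symmetric] flip: ennreal_mult)
  qed
  ultimately show "x \<le> ennreal (A * h powr \<alpha>)" using assms by (simp add: ennreal_mult mult.commute)
next
  assume "x \<le> ennreal (A * h powr \<alpha>)"
  then have "ennreal (h powr (- \<alpha>)) * x \<le> ennreal (h powr (- \<alpha>)) * ennreal (A * h powr \<alpha>)"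
    by (rule mult_left_mono) simp
  also have "\<dots> = ennreal A"
  proof -
    have "h powr (- \<alpha>) * (A * h powr \<alpha>) = A * (h powr (- \<alpha>) * h powr \<alpha>)" by simp
    also have "h powr (- \<alpha>) * h powr \<alpha> = 1" using assms by (simp add: powr_add[symmetric])
    finally show ?thesis using assms by (simp flip: ennreal_mult)
  qed
  finally show "ennreal (h powr (- \<alpha>)) * x \<le> ennreal A" .
qed

text \<open>In \<open>theta_mod\<close> the step is strictly below \<open>h\<close>; letting \<open>h\<close> decrease to the step \<open>t\<close> recovers
  the weight \<open>t powr (- \<alpha>)\<close>.\<close>

lemma theta_mod_le_iff:
  assumes f: "f \<in> X" and A: "0 \<le> A"
  shows "theta_mod k \<alpha> p f \<delta> \<le> ennreal A \<longleftrightarrow> hol k (\<alpha> * q) (A powr q) \<delta> f"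
proof
  assume hol: "hol k (\<alpha> * q) (A powr q) \<delta> f"
  show "theta_mod k \<alpha> p f \<delta> \<le> ennreal A"
    unfolding theta_mod_def
  proof (rule SUP_least)
    fix h assume h: "h \<in> {0<..\<delta>}"
    have "modulus k p f h \<le> ennreal (A * h powr \<alpha>)"
      unfolding modulus_def
    proof (rule SUP_least)
      fix t assume t: "t \<in> {0<..<h}"
      have "nq (fdiff k t f) \<le> A powr q * t powr (\<alpha> * q)" using hol h t by (auto simp: hol_def)
      then have "Lp_norm p (fdiff k t f) \<le> ennreal (A * t powr \<alpha>)"
        using t f A by (subst Lp_norm_le_iff) auto
      also have "\<dots> \<le> ennreal (A * h powr \<alpha>)"
        using t A \<alpha> by (intro ennreal_leI mult_left_mono powr_mono2) auto
      finally show "Lp_norm p (fdiff k t f) \<le> ennreal (A * h powr \<alpha>)" .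
    qed
    then show "ennreal (h powr - \<alpha>) * modulus k p f h \<le> ennreal A"
      using h A by (subst scaled_le_iff) auto
  qed
next
  assume th: "theta_mod k \<alpha> p f \<delta> \<le> ennreal A"
  show "hol k (\<alpha> * q) (A powr q) \<delta> f"
    unfolding hol_def
  proof (intro allI impI)
    fix t assume t: "0 < t \<and> t < \<delta>"
    have *: "nq (fdiff k t f) \<le> A powr q * h powr (\<alpha> * q)" if h: "t < h" "h < \<delta>" for h
    proof -
      have "ennreal (h powr - \<alpha>) * modulus k p f h \<le> theta_mod k \<alpha> p f \<delta>"
        unfolding theta_mod_def using h t by (intro SUP_upper) auto
      with th have "ennreal (h powr - \<alpha>) * modulus k p f h \<le> ennreal A" by (rule order.trans[rotated])
      then have "modulus k p f h \<le> ennreal (A * h powr \<alpha>)"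
        using h t A by (subst (asm) scaled_le_iff) auto
      moreover have "Lp_norm p (fdiff k t f) \<le> modulus k p f h"
        unfolding modulus_def using h t by (intro SUP_upper) auto
      ultimately have "Lp_norm p (fdiff k t f) \<le> ennreal (A * h powr \<alpha>)" by (rule order.trans[rotated])
      then show ?thesis using h t f A by (subst (asm) Lp_norm_le_iff) auto
    qed
    show "nq (fdiff k t f) \<le> A powr q * t powr (\<alpha> * q)"
    proof (rule tendsto_lowerbound)
      show "((\<lambda>h. A powr q * h powr (\<alpha> * q)) \<longlongrightarrow> A powr q * t powr (\<alpha> * q)) (at_right t)"
        using t by (intro tendsto_intros) auto
      have "eventually (\<lambda>h. h \<in> {t<..<\<delta>}) (at_right t)"
        using t eventually_at_right_real by blast
      then show "eventually (\<lambda>h. nq (fdiff k t f) \<le> A powr q * h powr (\<alpha> * q)) (at_right t)"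
        by eventually_elim (auto intro: *)
    qed simp
  qed
qed

lemma H_seminorm_le_iff:
  assumes g: "g \<in> X" and A: "0 \<le> A"
  shows "H_seminorm p r \<alpha> g \<le> ennreal A \<longleftrightarrow> (\<forall>h>0. nq (fdiff r h g) \<le> A powr q * h powr (\<alpha> * q))"
proof -
  have "H_seminorm p r \<alpha> g \<le> ennreal A \<longleftrightarrow> (\<forall>h>0. ennreal (h powr (- \<alpha>)) * Lp_norm p (fdiff r h g) \<le> ennreal A)"
    by (auto simp: H_seminorm_def SUP_le_iff)
  also have "\<dots> \<longleftrightarrow> (\<forall>h>0. nq (fdiff r h g) \<le> A powr q * h powr (\<alpha> * q))"
    using g A by (auto simp: scaled_le_iff Lp_norm_le_iff X_fdiff)
  finally show ?thesis .
qed

lemma comparison_if_approx: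
  assumes r: "\<alpha> < real r" and s: "1 \<le> s" and f: "f \<in> X" and k: "1 \<le> k" and L: "0 < L"
    and le: "\<And>n. n \<ge> 1 \<Longrightarrow> theta_mod s \<alpha> p f (1 / real n) \<le> ennreal L * best_approx n p r \<alpha> f"
  shows "\<exists>M>0. \<forall>h. 0 < h \<and> h \<le> 1 \<longrightarrow> theta_mod s \<alpha> p f h \<le> ennreal M * theta_mod k \<alpha> p f h"
proof -
  define \<beta> where "\<beta> = \<alpha> * q"
  have \<beta>: "0 < \<beta>" "\<beta> < q * real r" using \<alpha> r q_pos by (auto simp: \<beta>_def)
  obtain C where C: "C > 0" and jack: "\<forall>n\<ge>1. \<forall>A>0. \<forall>f\<in>X. hol k \<beta> A (1 / real n) f \<longrightarrow>
    (\<exists>T\<in>trig_poly n. nq (\<lambda>x. f x - T x) \<le> C * A \<and> (\<forall>h>0. nq (fdiff r h (\<lambda>x. f x - T x)) \<le> C * A * h powr \<beta>))"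
    using jackson_hoelder[OF k \<beta>] by (elim exE conjE)
  have "hol s \<beta> ((2 * L) powr q * C * A) (1 / real n) f"
    if n: "n \<ge> 1" and A: "0 < A" and hol: "hol k \<beta> A (1 / real n) f" for n A
  proof -
    \<comment> \<open>\<open>nq\<close> is a q-th power, so a bound \<open>C * A\<close> on its
      scale is the bound \<open>B\<close> for the norm.\<close>
    define B where "B = (C * A) powr (1 / q)"
    have B: "B \<ge> 0" "B powr q = C * A" using C A q_pos by (auto simp: B_def powr_powr)
    from jack[rule_format, OF n A f hol]
    obtain T where T: "T \<in> trig_poly n" and 1: "nq (\<lambda>x. f x - T x) \<le> C * A"
      and 2: "\<forall>h>0. nq (fdiff r h (\<lambda>x. f x - T x)) \<le> C * A * h powr \<beta>" by (elim bexE conjE)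
    have gX: "(\<lambda>x. f x - T x) \<in> X" using f X_trig_poly[OF T] by auto
    have "Lp_norm p (\<lambda>x. f x - T x) \<le> ennreal B"
      using 1 B q_pos unfolding norm[OF gX] by (intro ennreal_leI) (simp add: powr_inverse_le_iff)
    moreover have "H_seminorm p r \<alpha> (\<lambda>x. f x - T x) \<le> ennreal B"
      using 2 B by (subst H_seminorm_le_iff[OF gX]) (auto simp: \<beta>_def)
    ultimately have "H_norm p r \<alpha> (\<lambda>x. f x - T x) \<le> ennreal B + ennreal B" unfolding H_norm_def by (rule add_mono)
    moreover have "best_approx n p r \<alpha> f \<le> H_norm p r \<alpha> (\<lambda>x. f x - T x)"
      unfolding best_approx_def by (rule INF_lower[OF T])
    ultimately have "best_approx n p r \<alpha> f \<le> ennreal (2 * B)"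
      using B by (auto simp flip: ennreal_plus intro: order.trans)
    then have "ennreal L * best_approx n p r \<alpha> f \<le> ennreal L * ennreal (2 * B)" by (rule mult_left_mono) simp
    with le[OF n] have "theta_mod s \<alpha> p f (1 / real n) \<le> ennreal L * ennreal (2 * B)" by (rule order.trans)
    also have "\<dots> = ennreal (2 * L * B)" using L B by (simp add: ennreal_mult[symmetric] mult_ac)
    finally have "hol s \<beta> ((2 * L * B) powr q) (1 / real n) f"
      using L B unfolding \<beta>_def by (subst (asm) theta_mod_le_iff[OF f]) auto
    then show ?thesis using L B by (simp add: powr_mult mult.assoc)
  qed
  from theta_comparison_real_steps[OF f s \<beta>(1) this]
  obtain M where M: "\<And>h A. 0 < h \<Longrightarrow> h \<le> 1 \<Longrightarrow> 0 < A \<Longrightarrow> hol k \<beta> A h f \<Longrightarrow> hol s \<beta> (M * A) h f" by blast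
  \<comment> \<open>\<open>M\<close> may be negative or 0; the maximum with 1 yields a positive
    constant.\<close>
  define N where "N = (max M 1) powr (1 / q)"
  have N: "N > 0" "N powr q = max M 1" using q_pos by (auto simp: N_def powr_powr)
  show ?thesis
  proof (intro exI[of _ N] conjI allI impI N(1))
    fix h :: real assume h: "0 < h \<and> h \<le> 1"
    show "theta_mod s \<alpha> p f h \<le> ennreal N * theta_mod k \<alpha> p f h"
    proof (rule ennreal_le_scaleI[OF N(1)])
      fix A :: real assume A: "0 < A" and "theta_mod k \<alpha> p f h \<le> ennreal A"
      then have "hol k \<beta> (A powr q) h f" unfolding \<beta>_def by (subst (asm) theta_mod_le_iff[OF f]) auto
      then have "hol s \<beta> (M * A powr q) h f" using h A by (intro M) auto
      moreover have "M * A powr q \<le> (N * A) powr q"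
        using A N by (simp add: powr_mult mult_right_mono)
      ultimately have "hol s \<beta> ((N * A) powr q) h f" by (rule hol_mono) simp
      then show "theta_mod s \<alpha> p f h \<le> ennreal (N * A)"
        using A N unfolding \<beta>_def by (subst theta_mod_le_iff[OF f]) auto
    qed
  qed
qed

lemma approx_if_comparison:
  assumes r: "1 \<le> r" "\<alpha> < real r" and s: "1 \<le> s" "\<alpha> \<le> real s" and f: "f \<in> X" and k: "1 \<le> k"
    and ks: "real s + 1 / q - 1 < real k" and M: "0 < M"
    and fin: "H_seminorm p r \<alpha> f < \<infinity>"
    and le: "\<And>h. 0 < h \<Longrightarrow> h \<le> 1 \<Longrightarrow> theta_mod s \<alpha> p f h \<le> ennreal M * theta_mod k \<alpha> p f h"
  shows "\<exists>L>0. \<forall>n\<ge>1. theta_mod s \<alpha> p f (1 / real n) \<le> ennreal L * best_approx n p r \<alpha> f"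
proof -
  define \<beta> where "\<beta> = \<alpha> * q"
  have \<beta>: "0 < \<beta>" "\<beta> < q * real r" "\<beta> \<le> q * real s" using \<alpha> r s q_pos by (auto simp: \<beta>_def)
  have "q * (real s + 1 / q - 1) < q * real k" using ks q_pos by (intro mult_strict_left_mono)
  then have ks': "q * (real s - 1) + 1 < q * real k" using q_pos by (simp add: algebra_simps)
  obtain A0 where A0: "0 < A0" "H_seminorm p r \<alpha> f \<le> ennreal A0"
  proof -
    obtain a where "H_seminorm p r \<alpha> f = ennreal a" "0 \<le> a" using fin by (cases "H_seminorm p r \<alpha> f") auto
    \<comment> \<open>The seminorm may be 0, while \<open>theta_le_approx\<close> asks for a
      positive bound.\<close>
    then show ?thesis by (intro that[of "a + 1"]) (auto intro: ennreal_leI)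
  qed
  have hol_r: "hol r \<beta> (A0 powr q) \<delta> f" for \<delta>
    using A0 H_seminorm_le_iff[OF f, of A0 r] by (simp add: hol_def \<beta>_def)
  have cmp: "hol s \<beta> (M powr q * A) h f" if h: "0 < h" "h \<le> 1" and A: "0 < A" and hol: "hol k \<beta> A h f" for h A
  proof -
    define B where "B = A powr (1 / q)"
    have B: "0 \<le> B" "B powr q = A" using A q_pos by (auto simp: B_def powr_powr)
    have "theta_mod k \<alpha> p f h \<le> ennreal B" using hol B unfolding \<beta>_def by (subst theta_mod_le_iff[OF f]) auto
    then have "ennreal M * theta_mod k \<alpha> p f h \<le> ennreal M * ennreal B" by (rule mult_left_mono) simp
    with le[OF h] have "theta_mod s \<alpha> p f h \<le> ennreal M * ennreal B" by (rule order.trans)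
    also have "\<dots> = ennreal (M * B)" using M B by (simp add: ennreal_mult)
    finally have "hol s \<beta> ((M * B) powr q) h f" using M B unfolding \<beta>_def by (subst (asm) theta_mod_le_iff[OF f]) auto
    then show ?thesis using M B by (simp add: powr_mult)
  qed
  have pos: "0 < M powr q" "0 < A0 powr q" using M A0 by auto
  have "\<exists>L>0. \<forall>n\<ge>1. \<forall>T\<in>trig_poly n. \<forall>E>0.
    (\<forall>h>0. nq (fdiff r h (\<lambda>x. f x - T x)) \<le> E * h powr \<beta>) \<longrightarrow> hol s \<beta> (L * E) (1 / real n) f"
    by (rule theta_le_approx[OF f r(1) k s(1) \<beta> ks' pos hol_r]) (rule cmp)
  then obtain L0 where L0: "L0 > 0" and main: "\<forall>n\<ge>1. \<forall>T\<in>trig_poly n. \<forall>E>0.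
    (\<forall>h>0. nq (fdiff r h (\<lambda>x. f x - T x)) \<le> E * h powr \<beta>) \<longrightarrow> hol s \<beta> (L0 * E) (1 / real n) f"
    by (elim exE conjE)
  define L where "L = L0 powr (1 / q) * 2"
  have L: "L > 0" using L0 by (simp add: L_def)
  show ?thesis
  proof (intro exI[of _ L] conjI allI impI L)
    fix n :: nat assume n: "n \<ge> 1"
    show "theta_mod s \<alpha> p f (1 / real n) \<le> ennreal L * best_approx n p r \<alpha> f"
    proof (rule ennreal_le_scaleI[OF L])
      fix A :: real assume A: "0 < A" and best: "best_approx n p r \<alpha> f \<le> ennreal A"
      \<comment> \<open>The infimum need not be attained; some polynomial stays below the strictly
        larger \<open>2 * A\<close>, whence the factor 2 in \<open>L\<close>.\<close>
      have "ennreal A < ennreal (2 * A)" using A by (simp add: ennreal_less_iff)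
      with best have "best_approx n p r \<alpha> f < ennreal (2 * A)" by (rule le_less_trans)
      then obtain T where T: "T \<in> trig_poly n" and H: "H_norm p r \<alpha> (\<lambda>x. f x - T x) < ennreal (2 * A)"
        unfolding best_approx_def by (auto simp: INF_less_iff)
      have gX: "(\<lambda>x. f x - T x) \<in> X" using f X_trig_poly[OF T] by auto
      have "H_seminorm p r \<alpha> (\<lambda>x. f x - T x) \<le> H_norm p r \<alpha> (\<lambda>x. f x - T x)"
        unfolding H_norm_def by simp
      also have "\<dots> \<le> ennreal (2 * A)" using H by (rule less_imp_le)
      finally have "\<forall>h>0. nq (fdiff r h (\<lambda>x. f x - T x)) \<le> (2 * A) powr q * h powr \<beta>"
        using A H_seminorm_le_iff[OF gX, of "2 * A" r] by (simp add: \<beta>_def)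
      moreover have "0 < (2 * A) powr q" using A by simp
      ultimately have "hol s \<beta> (L0 * (2 * A) powr q) (1 / real n) f" using main[rule_format, OF n T] by blast
      moreover have "L0 * (2 * A) powr q = (L * A) powr q"
        using L0 A q_pos by (simp add: L_def powr_mult powr_powr)
      ultimately show "theta_mod s \<alpha> p f (1 / real n) \<le> ennreal (L * A)"
        using A L unfolding \<beta>_def by (subst theta_mod_le_iff[OF f]) auto
    qed
  qed
qed

lemma theta_equivalence:
  assumes "1 \<le> r" "\<alpha> < real r" "1 \<le> s" "\<alpha> \<le> real s" "f \<in> X" "H_norm p r \<alpha> f < \<infinity>"
  shows "(\<exists>L::real. L > 0 \<and> (\<forall>n::nat. n \<ge> 1 \<longrightarrow>
            theta_mod s \<alpha> p f (1 / real n) \<le> ennreal L * best_approx n p r \<alpha> f))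
     \<longleftrightarrow> (\<exists>k::nat. k \<ge> 1 \<and> real k > real s + 1 / q - 1 \<and>
            (\<exists>M::real. M > 0 \<and> (\<forall>h::real. 0 < h \<and> h \<le> 1 \<longrightarrow>
                  theta_mod s \<alpha> p f h \<le> ennreal M * theta_mod k \<alpha> p f h)))"
    (is "?L \<longleftrightarrow> ?R")
proof
  assume ?L
  then obtain L where L: "0 < L"
    "\<And>n. n \<ge> 1 \<Longrightarrow> theta_mod s \<alpha> p f (1 / real n) \<le> ennreal L * best_approx n p r \<alpha> f" by blast
  \<comment> \<open>Every order \<open>k\<close> is admissible for this implication; one above the
    threshold is taken.\<close>
  obtain k0 :: nat where "real s + 1 / q - 1 < real k0" using reals_Archimedean2 by blast
  then have k: "1 \<le> Suc k0" "real s + 1 / q - 1 < real (Suc k0)" by auto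
  from comparison_if_approx[OF assms(2,3,5) k(1) L] k show ?R by blast
next
  assume ?R
  then obtain k M where k: "k \<ge> 1" "real s + 1 / q - 1 < real k" and M: "M > 0"
    "\<And>h. 0 < h \<Longrightarrow> h \<le> 1 \<Longrightarrow> theta_mod s \<alpha> p f h \<le> ennreal M * theta_mod k \<alpha> p f h" by blast
  have "H_seminorm p r \<alpha> f \<le> H_norm p r \<alpha> f" unfolding H_norm_def by simp
  then have "H_seminorm p r \<alpha> f < \<infinity>" using assms(6) by (rule le_less_trans)
  from approx_if_comparison[OF assms(1-5) k M(1) this M(2)] show ?L by blast
qed

end

end

section \<open>Borel representatives of Lebesgue measurable functions\<close>

lemma Lp_norm_lborel:
  assumes "p \<noteq> \<infinity>" and [measurable]: "f \<in> borel_measurable borel"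
  shows "Lp_norm p f = (let I = (\<integral>\<^sup>+x. ennreal (norm (f x) powr enn2real p) \<partial>circ)
    in if I = \<infinity> then \<infinity> else ennreal (enn2real I powr (1 / enn2real p)))"
  using assms(1) by (simp add: Lp_norm_def nn_integral_completion nn_integral_circ)

lemma Lp_norm_cong_AE:
  assumes "p \<noteq> \<infinity>" "AE x in lborel. f x = g x"
  shows "Lp_norm p f = Lp_norm p g"
proof -
  have "(\<integral>\<^sup>+x\<in>{0..<2 * pi}. ennreal (norm (f x) powr enn2real p) \<partial>lebesgue)
      = (\<integral>\<^sup>+x\<in>{0..<2 * pi}. ennreal (norm (g x) powr enn2real p) \<partial>lebesgue)"
    unfolding nn_integral_completion using assms(2) by (intro nn_integral_cong_AE) (auto elim: eventually_mono)
  then show ?thesis using assms(1) by (simp add: Lp_norm_def)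
qed

lemma AE_lborel_shift:
  fixes c :: real
  assumes "AE x in lborel. P x" shows "AE x in lborel. P (x + c)"
proof -
  from assms obtain N where N: "N \<in> null_sets lborel" "{x. \<not> P x} \<subseteq> N"
    by (auto simp: eventually_ae_filter)
  then have [measurable]: "N \<in> sets borel" by (auto simp: null_sets_def)
  have m: "(\<lambda>x. indicator N x :: ennreal) \<in> borel_measurable borel" by measurable
  have "emeasure lborel {x. x + c \<in> N} = (\<integral>\<^sup>+x. indicator N (x + c) \<partial>lborel)"
  proof -
    have "{x. x + c \<in> N} \<in> sets lborel" by measurable
    from nn_integral_indicator[OF this] show ?thesis by (simp add: indicator_def of_bool_def)
  qed
  also have "\<dots> = (\<integral>\<^sup>+x. indicator N x \<partial>lborel)" by (rule nn_integral_lborel_shift[OF m])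
  also have "\<dots> = emeasure lborel N" by (rule nn_integral_indicator) simp
  also have "\<dots> = 0" using N by (simp add: null_sets_def)
  finally have "{x. x + c \<in> N} \<in> null_sets lborel" by (intro null_setsI) measurable
  then show ?thesis by (rule AE_I') (use N in auto)
qed

lemma fdiff_cong_AE:
  assumes "AE x in lborel. f x = g x"
  shows "AE x in lborel. fdiff k h f x = fdiff k h g x"
proof -
  have "AE x in lborel. \<forall>\<nu>\<in>{..k}. f (x + real \<nu> * h) = g (x + real \<nu> * h)"
    by (intro AE_finite_allI AE_lborel_shift[OF assms]) simp
  then show ?thesis by eventually_elim (auto simp: fdiff_def intro!: sum.cong)
qed

text \<open>Borel measurability makes compositions such as \<open>f (x + l)\<close> jointly
  measurable in \<open>x\<close> and \<open>l\<close>. A Borel version is made periodic by extending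
  its values from one period; the exceptional set stays null, being covered by countably many
  translates of a null set.\<close>

lemma borel_representative:
  assumes per: "periodic_2pi f" and f: "f \<in> borel_measurable lebesgue"
  obtains g where "periodic_2pi g" "g \<in> borel_measurable borel" "AE x in lborel. f x = g x"
proof -
  have "(\<lambda>x. Re (f x)) \<in> borel_measurable (completion lborel)" "(\<lambda>x. Im (f x)) \<in> borel_measurable (completion lborel)"
    using f by auto
  from this[THEN completion_ex_borel_measurable_real]
  obtain u v where [measurable]: "u \<in> borel_measurable lborel" "v \<in> borel_measurable lborel"
    and ae: "AE x in lborel. Re (f x) = u x" "AE x in lborel. Im (f x) = v x" by blast
  define w where "w x = Complex (u x) (v x)" for x
  have [measurable]: "w \<in> borel_measurable borel"
    unfolding w_def Complex_eq by measurable
  have w: "AE x in lborel. f x = w x"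
    using ae by eventually_elim (simp add: w_def complex_eq_iff)
  define g where "g x = w (x - 2 * pi * of_int \<lfloor>x / (2 * pi)\<rfloor>)" for x
  have "periodic_2pi g"
    unfolding periodic_2pi_def
  proof
    fix x
    have "(x + 2 * pi) / (2 * pi) = x / (2 * pi) + 1" by (simp add: add_divide_distrib)
    then have "\<lfloor>(x + 2 * pi) / (2 * pi)\<rfloor> = \<lfloor>x / (2 * pi)\<rfloor> + 1" by simp
    then show "g (x + 2 * pi) = g x" by (simp add: g_def algebra_simps)
  qed
  moreover have "g \<in> borel_measurable borel" unfolding g_def by measurable
  moreover have "AE x in lborel. f x = g x"
  proof -
    have "AE x in lborel. \<forall>k::int. f (x + (- (2 * pi * of_int k))) = w (x + (- (2 * pi * of_int k)))"
      unfolding AE_all_countable by (intro allI AE_lborel_shift[OF w])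
    then show ?thesis
    proof eventually_elim
      case (elim x)
      define k where "k = \<lfloor>x / (2 * pi)\<rfloor>"
      have "f (x - 2 * pi * of_int k + 2 * pi * of_int k) = f (x - 2 * pi * of_int k)"
        by (rule periodic_mod_2pi) (use per in \<open>simp add: periodic_2pi_def\<close>)
      then have "f x = f (x - 2 * pi * of_int k)" by simp
      also have "\<dots> = w (x - 2 * pi * of_int k)" using elim[rule_format, of k] by simp
      finally show ?case by (simp add: g_def k_def)
    qed
  qed
  ultimately show ?thesis by (rule that)
qed

theorem theorem3p3:
  fixes p :: ennreal and r s :: nat and \<alpha> p\<^sub>1 :: real and f :: "real \<Rightarrow> complex"
  assumes "0 < p" and "1 \<le> r" and "1 \<le> s" and "0 < \<alpha>" and "\<alpha> < real r" and "\<alpha> \<le> real s"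
    and "p\<^sub>1 = enn2real (min p 1)"
    and "f \<in> H_space p r \<alpha>"
  shows "(\<exists>L::real. L > 0 \<and>
            (\<forall>n::nat. n \<ge> 1 \<longrightarrow>
               theta_mod s \<alpha> p f (1 / real n) \<le> ennreal L * best_approx n p r \<alpha> f))
     \<longleftrightarrow>
         (\<exists>k::nat. k \<ge> 1 \<and> real k > real s + 1 / p\<^sub>1 - 1 \<and>
            (\<exists>M::real. M > 0 \<and>
               (\<forall>h::real. 0 < h \<and> h \<le> 1 \<longrightarrow>
                  theta_mod s \<alpha> p f h \<le> ennreal M * theta_mod k \<alpha> p f h)))"
proof (cases "p = \<infinity>")
  case True
  have p1: "p\<^sub>1 = 1" using assms(7) True by simp
  have norm: "Lp_norm p g = ennreal (sup_nq g powr (1 / 1))" if g: "g \<in> sup_X" for g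
  proof -
    have le: "(SUP x. ennreal (norm (g x))) \<le> ennreal (sup_nq g)"
      by (intro SUP_least ennreal_leI norm_le_sup_nq g)
    obtain a where a: "(SUP x. ennreal (norm (g x))) = ennreal a" "0 \<le> a"
      using le by (cases "SUP x. ennreal (norm (g x))") (auto simp: top_unique)
    have "ennreal (norm (g x)) \<le> ennreal a" for x unfolding a(1)[symmetric] by (rule SUP_upper) simp
    then have "sup_nq g \<le> a" using a(2) by (intro sup_nq_least) simp
    with le a have "(SUP x. ennreal (norm (g x))) = ennreal (sup_nq g)" by (simp add: ennreal_leI antisym)
    then show ?thesis using True by (simp add: Lp_norm_def sup_nq_nonneg)
  qed
  have per: "periodic_2pi f" and cont: "continuous_on UNIV f" and fin: "H_norm p r \<alpha> f < \<infinity>"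
    using assms(8) True by (auto simp: H_space_def Lp_def)
  have "norm (f x) \<le> (SUP y\<in>{0..2 * pi}. norm (f y))" for x
  proof -
    define k where "k = \<lfloor>x / (2 * pi)\<rfloor>"
    have "of_int k \<le> x / (2 * pi)" "x / (2 * pi) < of_int k + 1" unfolding k_def by linarith+
    then have y: "x - 2 * pi * of_int k \<in> {0..2 * pi}" by (simp add: field_simps)
    have "f (x - 2 * pi * of_int k + 2 * pi * of_int k) = f (x - 2 * pi * of_int k)"
      by (rule periodic_mod_2pi) (use per in \<open>simp add: periodic_2pi_def\<close>)
    then have "norm (f x) = norm (f (x - 2 * pi * of_int k))" by simp
    also have "\<dots> \<le> (SUP y\<in>{0..2 * pi}. norm (f y))"
    proof (rule cSUP_upper[OF y])
      have "compact ((\<lambda>y. norm (f y)) ` {0..2 * pi})"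
        by (intro compact_continuous_image continuous_on_norm continuous_on_subset[OF cont]) auto
      then show "bdd_above ((\<lambda>y. norm (f y)) ` {0..2 * pi})"
        by (intro bounded_imp_bdd_above compact_imp_bounded)
    qed
    finally show ?thesis .
  qed
  then have "f \<in> sup_X"
    using per cont by (auto simp: sup_X_iff intro: borel_measurable_continuous_onI)
  from sup.theta_equivalence[OF norm assms(4,2,5,3,6) this fin] show ?thesis by (simp only: p1)
next
  case False
  define p' where "p' = enn2real p"
  have p': "0 < p'" "p = ennreal p'"
    using False assms(1) by (auto simp: p'_def enn2real_positive_iff less_top)
  interpret lp_circle p' by unfold_locales (rule p'(1))
  have p1: "p\<^sub>1 = q"
    using assms(7) p' by (simp add: q_def min_def flip: ennreal_1)
  have norm: "Lp_norm p g = ennreal (nq g powr (1 / q))" if g: "g \<in> X" for g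
  proof -
    have "Lp_norm p g = ennreal (enn2real (Ip g) powr (1 / p'))"
      using g False by (subst Lp_norm_lborel) (auto simp: X_def Ip_def p'_def[symmetric] Let_def)
    also have "enn2real (Ip g) powr (1 / p') = nq g powr (1 / q)"
    proof -
      have "1 / P * (1 / q) = 1 / (q * P)" by simp
      also have "\<dots> = 1 / p'" by (simp only: P(3))
      finally show ?thesis by (simp only: nq_def powr_powr)
    qed
    finally show ?thesis .
  qed
  have per: "periodic_2pi f" and meas: "f \<in> borel_measurable lebesgue" and fin: "H_norm p r \<alpha> f < \<infinity>"
    and Lp: "Lp_norm p f < \<infinity>"
    using assms(8) False by (auto simp: H_space_def Lp_def)
  \<comment> \<open>\<open>f\<close> may be replaced by a Borel function: for finite
    \<open>p\<close> all norms in the statement, also those of differences, ignore null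
    sets.\<close>
  obtain g where g: "periodic_2pi g" "g \<in> borel_measurable borel" and ae: "AE x in lborel. f x = g x"
    using borel_representative[OF per meas] .
  have fd: "Lp_norm p (fdiff k h f) = Lp_norm p (fdiff k h g)" for k h
    by (rule Lp_norm_cong_AE[OF False fdiff_cong_AE[OF ae]])
  have theta: "theta_mod k \<alpha> p f h = theta_mod k \<alpha> p g h" for k h
    by (simp add: theta_mod_def modulus_def fd)
  have H: "H_norm p r \<alpha> (\<lambda>x. f x - T x) = H_norm p r \<alpha> (\<lambda>x. g x - T x)" for T
  proof -
    have ae': "AE x in lborel. f x - T x = g x - T x" using ae by eventually_elim simp
    show ?thesis
      unfolding H_norm_def H_seminorm_def
      using Lp_norm_cong_AE[OF False ae'] Lp_norm_cong_AE[OF False fdiff_cong_AE[OF ae']] by simp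
  qed
  have best: "best_approx n p r \<alpha> f = best_approx n p r \<alpha> g" for n
    by (simp add: best_approx_def H)
  have gfin: "H_norm p r \<alpha> g < \<infinity>" using fin H[of "\<lambda>x. 0"] by simp
  have "Lp_norm p g < \<infinity>" using Lp Lp_norm_cong_AE[OF False ae] by simp
  then have "Ip g < \<infinity>"
    using g False by (subst (asm) Lp_norm_lborel) (auto simp: Ip_def p'_def[symmetric] Let_def less_top split: if_splits)
  then have "g \<in> X" using g by (simp add: X_def)
  from theta_equivalence[OF norm assms(4,2,5,3,6) this gfin] show ?thesis unfolding theta best p1 .
qed

end
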